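(* Let $T\in L(\ell_2)$ be compact and let $X$ be an arbitrary separable infinite dimensional $\mathcal L_p$-space, where $1<p<\infty$. The operator $T$ factors as $T=T^{(2)}T^{(1)}$ through $X$ such that $T^{(1)}(\ell_2)\subset X$ is dense and both $T^{(1)}\in L(\ell_2,X)$ and $T^{(2)}\in L(X,\ell_2)$ are compact.
   Context: Banach spaces are over the same field, $\mathbb R$ or $\mathbb C$; $L(X,Y)$ denotes the bounded linear operators and $L(X)=L(X,X)$. A Banach space $X$ is an $\mathcal L_p$-space if there is $\lambda\ge1$ such that every finite dimensional subspace $M\subset X$ is contained in a finite dimensional subspace $N\subset X$ with $d(N,\ell_p^{\dim N})\le\lambda$, where $d$ is the Banach--Mazur distance. *)

theory Defs
  imports "HOL-Analysis.Analysis" "HOL-Library.Function_Algebras"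
begin

section \<open>Scalars\<close>

text \<open>
  The instances of this class are exactly the fields \<open>\<real>\<close> and \<open>\<complex>\<close> with their usual absolute values
  (up to isometric isomorphism), so that a statement over a scalar type of this class
  covers the real and the complex case simultaneously.
\<close>

class real_or_complex = real_normed_field + banach +
  assumes real_or_complex:
    "(\<forall>x. \<exists>r. x = r *\<^sub>R 1) \<or>
     (\<exists>i. i * i = - 1 \<and> (\<forall>a b. norm (a *\<^sub>R 1 + b *\<^sub>R i) = sqrt (a\<^sup>2 + b\<^sup>2)) \<and>
          (\<forall>x. \<exists>a b. x = a *\<^sub>R 1 + b *\<^sub>R i))"

instance real :: real_or_complex
  by standard simp

instance complex :: real_or_complex
proof
  have "\<i> * \<i> = - 1 \<and> (\<forall>a b. norm (a *\<^sub>R 1 + b *\<^sub>R \<i>) = sqrt (a\<^sup>2 + b\<^sup>2)) \<and>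
    (\<forall>x. \<exists>a b. x = a *\<^sub>R 1 + b *\<^sub>R \<i>)"
    by (auto simp: cmod_def complex_eq_iff)
  then show "(\<forall>x::complex. \<exists>r. x = r *\<^sub>R 1) \<or>
     (\<exists>i::complex. i * i = - 1 \<and> (\<forall>a b. norm (a *\<^sub>R 1 + b *\<^sub>R i) = sqrt (a\<^sup>2 + b\<^sup>2)) \<and>
          (\<forall>x. \<exists>a b. x = a *\<^sub>R 1 + b *\<^sub>R i))"
    by blast
qed

section \<open>Normed spaces over the scalar field\<close>

text \<open>
  The type classes only provide the underlying real normed space; the scalar multiplication
  by \<open>'k\<close> is an additional parameter compatible with it. A Banach space over \<open>'k\<close> is
  such a structure on a type of class \<open>banach\<close>.
\<close>

locale normed_space_over = vector_space scale
  for scale :: "'k::real_or_complex \<Rightarrow> 'x::real_normed_vector \<Rightarrow> 'x" +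
  assumes norm_scale: "norm (scale c x) = norm c * norm x"
    and scale_of_real: "scale (of_real r) x = r *\<^sub>R x"
begin

definition finite_dimensional :: "'x set \<Rightarrow> bool" where
  "finite_dimensional M \<longleftrightarrow> subspace M \<and> (\<exists>B. finite B \<and> span B = M)"

end

definition bounded_operator ::
  "('k::real_or_complex \<Rightarrow> 'x::real_normed_vector \<Rightarrow> 'x) \<Rightarrow> ('k \<Rightarrow> 'y::real_normed_vector \<Rightarrow> 'y) \<Rightarrow>
   ('x \<Rightarrow> 'y) \<Rightarrow> bool" where
  "bounded_operator s1 s2 T \<longleftrightarrow>
     Vector_Spaces.linear s1 s2 T \<and> (\<exists>C. \<forall>x. norm (T x) \<le> C * norm x)"

definition compact_operator ::
  "('k::real_or_complex \<Rightarrow> 'x::real_normed_vector \<Rightarrow> 'x) \<Rightarrow> ('k \<Rightarrow> 'y::real_normed_vector \<Rightarrow> 'y) \<Rightarrow>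
   ('x \<Rightarrow> 'y) \<Rightarrow> bool" where
  "compact_operator s1 s2 T \<longleftrightarrow>
     bounded_operator s1 s2 T \<and> compact (closure (T ` cball 0 1))"

section \<open>Banach--Mazur distance\<close>

text \<open>
  Normed spaces are given here by a carrier set, a scalar multiplication and a norm on the
  carrier, since both the subspaces of a Banach space and the spaces \<open>\<ell>\<^sub>p\<^sup>n\<close> with varying \<open>n\<close>
  are needed. The values are extended reals: the distance of non-isomorphic spaces is \<open>\<infinity>\<close>.
\<close>

definition operator_norm_on :: "'a set \<Rightarrow> ('a \<Rightarrow> real) \<Rightarrow> ('b \<Rightarrow> real) \<Rightarrow> ('a \<Rightarrow> 'b) \<Rightarrow> ereal" where
  "operator_norm_on M nM nN S = (SUP x\<in>{x\<in>M. nM x \<le> 1}. ereal (nN (S x)))"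

definition linear_isomorphism_on ::
  "'a::ab_group_add set \<Rightarrow> ('k \<Rightarrow> 'a \<Rightarrow> 'a) \<Rightarrow> 'b::ab_group_add set \<Rightarrow> ('k \<Rightarrow> 'b \<Rightarrow> 'b) \<Rightarrow>
   ('a \<Rightarrow> 'b) \<Rightarrow> bool" where
  "linear_isomorphism_on M sM N sN S \<longleftrightarrow>
     bij_betw S M N \<and> (\<forall>x\<in>M. \<forall>y\<in>M. S (x + y) = S x + S y) \<and>
     (\<forall>c. \<forall>x\<in>M. S (sM c x) = sN c (S x))"

definition banach_mazur_distance ::
  "'a::ab_group_add set \<Rightarrow> ('k \<Rightarrow> 'a \<Rightarrow> 'a) \<Rightarrow> ('a \<Rightarrow> real) \<Rightarrow>
   'b::ab_group_add set \<Rightarrow> ('k \<Rightarrow> 'b \<Rightarrow> 'b) \<Rightarrow> ('b \<Rightarrow> real) \<Rightarrow> ereal" where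
  "banach_mazur_distance M sM nM N sN nN =
     (INF S\<in>{S. linear_isomorphism_on M sM N sN S}.
        operator_norm_on M nM nN S * operator_norm_on N nN nM (inv_into M S))"

section \<open>The spaces \<open>\<ell>\<^sub>p\<^sup>n\<close> and \<open>\<L>\<^sub>p\<close>-spaces\<close>

text \<open>\<open>\<ell>\<^sub>p\<^sup>n\<close> consists of the sequences supported in \<open>{0..<n}\<close>, with pointwise operations.\<close>

definition lp_carrier :: "nat \<Rightarrow> (nat \<Rightarrow> 'k::real_or_complex) set" where
  "lp_carrier n = {a. \<forall>i\<ge>n. a i = 0}"

definition lp_scale :: "'k::real_or_complex \<Rightarrow> (nat \<Rightarrow> 'k) \<Rightarrow> (nat \<Rightarrow> 'k)" where
  "lp_scale c a = (\<lambda>i. c * a i)"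

definition lp_norm :: "real \<Rightarrow> nat \<Rightarrow> (nat \<Rightarrow> 'k::real_or_complex) \<Rightarrow> real" where
  "lp_norm p n a = (\<Sum>i<n. norm (a i) powr p) powr (1 / p)"

definition (in normed_space_over) script_Lp_space :: "real \<Rightarrow> bool" where
  "script_Lp_space p \<longleftrightarrow>
     (\<exists>C::real. C \<ge> 1 \<and>
        (\<forall>M. finite_dimensional M \<longrightarrow>
           (\<exists>N. finite_dimensional N \<and> M \<subseteq> N \<and>
                banach_mazur_distance N scale norm (lp_carrier (dim N)) lp_scale (lp_norm p (dim N))
                  \<le> ereal C)))"

section \<open>The Hilbert space \<open>\<ell>\<^sub>2\<close>\<close>

typedef (overloaded) 'k ell2 = "{x :: nat \<Rightarrow> 'k::real_or_complex. summable (\<lambda>i. (norm (x i))\<^sup>2)}"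
  morphisms coord Abs_ell2
  by (rule exI[of _ "\<lambda>_. 0"]) simp

setup_lifting type_definition_ell2

lemma summable_norm_square_add:
  fixes x y :: "nat \<Rightarrow> 'k::real_normed_vector"
  assumes "summable (\<lambda>i. (norm (x i))\<^sup>2)" "summable (\<lambda>i. (norm (y i))\<^sup>2)"
  shows "summable (\<lambda>i. (norm (x i + y i))\<^sup>2)"
proof (rule summable_comparison_test')
  show "summable (\<lambda>i. 2 * (norm (x i))\<^sup>2 + 2 * (norm (y i))\<^sup>2)"
    using assms by (intro summable_add summable_mult)
  fix i :: nat
  have "(norm (x i + y i))\<^sup>2 \<le> (norm (x i) + norm (y i))\<^sup>2"
    by (intro power_mono norm_triangle_ineq norm_ge_zero)
  also have "\<dots> \<le> 2 * (norm (x i))\<^sup>2 + 2 * (norm (y i))\<^sup>2"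
    using sum_squares_bound[of "norm (x i)" "norm (y i)"] by (simp add: power2_sum)
  finally show "norm ((norm (x i + y i))\<^sup>2) \<le> 2 * (norm (x i))\<^sup>2 + 2 * (norm (y i))\<^sup>2"
    by simp
qed

lemma summable_norm_square_mult:
  fixes x :: "nat \<Rightarrow> 'k::real_normed_field"
  assumes "summable (\<lambda>i. (norm (x i))\<^sup>2)"
  shows "summable (\<lambda>i. (norm (c * x i))\<^sup>2)"
  using summable_mult[OF assms, of "(norm c)\<^sup>2"] by (simp add: norm_mult power_mult_distrib)

lemma ell2_norm_triangle:
  fixes x y :: "nat \<Rightarrow> 'k::real_normed_vector"
  assumes x: "summable (\<lambda>i. (norm (x i))\<^sup>2)" and y: "summable (\<lambda>i. (norm (y i))\<^sup>2)"
  shows "sqrt (\<Sum>i. (norm (x i + y i))\<^sup>2) \<le> sqrt (\<Sum>i. (norm (x i))\<^sup>2) + sqrt (\<Sum>i. (norm (y i))\<^sup>2)"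
proof -
  let ?R = "sqrt (\<Sum>i. (norm (x i))\<^sup>2) + sqrt (\<Sum>i. (norm (y i))\<^sup>2)"
  have R0: "?R \<ge> 0"
    by (intro add_nonneg_nonneg real_sqrt_ge_zero suminf_nonneg x y) auto
  have "(\<Sum>i<n. (norm (x i + y i))\<^sup>2) \<le> ?R\<^sup>2" for n
  proof -
    have "L2_set (\<lambda>i. norm (x i + y i)) {..<n} \<le> L2_set (\<lambda>i. norm (x i) + norm (y i)) {..<n}"
      by (rule L2_set_mono) (auto intro: norm_triangle_ineq)
    also have "\<dots> \<le> L2_set (\<lambda>i. norm (x i)) {..<n} + L2_set (\<lambda>i. norm (y i)) {..<n}"
      by (rule L2_set_triangle_ineq)
    also have "\<dots> \<le> ?R"
      unfolding L2_set_def by (intro add_mono real_sqrt_le_mono sum_le_suminf x y) auto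
    finally have "sqrt (\<Sum>i<n. (norm (x i + y i))\<^sup>2) \<le> ?R"
      by (simp add: L2_set_def)
    then show ?thesis
      by (rule sqrt_le_D)
  qed
  then have "(\<Sum>i. (norm (x i + y i))\<^sup>2) \<le> ?R\<^sup>2"
    by (intro suminf_le_const summable_norm_square_add x y)
  then show ?thesis
    using R0 by (rule real_le_lsqrt[rotated])
qed

instantiation ell2 :: (real_or_complex) real_normed_vector
begin

lift_definition zero_ell2 :: "'a ell2" is "\<lambda>_. 0" by simp

lift_definition plus_ell2 :: "'a ell2 \<Rightarrow> 'a ell2 \<Rightarrow> 'a ell2" is "\<lambda>x y i. x i + y i"
  by (rule summable_norm_square_add)

lift_definition uminus_ell2 :: "'a ell2 \<Rightarrow> 'a ell2" is "\<lambda>x i. - x i" by simp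

lift_definition minus_ell2 :: "'a ell2 \<Rightarrow> 'a ell2 \<Rightarrow> 'a ell2" is "\<lambda>x y i. x i - y i"
  subgoal for x y using summable_norm_square_add[of x "\<lambda>i. - y i"] by simp
  done

lift_definition scaleR_ell2 :: "real \<Rightarrow> 'a ell2 \<Rightarrow> 'a ell2" is "\<lambda>r x i. r *\<^sub>R x i"
  by (simp add: power_mult_distrib summable_mult)

lift_definition norm_ell2 :: "'a ell2 \<Rightarrow> real" is "\<lambda>x. sqrt (\<Sum>i. (norm (x i))\<^sup>2)" .

definition dist_ell2 :: "'a ell2 \<Rightarrow> 'a ell2 \<Rightarrow> real" where
  "dist_ell2 x y = norm (x - y)"

definition sgn_ell2 :: "'a ell2 \<Rightarrow> 'a ell2" where
  "sgn_ell2 x = inverse (norm x) *\<^sub>R x"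

definition uniformity_ell2 :: "('a ell2 \<times> 'a ell2) filter" where
  "uniformity_ell2 = (INF e\<in>{0 <..}. principal {(x, y). dist x y < e})"

definition open_ell2 :: "'a ell2 set \<Rightarrow> bool" where
  "open_ell2 S = (\<forall>x\<in>S. \<forall>\<^sub>F (x', y) in uniformity. x' = x \<longrightarrow> y \<in> S)"

instance
proof
  fix x y z :: "'a ell2" and r s :: real and U :: "'a ell2 set"
  show "x + y + z = x + (y + z)" "x + y = y + x" "0 + x = x" "- x + x = 0" "x - y = x + - y"
    "r *\<^sub>R (x + y) = r *\<^sub>R x + r *\<^sub>R y" "(r + s) *\<^sub>R x = r *\<^sub>R x + s *\<^sub>R x"
    "r *\<^sub>R s *\<^sub>R x = (r * s) *\<^sub>R x" "1 *\<^sub>R x = x"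
    by (transfer; simp add: fun_eq_iff algebra_simps)+
  show "dist x y = norm (x - y)" by (rule dist_ell2_def)
  show "sgn x = inverse (norm x) *\<^sub>R x" by (simp add: sgn_ell2_def)
  show "uniformity = (INF e\<in>{0 <..}. principal {(x::'a ell2, y). dist x y < e})"
    by (rule uniformity_ell2_def)
  show "open U = (\<forall>x\<in>U. \<forall>\<^sub>F (x', y) in uniformity. x' = x \<longrightarrow> y \<in> U)"
    by (rule open_ell2_def)
  show "norm x = 0 \<longleftrightarrow> x = 0"
    by transfer (simp add: suminf_eq_zero_iff fun_eq_iff)
  show "norm (x + y) \<le> norm x + norm y"
    by transfer (rule ell2_norm_triangle)
  show "norm (r *\<^sub>R x) = \<bar>r\<bar> * norm x"
    by transfer (simp add: power_mult_distrib suminf_mult real_sqrt_mult)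
qed

end

lemma norm_coord_le: "norm (coord x i) \<le> norm (x :: 'k::real_or_complex ell2)"
proof (transfer fixing: i)
  fix x :: "nat \<Rightarrow> 'k" assume x: "summable (\<lambda>i. (norm (x i))\<^sup>2)"
  have "(\<Sum>j\<in>{i}. (norm (x j))\<^sup>2) \<le> (\<Sum>j. (norm (x j))\<^sup>2)"
    by (rule sum_le_suminf[OF x]) auto
  then show "norm (x i) \<le> sqrt (\<Sum>i. (norm (x i))\<^sup>2)"
    by (simp add: real_le_rsqrt)
qed

instance ell2 :: (real_or_complex) banach
proof
  fix X :: "nat \<Rightarrow> 'a ell2"
  assume X: "Cauchy X"
  have partial: "(\<Sum>i<n. (norm (coord x i))\<^sup>2) \<le> (norm x)\<^sup>2" for x :: "'a ell2" and n
    by transfer (auto simp: suminf_nonneg intro!: sum_le_suminf)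
  have diff: "coord (x - y) i = coord x i - coord y i" for x y :: "'a ell2" and i
    by transfer simp
  have "Cauchy (\<lambda>n. coord (X n) i)" for i
  proof (rule metric_CauchyI)
    fix e :: real assume "e > 0"
    then obtain M where M: "\<And>m n. m \<ge> M \<Longrightarrow> n \<ge> M \<Longrightarrow> dist (X m) (X n) < e"
      using metric_CauchyD[OF X] by blast
    have "dist (coord (X m) i) (coord (X n) i) < e" if "m \<ge> M" "n \<ge> M" for m n
      using norm_coord_le[of "X m - X n" i] M[OF that] by (simp add: dist_norm diff)
    then show "\<exists>M. \<forall>m\<ge>M. \<forall>n\<ge>M. dist (coord (X m) i) (coord (X n) i) < e"
      by blast
  qed
  then have "\<exists>l. (\<lambda>n. coord (X n) i) \<longlonglongrightarrow> l" for i
    by (simp add: Cauchy_convergent_iff convergent_def)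
  then obtain l where l: "\<And>i. (\<lambda>n. coord (X n) i) \<longlonglongrightarrow> l i"
    by metis
  have tail: "\<exists>M. \<forall>m\<ge>M. \<forall>k. (\<Sum>i<k. (norm (coord (X m) i - l i))\<^sup>2) \<le> e\<^sup>2" if "e > 0" for e :: real
  proof -
    obtain M where M: "\<And>m n. m \<ge> M \<Longrightarrow> n \<ge> M \<Longrightarrow> dist (X m) (X n) < e"
      using metric_CauchyD[OF X \<open>e > 0\<close>] by blast
    have "(\<Sum>i<k. (norm (coord (X m) i - l i))\<^sup>2) \<le> e\<^sup>2" if "m \<ge> M" for m k
    proof (rule tendsto_upperbound)
      show "(\<lambda>n. \<Sum>i<k. (norm (coord (X m) i - coord (X n) i))\<^sup>2)
              \<longlonglongrightarrow> (\<Sum>i<k. (norm (coord (X m) i - l i))\<^sup>2)"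
        by (intro tendsto_intros l)
      show "\<forall>\<^sub>F n in sequentially. (\<Sum>i<k. (norm (coord (X m) i - coord (X n) i))\<^sup>2) \<le> e\<^sup>2"
        using eventually_ge_at_top[of M]
      proof eventually_elim
        case (elim n)
        have "(norm (X m - X n))\<^sup>2 \<le> e\<^sup>2"
          using M[OF \<open>m \<ge> M\<close> elim] by (intro power_mono) (auto simp: dist_norm)
        then show ?case
          using partial[where x = "X m - X n" and n = k] by (simp add: diff)
      qed
    qed simp
    then show ?thesis by blast
  qed
  have "summable (\<lambda>i. (norm (l i))\<^sup>2)"
  proof -
    obtain M where M: "\<And>k. (\<Sum>i<k. (norm (coord (X M) i - l i))\<^sup>2) \<le> 1\<^sup>2"
      using tail[of 1] by auto
    have "summable (\<lambda>i. (norm (coord (X M) i - l i))\<^sup>2)"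
      by (rule bounded_imp_summable[where B = "1\<^sup>2"])
        (use M[of "Suc _"] in \<open>auto simp: lessThan_Suc_atMost\<close>)
    then have "summable (\<lambda>i. (norm (- (coord (X M) i - l i) + coord (X M) i))\<^sup>2)"
      using coord[of "X M"] by (intro summable_norm_square_add) (simp_all add: norm_minus_commute)
    then show ?thesis by simp
  qed
  then have coordL: "coord (Abs_ell2 l) = l"
    by (simp add: Abs_ell2_inverse)
  have "X \<longlonglongrightarrow> Abs_ell2 l"
  proof (rule metric_LIMSEQ_I)
    fix r :: real assume "r > 0"
    then obtain M where M: "\<And>m k. m \<ge> M \<Longrightarrow> (\<Sum>i<k. (norm (coord (X m) i - l i))\<^sup>2) \<le> (r / 2)\<^sup>2"
      using tail[of "r / 2"] by auto
    have "dist (X m) (Abs_ell2 l) < r" if "m \<ge> M" for m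
    proof -
      have eq: "coord (X m - Abs_ell2 l) = (\<lambda>i. coord (X m) i - l i)"
        by (simp add: fun_eq_iff diff coordL)
      have "(\<Sum>i. (norm (coord (X m - Abs_ell2 l) i))\<^sup>2) \<le> (r / 2)\<^sup>2"
        using coord[of "X m - Abs_ell2 l"] M[OF that] by (intro suminf_le_const) (simp_all add: eq)
      then have "norm (X m - Abs_ell2 l) \<le> r / 2"
        using \<open>r > 0\<close> unfolding norm_ell2.rep_eq by (intro real_le_lsqrt) simp_all
      then show ?thesis
        using \<open>r > 0\<close> by (simp add: dist_norm)
    qed
    then show "\<exists>no. \<forall>n\<ge>no. dist (X n) (Abs_ell2 l) < r" by blast
  qed
  then show "convergent X"
    by (auto simp: convergent_def)
qed

lift_definition ell2_scale :: "'k::real_or_complex \<Rightarrow> 'k ell2 \<Rightarrow> 'k ell2" is "\<lambda>c x i. c * x i"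
  by (rule summable_norm_square_mult)

lemma normed_space_over_ell2:
  "normed_space_over (ell2_scale :: 'k::real_or_complex \<Rightarrow> 'k ell2 \<Rightarrow> 'k ell2)"
proof
  fix a b :: 'k and x y :: "'k ell2" and r :: real
  show "ell2_scale a (x + y) = ell2_scale a x + ell2_scale a y"
    "ell2_scale (a + b) x = ell2_scale a x + ell2_scale b x"
    "ell2_scale a (ell2_scale b x) = ell2_scale (a * b) x" "ell2_scale 1 x = x"
    by (transfer; simp add: fun_eq_iff algebra_simps)+
  show "norm (ell2_scale a x) = norm a * norm x"
    by transfer (simp add: norm_mult power_mult_distrib suminf_mult real_sqrt_mult)
  show "ell2_scale (of_real r) x = r *\<^sub>R x"
    by transfer (simp add: scaleR_conv_of_real)
qed

end

theory Submission
  imports Defs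
begin

text \<open>
  Let \<open>e\<^sub>i\<close> be the unit vectors of \<open>\<ell>\<^sub>2\<close>. The factorization comes from vectors \<open>v\<^sub>i\<close> of \<open>X\<close> with dense
  span and biorthogonal functionals \<open>w\<^sub>i\<close>, cut into consecutive finite blocks of indices. The operators are
    \<open>T\<^sub>1 x = \<Sum>\<^sub>k 2\<^sup>-\<^sup>k \<Sum>\<^sub>i x\<^sub>i v\<^sub>i\<close>  and  \<open>T\<^sub>2 y = \<Sum>\<^sub>k 2\<^sup>k \<Sum>\<^sub>i w\<^sub>i(y) T e\<^sub>i\<close>,
  where \<open>i\<close> runs through the \<open>k\<close>-th block. The weights cancel in \<open>T\<^sub>2 T\<^sub>1 = T\<close>, and \<open>T\<^sub>1\<close> has dense range
  because it reaches every \<open>v\<^sub>i\<close>. Both operators are compact, as norm convergent series of operators of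
  finite rank, if each block of \<open>v\<^sub>i\<close> spans a copy of a Hilbert space and the \<open>w\<^sub>i\<close> project onto it, with
  one constant for all blocks, and if the norm of \<open>T\<close> on the span of the \<open>e\<^sub>i\<close> from the \<open>k\<close>-th block
  onwards is of the order \<open>4\<^sup>-\<^sup>k\<close>. The latter only requires that blocks be long, since a compact
  operator on \<open>\<ell>\<^sub>2\<close> is small on tails (\<open>compact_operator_tail\<close>).

  The last index \<open>N\<close> of a block is special: its vector is an arbitrary one that brings the next member of a
  dense sequence into the span. There is no uniform bound for its functional, but this vector
  is chosen first and the rest of the block is then made so long that \<open>T e\<^sub>N\<close> compensates for the functional
  (\<open>biorthogonal_extension\<close>). Hence Hilbert spaces of arbitrary dimension are needed in \<open>X\<close>, complemented
  with a constant independent of the dimension, and biorthogonal to finitely many given vectors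
  and functionals. The last requirement is free: in a copy of larger dimension, it amounts
  to choosing orthonormal vectors orthogonal to finitely many others (\<open>orthonormal_in_span\<close>).

  The core is therefore that \<open>X\<close> contains uniformly complemented copies of \<open>\<ell>\<^sub>2\<^sup>k\<close>
  (\<open>uniformly_complemented_hilbert_spaces\<close>). By Khinchine's inequality the \<open>m\<close> Rademacher functions in a
  copy of \<open>\<ell>\<^sub>p\<close> of dimension \<open>2\<^sup>m\<close> in \<open>X\<close> span a copy of \<open>\<ell>\<^sub>2\<^sup>m\<close>, and the Rademacher coefficients \<open>\<phi>\<^sub>i\<close> satisfy
    \<open>\<bar>\<Sum> \<phi>\<^sub>i(y\<^sub>i)\<bar> \<le> C \<surd>m E \<parallel>\<Sum> \<epsilon>\<^sub>i y\<^sub>i\<parallel>\<close>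
  for independent signs \<open>\<epsilon>\<^sub>i\<close>. This inequality, and not a bound for the coefficient map, survives the extension
  to all of \<open>X\<close> by the Hahn--Banach theorem on \<open>X\<^sup>m\<close> (\<open>randomized_biorthogonal_system\<close>). It means that
  \<open>\<Sum> a\<^sub>i \<phi>\<^sub>i\<close> has norm at most \<open>C \<bar>a\<bar>\<close> on average over \<open>a\<close>, while a projection needs this for all \<open>a\<close>.
  It is thus enough to find a \<open>k\<close>-dimensional space of good \<open>a\<close> once \<open>m\<close> is large, which is the easy
  half of Dvoretzky's theorem. On a copy of \<open>\<ell>\<^sub>p\<^sup>n\<close> the \<open>\<phi>\<^sub>i\<close> are elements of \<open>\<ell>\<^sub>q\<^sup>n\<close> whose square function
  is bounded by \<open>C \<surd>m\<close> (\<open>coefficient_square_function_bound\<close>), and after a change of density it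
  suffices to bound moments of order \<open>2r \<ge> q\<close>. After discarding at most half of the
  dimensions the second moments are bounded uniformly (\<open>flat_orthonormal_family\<close>). Then the
  \<open>2r\<close>-th moments of random sign combinations of the remaining directions have variance of order \<open>1/m\<close>, by a
  Poincare inequality on the cube and Bessel's inequality (\<open>rademacher_moment_variance\<close>), so that one choice
  of signs serves a whole finite net in the \<open>k\<close>-dimensional ball (\<open>good_signs\<close>). The choice
  depends on the copy of \<open>\<ell>\<^sub>p\<^sup>n\<close>, but after rounding there are only finitely many choices,
  and one of them works on all copies simultaneously (\<open>globally_adapted_vectors\<close>).
\<close>

section \<open>Conjugation and compact balls in the scalar field\<close>

text \<open>
  One formula for the real part over \<open>\<real>\<close> and over \<open>\<complex>\<close>. On \<open>\<real>\<close> it is the identity, and so is the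
  conjugation defined from it.
\<close>

definition kre :: "'k::real_or_complex \<Rightarrow> real" where
  "kre x = ((norm (1 + x))\<^sup>2 - (norm x)\<^sup>2 - 1) / 2"

definition kcnj :: "'k::real_or_complex \<Rightarrow> 'k" where
  "kcnj x = of_real (2 * kre x) - x"

lemma scalar_cases:
  fixes dummy :: "'k::real_or_complex itself"
  obtains (real) "\<And>x::'k::real_or_complex. x = of_real (kre x)" "\<And>r. kre (of_real r :: 'k) = r"
      "\<And>x::'k. norm x = \<bar>kre x\<bar>"
  | (complex) i :: 'k and im :: "'k \<Rightarrow> real" where "i * i = - 1"
      "\<And>x::'k. x = of_real (kre x) + of_real (im x) * i"
      "\<And>a b. kre (of_real a + of_real b * i) = a" "\<And>a b. im (of_real a + of_real b * i) = b"
      "\<And>x::'k. norm x = sqrt ((kre x)\<^sup>2 + (im x)\<^sup>2)"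
proof -
  consider "\<forall>x::'k. \<exists>r. x = r *\<^sub>R 1" |
    "\<exists>i::'k. i * i = - 1 \<and> (\<forall>a b. norm (a *\<^sub>R 1 + b *\<^sub>R i) = sqrt (a\<^sup>2 + b\<^sup>2)) \<and>
          (\<forall>x. \<exists>a b. x = a *\<^sub>R 1 + b *\<^sub>R i)"
    using real_or_complex by blast
  then show thesis
  proof cases
    case 1
    have *: "kre (of_real r :: 'k) = r" for r
    proof -
      have e: "1 + of_real r = (of_real (1 + r) :: 'k)" by simp
      show ?thesis
        unfolding kre_def e norm_of_real by (simp add: power2_eq_square algebra_simps)
    qed
    have **: "x = of_real (kre x)" for x :: 'k
    proof -
      obtain r where r: "x = of_real r" using 1 by (auto simp: of_real_def)
      show ?thesis unfolding r * ..
    qed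
    have "norm x = \<bar>kre x\<bar>" for x :: 'k
      by (subst **[of x]) (rule norm_of_real)
    then show ?thesis
      using * ** by (intro real)
  next
    case 2
    then obtain i :: 'k where i: "i * i = - 1"
      and n: "\<And>a b. norm (a *\<^sub>R 1 + b *\<^sub>R i) = sqrt (a\<^sup>2 + b\<^sup>2)"
      and ex: "\<And>x. \<exists>a b. x = a *\<^sub>R 1 + b *\<^sub>R i"
      by blast
    have n': "norm (of_real a + of_real b * i) = sqrt (a\<^sup>2 + b\<^sup>2)" for a b
      using n[of a b] by (simp add: scaleR_conv_of_real)
    have k: "kre (of_real a + of_real b * i) = a" for a b
    proof -
      have "1 + (of_real a + of_real b * i) = of_real (1 + a) + of_real b * i"
        by simp
      moreover have "(norm (of_real a + of_real b * i))\<^sup>2 = a\<^sup>2 + b\<^sup>2" for a b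
        unfolding n' by simp
      ultimately show ?thesis
        unfolding kre_def by (simp only:) (simp add: power2_eq_square algebra_simps)
    qed
    have uniq: "b = b'" if "of_real a + of_real b * i = of_real a' + of_real b' * i" for a b a' b'
    proof -
      have "a = a'" using arg_cong[OF that, of kre] by (simp only: k)
      then have "of_real (b - b') * i = 0" using that by (simp add: algebra_simps)
      moreover have "i \<noteq> 0" using i by auto
      ultimately show ?thesis by simp
    qed
    define im where "im x = (THE b. \<exists>a. x = of_real a + of_real b * i)" for x
    have im: "im (of_real a + of_real b * i) = b" for a b
      unfolding im_def by (rule the_equality) (use uniq in blast)+
    have d: "x = of_real (kre x) + of_real (im x) * i" for x
    proof -
      obtain a b where x: "x = of_real a + of_real b * i"
        using ex[of x] by (auto simp: scaleR_conv_of_real)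
      show ?thesis unfolding x k im ..
    qed
    have "norm x = sqrt ((kre x)\<^sup>2 + (im x)\<^sup>2)" for x
      by (subst d[of x]) (rule n')
    then show ?thesis using i d k im by (intro complex)
  qed
qed

lemma kre_add: "kre (x + y) = kre x + kre (y::'k::real_or_complex)"
proof (cases rule: scalar_cases[where ?'k='k])
  case real
  have "x + y = of_real (kre x + kre y)"
    by (subst real(1)[of x], subst real(1)[of y]) simp
  from trans[OF arg_cong[OF this, of kre] real(2)] show ?thesis .
next
  case (complex i im)
  have "x + y = of_real (kre x + kre y) + of_real (im x + im y) * i"
    by (subst complex(2)[of x], subst complex(2)[of y]) (simp add: algebra_simps)
  from trans[OF arg_cong[OF this, of kre] complex(3)] show ?thesis .
qed

lemma kre_scale: "kre (of_real r * x) = r * kre (x::'k::real_or_complex)"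
proof (cases rule: scalar_cases[where ?'k='k])
  case real
  have "of_real r * x = of_real (r * kre x)"
    by (subst real(1)[of x]) simp
  from trans[OF arg_cong[OF this, of kre] real(2)] show ?thesis .
next
  case (complex i im)
  have "of_real r * x = of_real (r * kre x) + of_real (r * im x) * i"
    by (subst complex(2)[of x]) (simp add: algebra_simps)
  from trans[OF arg_cong[OF this, of kre] complex(3)] show ?thesis .
qed

lemma kre_numeral_mult [simp]: "kre (numeral n * x) = numeral n * kre (x::'k::real_or_complex)"
  using kre_scale[of "numeral n" x] by simp

lemma kre_of_real [simp]: "kre (of_real r :: 'k::real_or_complex) = r"
proof (cases rule: scalar_cases[where ?'k='k])
  case (complex i im)
  show ?thesis using complex(3)[of r 0] by simp
next
  case real
  show ?thesis by (rule real(2))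
qed

lemma kre_0 [simp]: "kre (0 :: 'k::real_or_complex) = 0"
  using kre_of_real[of 0] by simp

lemma kre_minus: "kre (- x) = - kre (x::'k::real_or_complex)"
  using kre_add[of x "-x"] by simp

lemma kre_diff: "kre (x - y) = kre x - kre (y::'k::real_or_complex)"
  using kre_add[of x "-y"] by (simp add: kre_minus)

lemma kre_sum: "kre (\<Sum>i\<in>A. f i) = (\<Sum>i\<in>A. kre (f i :: 'k::real_or_complex))"
  by (induction A rule: infinite_finite_induct) (simp_all add: kre_add)

lemma abs_kre_le: "\<bar>kre x\<bar> \<le> norm (x::'k::real_or_complex)"
proof (cases rule: scalar_cases[where ?'k='k])
  case (complex i im)
  show ?thesis unfolding complex(5) by (rule real_le_rsqrt) simp
next
  case real
  show ?thesis unfolding real(3) ..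
qed

lemma kre_le: "kre x \<le> norm (x::'k::real_or_complex)"
  using abs_kre_le[of x] by simp

lemma kcnj_add: "kcnj (x + y) = kcnj x + kcnj (y::'k::real_or_complex)"
  by (simp add: kcnj_def kre_add algebra_simps)

lemma kcnj_of_real [simp]: "kcnj (of_real r :: 'k::real_or_complex) = of_real r"
  by (simp add: kcnj_def)

lemma kcnj_0 [simp]: "kcnj (0 :: 'k::real_or_complex) = 0"
  by (simp add: kcnj_def)

lemma kcnj_kcnj [simp]: "kcnj (kcnj x) = (x::'k::real_or_complex)"
  by (simp add: kcnj_def kre_diff algebra_simps)

lemma kcnj_sum: "kcnj (\<Sum>i\<in>A. f i) = (\<Sum>i\<in>A. kcnj (f i :: 'k::real_or_complex))"
  by (induction A rule: infinite_finite_induct) (simp_all add: kcnj_add)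

lemma kcnj_mult: "kcnj (x * y) = kcnj x * kcnj (y::'k::real_or_complex)"
proof (cases rule: scalar_cases[where ?'k='k])
  case real
  have "kcnj z = z" for z :: 'k
    unfolding kcnj_def by (subst (2 3) real(1)[of z]) (simp add: real(2))
  then show ?thesis by simp
next
  case (complex i im)
  have c: "kcnj z = of_real (kre z) - of_real (im z) * i" for z
  proof -
    have "kcnj z = of_real (2 * kre z) - (of_real (kre z) + of_real (im z) * i)"
      unfolding kcnj_def by (rule arg_cong[OF complex(2)])
    then show ?thesis by simp
  qed
  have ii: "i * (i * z) = - z" for z
    unfolding mult.assoc[symmetric] complex(1) by simp
  have "x * y = of_real (kre x * kre y - im x * im y) + of_real (kre x * im y + im x * kre y) * i"
    by (subst complex(2)[of x], subst complex(2)[of y])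
      (simp add: algebra_simps ii complex(1))
  from trans[OF arg_cong[OF this, of kre] complex(3)] trans[OF arg_cong[OF this, of im] complex(4)]
  have *: "kre (x * y) = kre x * kre y - im x * im y" "im (x * y) = kre x * im y + im x * kre y" .
  show ?thesis
    unfolding c * by (simp add: algebra_simps ii complex(1))
qed

lemma mult_kcnj: "x * kcnj x = of_real ((norm (x::'k::real_or_complex))\<^sup>2)"
proof (cases rule: scalar_cases[where ?'k='k])
  case real
  obtain r where r: "x = of_real r" by (rule that[OF real(1)])
  show ?thesis
    unfolding r by (simp add: kcnj_def power2_eq_square)
next
  case (complex i im)
  have c: "kcnj x = of_real (kre x) - of_real (im x) * i"
  proof -
    have "kcnj x = of_real (2 * kre x) - (of_real (kre x) + of_real (im x) * i)"
      unfolding kcnj_def by (rule arg_cong[OF complex(2)])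
    then show ?thesis by simp
  qed
  have ii: "i * (i * z) = - z" for z
    unfolding mult.assoc[symmetric] complex(1) by simp
  show ?thesis
    unfolding c complex(5) by (subst complex(2)[of x])
      (simp add: algebra_simps power2_eq_square ii complex(1))
qed

lemma norm_kcnj [simp]: "norm (kcnj x) = norm (x::'k::real_or_complex)"
proof (cases "x = 0")
  case False
  have "norm x * norm (kcnj x) = norm x * norm x"
    unfolding norm_mult[symmetric] mult_kcnj by (simp add: power2_eq_square norm_mult)
  then show ?thesis using False by simp
qed simp

lemma kre_mult_kcnj: "kre (x * kcnj x) = (norm (x::'k::real_or_complex))\<^sup>2"
  unfolding mult_kcnj by (rule kre_of_real)

lemma kre_kcnj [simp]: "kre (kcnj x) = kre (x::'k::real_or_complex)"
  by (simp add: kcnj_def kre_diff)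

lemma norm_add_square:
  "(norm (x + y :: 'k::real_or_complex))\<^sup>2 = (norm x)\<^sup>2 + (norm y)\<^sup>2 + 2 * kre (x * kcnj y)"
proof -
  have "kre (y * kcnj x) = kre (x * kcnj y)"
    using kre_kcnj[of "y * kcnj x"] by (simp add: kcnj_mult mult.commute)
  then show ?thesis
    unfolding kre_mult_kcnj[symmetric] by (simp add: kcnj_add kre_add algebra_simps)
qed

lemma norm_diff_square:
  "(norm (x - y :: 'k::real_or_complex))\<^sup>2 = (norm x)\<^sup>2 + (norm y)\<^sup>2 - 2 * kre (x * kcnj y)"
  using norm_add_square[of x "-y"] kcnj_add[of y "-y"]
  by (simp add: kre_minus eq_neg_iff_add_eq_0[symmetric] add.commute)

lemma compact_cball_scalar: "compact (cball 0 M :: 'k::real_or_complex set)"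
proof (cases rule: scalar_cases[where ?'k='k])
  case real
  have "cball 0 M = (of_real :: real \<Rightarrow> 'k) ` {- M..M}"
  proof (intro equalityI subsetI)
    fix x :: 'k assume "x \<in> cball 0 M"
    then have "\<bar>kre x\<bar> \<le> M" using real(3)[of x] by simp
    then show "x \<in> of_real ` {- M..M}" by (intro rev_image_eqI[of "kre x"] real(1)) auto
  qed auto
  then show ?thesis
    by (simp only:) (intro compact_continuous_image continuous_intros compact_Icc)
next
  case (complex i im)
  have "cball 0 M = (\<lambda>z. of_real (fst z) + of_real (snd z) * i) ` {z. norm z \<le> M}"
  proof (intro equalityI subsetI)
    fix x :: 'k assume "x \<in> cball 0 M"
    then show "x \<in> (\<lambda>z. of_real (fst z) + of_real (snd z) * i) ` {z. norm z \<le> M}"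
      by (intro image_eqI[of _ _ "(kre x, im x)"]) (simp_all add: norm_prod_def complex(5)[symmetric] complex(2)[symmetric])
  next
    fix x :: 'k assume "x \<in> (\<lambda>z. of_real (fst z) + of_real (snd z) * i) ` {z. norm z \<le> M}"
    then obtain a b where x: "x = of_real a + of_real b * i" and ab: "norm (a, b) \<le> M" by auto
    have "kre x = a" "im x = b" unfolding x by (rule complex(3), rule complex(4))
    then show "x \<in> cball 0 M"
      using ab by (simp add: complex(5) norm_prod_def)
  qed
  moreover have "{z::real\<times>real. norm z \<le> M} = cball 0 M" by auto
  ultimately show ?thesis
    by (simp only:) (intro compact_continuous_image continuous_intros compact_cball)
qed

text \<open>
  Finite nets in the scalar field yield finite nets of coefficient vectors and of matrices,
  coordinate by coordinate.
\<close>

lemma finite_scalar_net: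
  assumes "0 < \<delta>"
  obtains D :: "'k::real_or_complex set" where "finite D"
    "\<And>z. norm z \<le> 1 \<Longrightarrow> \<exists>d\<in>D. norm (z - d) \<le> \<delta>"
proof -
  obtain D :: "'k set" where D: "finite D" "cball 0 1 \<subseteq> (\<Union>x\<in>D. ball x \<delta>)"
    using compact_cball_scalar[of 1] assms unfolding compact_eq_totally_bounded by blast
  have "\<exists>d\<in>D. norm (z - d) \<le> \<delta>" if "norm z \<le> 1" for z
  proof -
    have "z \<in> cball 0 1" using that by simp
    then obtain d where "d \<in> D" "dist d z < \<delta>" using D(2) by auto
    then show ?thesis by (auto simp: dist_norm norm_minus_commute intro!: bexI[of _ d])
  qed
  then show ?thesis using that D(1) by blast
qed

lemma norm_sum_mult_square_le:
  fixes a b :: "'i \<Rightarrow> 'k::real_normed_field"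
  shows "(norm (\<Sum>i\<in>A. a i * b i))\<^sup>2 \<le> (\<Sum>i\<in>A. (norm (a i))\<^sup>2) * (\<Sum>i\<in>A. (norm (b i))\<^sup>2)"
proof -
  have "norm (\<Sum>i\<in>A. a i * b i) \<le> (\<Sum>i\<in>A. norm (a i) * norm (b i))"
    by (rule order_trans[OF norm_sum]) (simp add: norm_mult)
  then have "(norm (\<Sum>i\<in>A. a i * b i))\<^sup>2 \<le> (\<Sum>i\<in>A. norm (a i) * norm (b i))\<^sup>2"
    by (intro power_mono) auto
  also have "\<dots> \<le> (\<Sum>i\<in>A. (norm (a i))\<^sup>2) * (\<Sum>i\<in>A. (norm (b i))\<^sup>2)"
    by (rule Cauchy_Schwarz_ineq_sum)
  finally show ?thesis .
qed

section \<open>Averages over signs\<close>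

text \<open>
  Expectations over independent random signs are averages over the finite set of all sign
  patterns; being extensional outside \<open>I\<close>, these patterns are finite in number.
\<close>

definition signs :: "'i set \<Rightarrow> ('i \<Rightarrow> real) set" where
  "signs I = PiE I (\<lambda>_. {- 1, 1})"

definition sign_avg :: "'i set \<Rightarrow> (('i \<Rightarrow> real) \<Rightarrow> real) \<Rightarrow> real" where
  "sign_avg I f = (\<Sum>e\<in>signs I. f e) / 2 ^ card I"

lemma finite_signs [simp]: "finite I \<Longrightarrow> finite (signs I)"
  by (auto simp: signs_def intro: finite_PiE)

lemma card_signs: "finite I \<Longrightarrow> card (signs I) = 2 ^ card I"
  by (simp add: signs_def card_PiE numeral_2_eq_2)

lemma signs_cases: "e \<in> signs I \<Longrightarrow> i \<in> I \<Longrightarrow> e i = 1 \<or> e i = - 1"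
  by (auto simp: signs_def PiE_iff)

lemma signs_abs: "e \<in> signs I \<Longrightarrow> i \<in> I \<Longrightarrow> \<bar>e i\<bar> = 1"
  using signs_cases by fastforce

lemma signs_square: "e \<in> signs I \<Longrightarrow> i \<in> I \<Longrightarrow> e i * e i = 1"
  using signs_cases by fastforce

lemma sign_avg_empty [simp]: "sign_avg {} f = f (\<lambda>_. undefined)"
  by (simp add: sign_avg_def signs_def)

text \<open>
  Conditioning on all signs but one; the inductions over the number of signs below rest on this.
\<close>

lemma sign_avg_insert:
  assumes "finite I" "i \<notin> I"
  shows "sign_avg (insert i I) f = sign_avg I (\<lambda>e. (f (e(i := 1)) + f (e(i := - 1))) / 2)"
proof -
  have inj: "inj_on (\<lambda>(y, e). e(i := y)) ({- 1, 1} \<times> signs I)"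
    unfolding signs_def by (rule inj_combinator) (use assms in auto)
  have se: "signs (insert i I) = (\<lambda>(y, e). e(i := y)) ` ({- 1, 1} \<times> signs I)"
    unfolding signs_def PiE_insert_eq ..
  have "(\<Sum>e\<in>signs (insert i I). f e) = (\<Sum>(y, e)\<in>{- 1, 1} \<times> signs I. f (e(i := y)))"
    unfolding se by (subst sum.reindex[OF inj]) (simp add: case_prod_unfold)
  also have "\<dots> = (\<Sum>y\<in>{- 1, 1}. \<Sum>e\<in>signs I. f (e(i := y)))"
    using assms by (simp add: sum.cartesian_product)
  also have "\<dots> = (\<Sum>e\<in>signs I. f (e(i := 1)) + f (e(i := - 1)))"
    by (simp add: sum.distrib)
  finally show ?thesis
    using assms unfolding sign_avg_def by (simp add: sum_divide_distrib field_simps)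
qed

lemma sign_avg_mono: "(\<And>e. e \<in> signs I \<Longrightarrow> f e \<le> g e) \<Longrightarrow> sign_avg I f \<le> sign_avg I g"
  unfolding sign_avg_def by (intro divide_right_mono sum_mono) auto

lemma sign_avg_cong: "(\<And>e. e \<in> signs I \<Longrightarrow> f e = g e) \<Longrightarrow> sign_avg I f = sign_avg I g"
  unfolding sign_avg_def by (simp cong: sum.cong)

lemma sign_avg_const [simp]: "finite I \<Longrightarrow> sign_avg I (\<lambda>_. c) = c"
  by (simp add: sign_avg_def card_signs)

lemma sign_avg_add: "sign_avg I (\<lambda>e. f e + g e) = sign_avg I f + sign_avg I g"
  by (simp add: sign_avg_def sum.distrib add_divide_distrib)

lemma sign_avg_mult: "sign_avg I (\<lambda>e. c * f e) = c * sign_avg I f"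
  by (simp add: sign_avg_def sum_distrib_left)

lemma sign_avg_sum: "sign_avg I (\<lambda>e. \<Sum>j\<in>J. f j e) = (\<Sum>j\<in>J. sign_avg I (f j))"
  unfolding sign_avg_def sum_divide_distrib[symmetric] by (subst sum.swap) simp

lemma sign_avg_nonneg: "(\<And>e. e \<in> signs I \<Longrightarrow> 0 \<le> f e) \<Longrightarrow> 0 \<le> sign_avg I f"
  unfolding sign_avg_def by (intro divide_nonneg_nonneg sum_nonneg) auto

lemma sign_avg_less_exists:
  assumes "finite I" "sign_avg I f < c"
  obtains e where "e \<in> signs I" "f e < c"
proof -
  have "\<not> (\<forall>e\<in>signs I. c \<le> f e)"
    using sign_avg_mono[of I "\<lambda>_. c" f] assms by auto
  then show ?thesis using that by force
qed

text \<open>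
  The sign at \<open>i\<close> is independent of and symmetric with respect to all the others; \<open>g\<close> sees only
  the others, since its argument has the sign at \<open>i\<close> overwritten.
\<close>

lemma sign_avg_flip:
  assumes "i \<in> I" "finite I"
  shows "sign_avg I (\<lambda>e. e i * g (e(i := 1))) = 0"
proof -
  define J where "J = I - {i}"
  have J: "I = insert i J" "finite J" "i \<notin> J" using assms by (auto simp: J_def)
  show ?thesis unfolding J(1) sign_avg_insert[OF J(2,3)] using J(2) by simp
qed

lemma sign_avg_orthogonal:
  assumes "finite I" "i \<in> I" "j \<in> I"
  shows "sign_avg I (\<lambda>e. e i * e j) = (if i = j then 1 else 0)"
proof (cases "i = j")
  case True
  then have "sign_avg I (\<lambda>e. e i * e j) = sign_avg I (\<lambda>_. 1)"
    using assms by (intro sign_avg_cong) (simp add: signs_square)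
  then show ?thesis using True assms by simp
next
  case False
  then show ?thesis using sign_avg_flip[of i I "\<lambda>e. e j"] assms by simp
qed

text \<open>
  With \<open>x = \<bar>a\<bar>\<^sup>2\<close>, \<open>y = \<bar>c\<bar>\<^sup>2\<close> and \<open>t = 2 Re(a c\<^sup>*)\<close> the two powers are \<open>\<bar>a + c\<bar>\<^sup>2\<^sup>r\<close> and \<open>\<bar>a - c\<bar>\<^sup>2\<^sup>r\<close>.
  The sum and the difference of the powers satisfy a linear recursion in \<open>r\<close>; the induction
  therefore carries a bound for \<open>t\<close> times the difference along with the claim.
\<close>

lemma two_point_power:
  fixes x y t C :: real
  assumes "0 \<le> x" "0 \<le> y" "t\<^sup>2 \<le> 4 * x * y" "4 * real R + 1 \<le> C" "r \<le> R"
  shows "(x + y + t) ^ r + (x + y - t) ^ r \<le> 2 * (x + C * y) ^ r"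
proof -
  let ?s = "x + y" and ?D = "x + C * y"
  have C: "1 \<le> C" using assms(4) by linarith
  have sD: "?s \<le> ?D" using mult_right_mono[OF C assms(2)] by simp
  have D0: "0 \<le> ?D" using sD assms by linarith
  have xD: "x \<le> ?D" using C assms by simp
  have "(?s + t) ^ r + (?s - t) ^ r \<le> 2 * ?D ^ r \<and>
        t * ((?s + t) ^ r - (?s - t) ^ r) * ?D \<le> 8 * real r * y * ?D ^ r * ?D \<and>
        (r \<ge> 1 \<longrightarrow> t * ((?s + t) ^ r - (?s - t) ^ r) \<le> 8 * real r * y * ?D ^ r)"
    using assms(5)
  proof (induction r)
    case (Suc r)
    define a where "a = (?s + t) ^ r + (?s - t) ^ r"
    define b where "b = (?s + t) ^ r - (?s - t) ^ r"
    have a: "(?s + t) ^ Suc r + (?s - t) ^ Suc r = ?s * a + t * b"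
      by (simp add: a_def b_def algebra_simps)
    have b: "(?s + t) ^ Suc r - (?s - t) ^ Suc r = ?s * b + t * a"
      by (simp add: a_def b_def algebra_simps)
    have IHa: "a \<le> 2 * ?D ^ r" using Suc a_def by simp
    have IHb: "t * b \<le> 8 * real r * y * ?D ^ r"
      using Suc b_def by (cases r) auto
    have Dr: "0 \<le> ?D ^ r" using D0 by simp
    have t2: "t\<^sup>2 * a \<le> 8 * y * (?D * ?D ^ r)"
    proof -
      have "t\<^sup>2 * a \<le> t\<^sup>2 * (2 * ?D ^ r)" using IHa by (intro mult_left_mono) auto
      also have "\<dots> \<le> (4 * x * y) * (2 * ?D ^ r)" using assms(3) Dr by (intro mult_right_mono) auto
      also have "\<dots> \<le> (4 * ?D * y) * (2 * ?D ^ r)"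
        using xD Dr assms(2) by (intro mult_right_mono) auto
      finally show ?thesis by (simp add: algebra_simps)
    qed
    have "?s * (t * b) \<le> ?s * (8 * real r * y * ?D ^ r)"
      using IHb assms by (intro mult_left_mono) auto
    also have "\<dots> \<le> ?D * (8 * real r * y * ?D ^ r)"
      using sD assms Dr by (intro mult_right_mono) auto
    finally have B: "t * (?s * b + t * a) \<le> 8 * real (Suc r) * y * ?D ^ Suc r"
      using t2 by (simp add: power2_eq_square algebra_simps)
    have "?s * a + t * b \<le> ?s * (2 * ?D ^ r) + 8 * real r * y * ?D ^ r"
      using IHa IHb assms by (intro add_mono mult_left_mono) auto
    also have "\<dots> = 2 * (x + (4 * real r + 1) * y) * ?D ^ r"
      by (simp add: algebra_simps)
    also have "\<dots> \<le> 2 * ?D * ?D ^ r"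
    proof -
      have "4 * real r + 1 \<le> C" using Suc.prems assms(4) by linarith
      then have "(4 * real r + 1) * y \<le> C * y" using assms(2) by (rule mult_right_mono)
      then show ?thesis using Dr by (intro mult_right_mono) auto
    qed
    finally have A: "?s * a + t * b \<le> 2 * ?D ^ Suc r" by (simp only: power_Suc mult.assoc)
    show ?case unfolding a b using A B D0 mult_right_mono[OF B D0] by auto
  qed simp
  then show ?thesis by simp
qed

lemma two_point_norm:
  fixes a c :: "'k::real_or_complex"
  assumes "r \<le> R"
  shows "norm (a + c) ^ (2 * r) + norm (a - c) ^ (2 * r)
          \<le> 2 * ((norm a)\<^sup>2 + (4 * real R + 1) * (norm c)\<^sup>2) ^ r"
proof -
  have "(2 * kre (a * kcnj c))\<^sup>2 \<le> 4 * (norm a)\<^sup>2 * (norm c)\<^sup>2"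
  proof -
    have "\<bar>kre (a * kcnj c)\<bar> \<le> norm a * norm c"
      using abs_kre_le[of "a * kcnj c"] by (simp add: norm_mult)
    then have "(kre (a * kcnj c))\<^sup>2 \<le> (norm a * norm c)\<^sup>2"
      by (metis abs_ge_zero power2_abs power_mono)
    then show ?thesis by (simp add: power_mult_distrib)
  qed
  from two_point_power[OF _ _ this order_refl assms]
  show ?thesis
    unfolding power_mult norm_add_square norm_diff_square by simp
qed

text \<open>
  The constant is uniform in all exponents up to \<open>R\<close>: one step of the induction over the number of
  signs expands a binomial, which needs the induction hypothesis for all lower exponents with one
  constant.
\<close>

lemma khinchine_upper:
  fixes c :: "'i \<Rightarrow> 'k::real_or_complex"
  assumes "finite I" "r \<le> R"
  shows "sign_avg I (\<lambda>e. norm (\<Sum>i\<in>I. e i *\<^sub>R c i) ^ (2 * r))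
          \<le> ((4 * real R + 1) * (\<Sum>i\<in>I. (norm (c i))\<^sup>2)) ^ r"
  using assms
proof (induction I arbitrary: r rule: finite_induct)
  case (insert i I)
  let ?C = "4 * real R + 1"
  let ?A = "\<lambda>e. \<Sum>j\<in>I. e j *\<^sub>R c j"
  let ?\<sigma> = "\<Sum>j\<in>I. (norm (c j))\<^sup>2"
  have S: "(\<Sum>j\<in>insert i I. (e(i := y)) j *\<^sub>R c j) = y *\<^sub>R c i + ?A e" for e :: "_ \<Rightarrow> real" and y
    unfolding sum.insert[OF insert.hyps] using insert.hyps
    by (auto intro!: sum.cong arg_cong2[where f="(+)"])
  have "sign_avg (insert i I) (\<lambda>e. norm (\<Sum>j\<in>insert i I. e j *\<^sub>R c j) ^ (2 * r))
      = sign_avg I (\<lambda>e. (norm (?A e + c i) ^ (2 * r) + norm (?A e - c i) ^ (2 * r)) / 2)"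
    unfolding sign_avg_insert[OF insert.hyps] S
    by (intro sign_avg_cong) (simp add: add.commute)
  also have "\<dots> \<le> sign_avg I (\<lambda>e. ((norm (?A e))\<^sup>2 + ?C * (norm (c i))\<^sup>2) ^ r)"
  proof (rule sign_avg_mono)
    fix e
    show "(norm (?A e + c i) ^ (2 * r) + norm (?A e - c i) ^ (2 * r)) / 2
      \<le> ((norm (?A e))\<^sup>2 + ?C * (norm (c i))\<^sup>2) ^ r"
      using two_point_norm[OF insert.prems, of "?A e" "c i"] by simp
  qed
  also have "\<dots> = (\<Sum>k\<le>r. of_nat (r choose k) * (?C * (norm (c i))\<^sup>2) ^ (r - k) *
                    sign_avg I (\<lambda>e. norm (?A e) ^ (2 * k)))"
    unfolding binomial_ring sign_avg_sum sign_avg_mult[symmetric]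
    by (intro sum.cong refl sign_avg_cong) (simp add: power_mult)
  also have "\<dots> \<le> (\<Sum>k\<le>r. of_nat (r choose k) * (?C * (norm (c i))\<^sup>2) ^ (r - k) * (?C * ?\<sigma>) ^ k)"
    using insert.prems by (intro sum_mono mult_left_mono insert.IH) auto
  also have "\<dots> = (?C * ?\<sigma> + ?C * (norm (c i))\<^sup>2) ^ r"
    unfolding binomial_ring by (intro sum.cong) auto
  also have "\<dots> = (?C * (\<Sum>j\<in>insert i I. (norm (c j))\<^sup>2)) ^ r"
    using insert.hyps by (simp add: algebra_simps)
  finally show ?case .
qed (simp add: zero_power2 power_0_left)

lemma sign_avg_square:
  fixes c :: "'i \<Rightarrow> 'k::real_or_complex"
  assumes "finite I"
  shows "sign_avg I (\<lambda>e. (norm (\<Sum>i\<in>I. e i *\<^sub>R c i))\<^sup>2) = (\<Sum>i\<in>I. (norm (c i))\<^sup>2)"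
  using assms
proof (induction I rule: finite_induct)
  case (insert i I)
  let ?A = "\<lambda>e. \<Sum>j\<in>I. e j *\<^sub>R c j"
  have S: "(\<Sum>j\<in>insert i I. (e(i := y)) j *\<^sub>R c j) = y *\<^sub>R c i + ?A e" for e :: "_ \<Rightarrow> real" and y
    unfolding sum.insert[OF insert.hyps] using insert.hyps
    by (auto intro!: sum.cong arg_cong2[where f="(+)"])
  have "sign_avg (insert i I) (\<lambda>e. (norm (\<Sum>j\<in>insert i I. e j *\<^sub>R c j))\<^sup>2)
      = sign_avg I (\<lambda>e. ((norm (?A e + c i))\<^sup>2 + (norm (?A e - c i))\<^sup>2) / 2)"
    unfolding sign_avg_insert[OF insert.hyps] S
    by (intro sign_avg_cong) (simp add: add.commute)
  also have "\<dots> = sign_avg I (\<lambda>e. (norm (?A e))\<^sup>2 + (norm (c i))\<^sup>2)"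
    unfolding norm_add_square norm_diff_square by (intro sign_avg_cong) simp
  finally show ?case using insert by (simp add: sign_avg_add)
qed simp

text \<open>
  First moments control second moments because fourth moments are controlled by the square of the
  second moments.
\<close>

lemma khinchine_lower:
  fixes c :: "'i \<Rightarrow> 'k::real_or_complex"
  assumes "finite I"
  shows "sqrt (\<Sum>i\<in>I. (norm (c i))\<^sup>2) \<le> 24 * sign_avg I (\<lambda>e. norm (\<Sum>i\<in>I. e i *\<^sub>R c i))"
proof -
  define \<sigma> where "\<sigma> = sqrt (\<Sum>i\<in>I. (norm (c i))\<^sup>2)"
  have \<sigma>0: "0 \<le> \<sigma>" by (simp add: \<sigma>_def sum_nonneg)
  have \<sigma>2: "\<sigma>\<^sup>2 = (\<Sum>i\<in>I. (norm (c i))\<^sup>2)" by (simp add: \<sigma>_def sum_nonneg)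
  let ?A = "\<lambda>e. norm (\<Sum>i\<in>I. e i *\<^sub>R c i)"
  show ?thesis
  proof (cases "\<sigma> = 0")
    case True
    then show ?thesis unfolding \<sigma>_def[symmetric] by (simp add: sign_avg_nonneg)
  next
    case False
    then have \<sigma>: "0 < \<sigma>" using \<sigma>0 by simp
    \<comment> \<open>For \<open>x \<le> t\<close> the first summand suffices, for \<open>x > t\<close> the second. The fourth moment is at most
      \<open>81 \<sigma>\<^sup>4\<close>, so \<open>t = 18 \<sigma>\<close> makes the second summand contribute \<open>\<sigma>\<^sup>2 / 4\<close>.\<close>
    have pt: "x\<^sup>2 \<le> (18 * \<sigma>) * x + 1 / (18 * \<sigma>)\<^sup>2 * x ^ 4" if "0 \<le> x" for x :: real
    proof (cases "x \<le> 18 * \<sigma>")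
      case True
      have "x\<^sup>2 \<le> (18 * \<sigma>) * x"
        using True that by (simp add: power2_eq_square mult_right_mono)
      moreover have "0 \<le> 1 / (18 * \<sigma>)\<^sup>2 * x ^ 4" by simp
      ultimately show ?thesis by linarith
    next
      case False
      then have "(18 * \<sigma>)\<^sup>2 \<le> x\<^sup>2" using \<sigma> by (intro power_mono) auto
      then have "(18 * \<sigma>)\<^sup>2 * x\<^sup>2 \<le> x\<^sup>2 * x\<^sup>2" by (rule mult_right_mono) simp
      then have "x\<^sup>2 \<le> 1 / (18 * \<sigma>)\<^sup>2 * x ^ 4"
        using \<sigma> by (simp add: pos_le_divide_eq mult.commute power_add[symmetric] del: power_mult_distrib)
      moreover have "0 \<le> (18 * \<sigma>) * x" using that \<sigma> by simp
      ultimately show ?thesis by linarith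
    qed
    have "\<sigma>\<^sup>2 = sign_avg I (\<lambda>e. (?A e)\<^sup>2)"
      unfolding \<sigma>2 sign_avg_square[OF assms] ..
    also have "\<dots> \<le> sign_avg I (\<lambda>e. (18 * \<sigma>) * ?A e + 1 / (18 * \<sigma>)\<^sup>2 * ?A e ^ 4)"
      by (intro sign_avg_mono pt) simp
    also have "\<dots> = (18 * \<sigma>) * sign_avg I ?A + 1 / (18 * \<sigma>)\<^sup>2 * sign_avg I (\<lambda>e. ?A e ^ (2 * 2))"
      by (simp only: sign_avg_add sign_avg_mult) simp
    also have "\<dots> \<le> (18 * \<sigma>) * sign_avg I ?A + 1 / (18 * \<sigma>)\<^sup>2 * (9 * \<sigma>\<^sup>2)\<^sup>2"
      using khinchine_upper[OF assms, of 2 2 c] unfolding \<sigma>2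
      by (intro add_left_mono mult_left_mono) auto
    finally have "\<sigma>\<^sup>2 \<le> (18 * \<sigma>) * sign_avg I ?A + 1 / (18 * \<sigma>)\<^sup>2 * (9 * \<sigma>\<^sup>2)\<^sup>2" .
    moreover have "1 / (18 * \<sigma>)\<^sup>2 * (9 * \<sigma>\<^sup>2)\<^sup>2 = \<sigma>\<^sup>2 / 4"
      using \<sigma> by (simp add: power2_eq_square field_simps)
    ultimately have "\<sigma> * \<sigma> \<le> \<sigma> * (24 * sign_avg I ?A)"
      by (simp add: power2_eq_square algebra_simps)
    then show ?thesis unfolding \<sigma>_def[symmetric] using \<sigma> by (simp only: mult_le_cancel_left_pos)
  qed
qed

text \<open>
  A Poincare inequality on the discrete cube, with one-sided increments: only decreases of \<open>F\<close>
  under the flip of a sign count. For a function that is convex in each sign such increments are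
  bounded by the gradient at the point itself, which is how the inequality is used.
\<close>

lemma sign_variance_le:
  fixes F :: "('i \<Rightarrow> real) \<Rightarrow> real"
  assumes "finite I"
  shows "sign_avg I (\<lambda>e. (F e - sign_avg I F)\<^sup>2)
          \<le> 1 / 2 * (\<Sum>i\<in>I. sign_avg I (\<lambda>e. (max 0 (F e - F (e(i := - e i))))\<^sup>2))"
  using assms
proof (induction I arbitrary: F rule: finite_induct)
  case (insert i I)
  note ins = sign_avg_insert[OF insert.hyps]
  let ?P = "\<lambda>e. F (e(i := 1))" and ?M = "\<lambda>e. F (e(i := - 1))"
  let ?G = "\<lambda>e. (?P e + ?M e) / 2"
  let ?D = "\<lambda>H j e. (max 0 (H e - H (e(j := - e j))))\<^sup>2 :: real"
  define \<mu> where "\<mu> = sign_avg I ?G"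
  have m: "sign_avg (insert i I) F = \<mu>" unfolding ins \<mu>_def ..
  have "sign_avg (insert i I) (\<lambda>e. (F e - \<mu>)\<^sup>2)
      = sign_avg I (\<lambda>e. (?G e - \<mu>)\<^sup>2 + 1 / 2 * (((max 0 (?P e - ?M e))\<^sup>2 + (max 0 (?M e - ?P e))\<^sup>2) / 2))"
    unfolding ins by (intro sign_avg_cong) (simp add: max_def power2_eq_square field_simps)
  also have "\<dots> = sign_avg I (\<lambda>e. (?G e - \<mu>)\<^sup>2) + 1 / 2 * sign_avg (insert i I) (?D F i)"
    unfolding sign_avg_add sign_avg_mult ins by simp
  finally have 1: "sign_avg (insert i I) (\<lambda>e. (F e - \<mu>)\<^sup>2) =
    sign_avg I (\<lambda>e. (?G e - \<mu>)\<^sup>2) + 1 / 2 * sign_avg (insert i I) (?D F i)" .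
  have 2: "sign_avg I (\<lambda>e. (?G e - \<mu>)\<^sup>2) \<le> 1 / 2 * (\<Sum>j\<in>I. sign_avg I (?D ?G j))"
    unfolding \<mu>_def by (rule insert.IH)
  have 3: "(\<Sum>j\<in>I. sign_avg I (?D ?G j)) \<le> (\<Sum>j\<in>I. sign_avg (insert i I) (?D F j))"
  proof (rule sum_mono)
    fix j assume j: "j \<in> I"
    then have ij: "j \<noteq> i" using insert.hyps by auto
    have sw: "e(j := y, i := z) = e(i := z, j := y)" for e :: "'i \<Rightarrow> real" and y z
      using ij by (simp add: fun_upd_twist)
    have conv: "(max 0 ((a + b) / 2))\<^sup>2 \<le> ((max 0 a)\<^sup>2 + (max 0 b)\<^sup>2) / 2" for a b :: real
    proof -
      have "max 0 ((a + b) / 2) \<le> (max 0 a + max 0 b) / 2" by (simp add: max_def)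
      then have "(max 0 ((a + b) / 2))\<^sup>2 \<le> ((max 0 a + max 0 b) / 2)\<^sup>2"
        by (intro power_mono) auto
      also have "\<dots> \<le> ((max 0 a)\<^sup>2 + (max 0 b)\<^sup>2) / 2"
        using sum_squares_bound[of "max 0 a" "max 0 b"] by (simp add: power2_eq_square field_simps)
      finally show ?thesis .
    qed
    show "sign_avg I (?D ?G j) \<le> sign_avg (insert i I) (?D F j)"
      unfolding ins
    proof (rule sign_avg_mono)
      fix e
      show "?D ?G j e \<le> (?D F j (e(i := 1)) + ?D F j (e(i := - 1))) / 2"
      proof -
        have eq: "?G e - ?G (e(j := - e j)) =
            ((?P e - ?P (e(j := - e j))) + (?M e - ?M (e(j := - e j)))) / 2"
          by (simp add: field_simps)
        show ?thesis
          unfolding eq using conv[of "?P e - ?P (e(j := - e j))" "?M e - ?M (e(j := - e j))"] ij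
          by (simp add: sw)
      qed
    qed
  qed
  show ?case
    unfolding m 1 sum.insert[OF insert.hyps] using 2 3 by simp
qed simp

section \<open>Orthonormal families of coordinate vectors\<close>

definition sqn :: "nat \<Rightarrow> (nat \<Rightarrow> 'k::real_or_complex) \<Rightarrow> real" where
  "sqn m a = (\<Sum>i<m. (norm (a i))\<^sup>2)"

definition lincomb :: "nat \<Rightarrow> (nat \<Rightarrow> 'k::real_or_complex) \<Rightarrow> (nat \<Rightarrow> nat \<Rightarrow> 'k) \<Rightarrow> nat \<Rightarrow> 'k" where
  "lincomb k b a = (\<lambda>i. \<Sum>j<k. b j * a j i)"

definition orthonormal :: "nat \<Rightarrow> nat \<Rightarrow> (nat \<Rightarrow> nat \<Rightarrow> 'k::real_or_complex) \<Rightarrow> bool" where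
  "orthonormal m k h \<longleftrightarrow> (\<forall>j<k. \<forall>j'<k. (\<Sum>i<m. h j i * kcnj (h j' i)) = (if j = j' then 1 else 0))"

lemma sqn_nonneg [simp]: "0 \<le> sqn m a"
  by (simp add: sqn_def sum_nonneg)

lemma sqn_kcnj [simp]: "sqn m (\<lambda>i. kcnj (a i)) = sqn m a"
  by (simp add: sqn_def)

lemma sqn_scale: "sqn m (\<lambda>i. c * a i) = (norm c)\<^sup>2 * sqn m a"
  by (simp add: sqn_def norm_mult power_mult_distrib sum_distrib_left)

lemma of_real_sqn: "of_real (sqn m a) = (\<Sum>i<m. a i * kcnj (a i))"
  by (simp add: sqn_def mult_kcnj)

lemma sqn_eq_0_iff: "sqn m a = 0 \<longleftrightarrow> (\<forall>i<m. a i = 0)"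
  by (auto simp: sqn_def sum_nonneg_eq_0_iff)

lemma norm_le_sqn: "i < m \<Longrightarrow> (norm (a i))\<^sup>2 \<le> sqn m a"
  unfolding sqn_def by (rule member_le_sum) auto

lemma norm_pairing_le: "(norm (\<Sum>i<m. a i * b i))\<^sup>2 \<le> sqn m a * sqn m b"
  unfolding sqn_def by (rule norm_sum_mult_square_le)

lemma sum_lincomb: "(\<Sum>i<m. lincomb k b a i * v i) = (\<Sum>j<k. b j * (\<Sum>i<m. a j i * v i))"
  unfolding lincomb_def sum_distrib_left sum_distrib_right
  by (subst sum.swap) (simp add: mult.assoc)

text \<open>
  The Euclidean norm of \<open>L\<close> is attained at the conjugate of \<open>L\<close>.
\<close>

lemma square_sum_le_by_duality:
  fixes L :: "'j \<Rightarrow> 'k::real_or_complex"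
  assumes "\<And>a. (norm (\<Sum>j\<in>J. a j * L j))\<^sup>2 \<le> B * (\<Sum>j\<in>J. (norm (a j))\<^sup>2)" "0 \<le> B"
  shows "(\<Sum>j\<in>J. (norm (L j))\<^sup>2) \<le> B"
proof -
  define S where "S = (\<Sum>j\<in>J. (norm (L j))\<^sup>2)"
  have S0: "0 \<le> S" by (simp add: S_def sum_nonneg)
  have "(\<Sum>j\<in>J. kcnj (L j) * L j) = of_real S"
    by (simp add: S_def mult_kcnj mult.commute[of "kcnj _"])
  then have "(norm (of_real S :: 'k))\<^sup>2 \<le> B * S"
    using assms(1)[of "\<lambda>j. kcnj (L j)"] by (simp add: S_def[symmetric])
  then have "S * S \<le> B * S"
    by (simp add: power2_eq_square)
  then have "S \<le> B"
    using S0 assms(2) by (cases "S = 0") auto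
  then show ?thesis by (simp add: S_def)
qed

lemma sqn_lincomb_orthonormal:
  assumes "orthonormal m k h"
  shows "sqn m (lincomb k c h) = sqn k c"
proof -
  have "of_real (sqn m (lincomb k c h)) = (\<Sum>i<m. lincomb k c h i * kcnj (lincomb k c h i))"
    by (rule of_real_sqn)
  also have "\<dots> = (\<Sum>j<k. c j * (\<Sum>i<m. h j i * kcnj (lincomb k c h i)))"
    by (rule sum_lincomb)
  also have "\<dots> = (\<Sum>j<k. c j * kcnj (c j))"
  proof (rule sum.cong[OF refl])
    fix j assume j: "j \<in> {..<k}"
    have "(\<Sum>i<m. h j i * kcnj (lincomb k c h i))
        = (\<Sum>i<m. \<Sum>j'<k. kcnj (c j') * (h j i * kcnj (h j' i)))"
      unfolding lincomb_def kcnj_sum kcnj_mult sum_distrib_left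
      by (intro sum.cong refl) (simp add: mult_ac)
    also have "\<dots> = (\<Sum>j'<k. kcnj (c j') * (\<Sum>i<m. h j i * kcnj (h j' i)))"
      by (subst sum.swap) (simp add: sum_distrib_left)
    also have "\<dots> = (\<Sum>j'<k. if j = j' then kcnj (c j') else 0)"
      using assms j unfolding orthonormal_def by (intro sum.cong) auto
    also have "\<dots> = kcnj (c j)"
      using j by simp
    finally show "c j * (\<Sum>i<m. h j i * kcnj (lincomb k c h i)) = c j * kcnj (c j)"
      by simp
  qed
  also have "\<dots> = (of_real (sqn k c) :: 'a)"
    by (rule of_real_sqn[symmetric])
  finally show ?thesis by (simp only: of_real_eq_iff)
qed

text \<open>
  The pairing is bilinear. Since the conjugates of orthonormal vectors are orthonormal, the usual
  inequality holds.
\<close>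

lemma bessel_inequality:
  assumes "orthonormal m k h"
  shows "(\<Sum>j<k. (norm (\<Sum>i<m. h j i * v i))\<^sup>2) \<le> sqn m v"
proof (rule square_sum_le_by_duality)
  fix a
  have "(norm (\<Sum>j<k. a j * (\<Sum>i<m. h j i * v i)))\<^sup>2 \<le> sqn m (lincomb k a h) * sqn m v"
    unfolding sum_lincomb[symmetric] by (rule norm_pairing_le)
  then show "(norm (\<Sum>j<k. a j * (\<Sum>i<m. h j i * v i)))\<^sup>2 \<le> sqn m v * (\<Sum>j<k. (norm (a j))\<^sup>2)"
    unfolding sqn_lincomb_orthonormal[OF assms] by (simp add: sqn_def mult.commute)
qed simp

text \<open>
  Fewer equations than unknowns: one unknown is eliminated with the help of the last equation.
\<close>

lemma homogeneous_system_solution: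
  fixes c :: "nat \<Rightarrow> 'j \<Rightarrow> 'k::field"
  assumes "finite J" "T < card J"
  shows "\<exists>b. (\<exists>j\<in>J. b j \<noteq> 0) \<and> (\<forall>t<T. (\<Sum>j\<in>J. b j * c t j) = 0)"
  using assms
proof (induction T arbitrary: J c)
  case 0
  then obtain j where "j \<in> J" by fastforce
  then show ?case by (intro exI[of _ "\<lambda>_. 1"]) auto
next
  case (Suc T)
  show ?case
  proof (cases "\<forall>j\<in>J. c T j = 0")
    case True
    obtain b where b: "\<exists>j\<in>J. b j \<noteq> 0" "\<And>t. t < T \<Longrightarrow> (\<Sum>j\<in>J. b j * c t j) = 0"
      using Suc.IH[of J c] Suc.prems by auto
    have "(\<Sum>j\<in>J. b j * c t j) = 0" if "t < Suc T" for t
      using b(2)[of t] that True by (cases "t = T") auto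
    then show ?thesis using b(1) by blast
  next
    case False
    then obtain i where i: "i \<in> J" "c T i \<noteq> 0" by blast
    define J' where "J' = J - {i}"
    have J: "J = insert i J'" "finite J'" "i \<notin> J'" using i Suc.prems by (auto simp: J'_def)
    have "T < card J'" using Suc.prems J by simp
    then obtain b where b: "\<exists>j\<in>J'. b j \<noteq> 0"
      "\<And>t. t < T \<Longrightarrow> (\<Sum>j\<in>J'. b j * (c t j - c t i * c T j / c T i)) = 0"
      using Suc.IH[of J' "\<lambda>t j. c t j - c t i * c T j / c T i"] J by auto
    define b' where "b' = b(i := - (\<Sum>j\<in>J'. b j * c T j) / c T i)"
    have s: "(\<Sum>j\<in>J. b' j * c t j) = - (\<Sum>j\<in>J'. b j * c T j) / c T i * c t i + (\<Sum>j\<in>J'. b j * c t j)" for t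
    proof -
      have "(\<Sum>j\<in>J'. b' j * c t j) = (\<Sum>j\<in>J'. b j * c t j)"
        using J by (intro sum.cong) (auto simp: b'_def)
      then show ?thesis unfolding J(1) sum.insert[OF J(2,3)] by (simp add: b'_def)
    qed
    have "(\<Sum>j\<in>J. b' j * c t j) = 0" if t: "t < Suc T" for t
    proof (cases "t = T")
      case True
      then show ?thesis unfolding s using i by simp
    next
      case False
      then have "(\<Sum>j\<in>J'. b j * c t j) - (\<Sum>j\<in>J'. b j * c T j) * (c t i / c T i) = 0"
        using b(2)[of t] t unfolding sum_distrib_right sum_subtractf[symmetric]
        by (simp add: algebra_simps)
      then show ?thesis unfolding s by (simp add: algebra_simps)
    qed
    moreover have "\<exists>j\<in>J. b' j \<noteq> 0"
      using b(1) J by (auto simp: b'_def)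
    ultimately show ?thesis by blast
  qed
qed

text \<open>
  Gram--Schmidt with side conditions. The next vector solves a homogeneous system in the
  coefficients: it is orthogonal to the vectors found before and satisfies the \<open>T\<close> constraints,
  altogether fewer equations than the \<open>k'\<close> unknowns. The lower bound excludes that the solution
  yields the zero vector.
\<close>

lemma orthonormal_in_span:
  fixes a :: "nat \<Rightarrow> nat \<Rightarrow> 'k::real_or_complex"
  assumes low: "\<And>b. \<gamma> * sqn k' b \<le> sqn m (lincomb k' b a)" and "0 < \<gamma>" and "k + T \<le> k'"
  shows "\<exists>h \<beta>. orthonormal m k h \<and> (\<forall>j<k. h j = lincomb k' (\<beta> j) a) \<and>
           (\<forall>j<k. \<forall>t<T. (\<Sum>i<m. h j i * c t i) = 0)"
  using assms(3)
proof (induction k)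
  case 0
  show ?case by (simp add: orthonormal_def)
next
  case (Suc k)
  then obtain h \<beta> where h: "orthonormal m k h" "\<And>j. j < k \<Longrightarrow> h j = lincomb k' (\<beta> j) a"
    "\<And>j t. j < k \<Longrightarrow> t < T \<Longrightarrow> (\<Sum>i<m. h j i * c t i) = 0"
    by auto
  define c' where "c' = (\<lambda>t i. if t < T then c t i else kcnj (h (t - T) i))"
  obtain b where b: "\<exists>j<k'. b j \<noteq> 0" "\<And>t. t < T + k \<Longrightarrow> (\<Sum>j<k'. b j * (\<Sum>i<m. a j i * c' t i)) = 0"
    using homogeneous_system_solution[of "{..<k'}" "T + k" "\<lambda>t j. \<Sum>i<m. a j i * c' t i"] Suc.prems
    by auto
  define v where "v = lincomb k' b a"
  have v0: "(\<Sum>i<m. v i * c' t i) = 0" if "t < T + k" for t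
    unfolding v_def sum_lincomb by (rule b(2)[OF that])
  have "sqn k' b \<noteq> 0" using b(1) by (auto simp: sqn_eq_0_iff)
  then have "0 < sqn k' b" by (metis sqn_nonneg less_eq_real_def)
  then have V: "0 < sqn m v" using low[of b] assms(2) unfolding v_def
    by (meson mult_pos_pos order_less_le_trans)
  define \<rho> :: 'k where "\<rho> = of_real (1 / sqrt (sqn m v))"
  define g where "g = (\<lambda>i. \<rho> * v i)"
  have g0: "(\<Sum>i<m. g i * c' t i) = 0" if "t < T + k" for t
    using v0[OF that] unfolding g_def mult.assoc sum_distrib_left[symmetric] by simp
  have gh: "(\<Sum>i<m. g i * kcnj (h j i)) = 0" if "j < k" for j
    using g0[of "T + j"] that by (simp add: c'_def)
  have hg: "(\<Sum>i<m. h j i * kcnj (g i)) = 0" if "j < k" for j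
    using arg_cong[OF gh[OF that], of kcnj] by (simp add: kcnj_sum kcnj_mult mult.commute)
  have "sqn m g = 1"
    unfolding g_def sqn_scale \<rho>_def using V by (simp add: power_divide norm_divide)
  then have gg: "(\<Sum>i<m. g i * kcnj (g i)) = 1"
    using of_real_sqn[of m g] by simp
  have g: "g = lincomb k' (\<lambda>j. \<rho> * b j) a"
    by (simp add: g_def v_def lincomb_def sum_distrib_left mult.assoc)
  have gc: "(\<Sum>i<m. g i * c t i) = 0" if "t < T" for t
    using g0[of t] that by (simp add: c'_def)
  show ?case
  proof (intro exI conjI allI impI)
    show "orthonormal m (Suc k) (h(k := g))"
      using h(1) gh hg gg unfolding orthonormal_def less_Suc_eq by simp
    show "(h(k := g)) j = lincomb k' ((\<beta>(k := \<lambda>j. \<rho> * b j)) j) a" if "j < Suc k" for j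
      using that h(2)[of j] g by (cases "j = k") simp_all
    show "(\<Sum>i<m. (h(k := g)) j i * c t i) = 0" if "j < Suc k" "t < T" for j t
      using that h(3)[of j t] gc[of t] by (cases "j = k") simp_all
  qed
qed

lemma orthonormal_complement:
  fixes c :: "nat \<Rightarrow> nat \<Rightarrow> 'k::real_or_complex"
  assumes "k + T \<le> m"
  shows "\<exists>h. orthonormal m k h \<and> (\<forall>j<k. \<forall>t<T. (\<Sum>i<m. h j i * c t i) = 0)"
proof -
  have "1 * sqn m b \<le> sqn m (lincomb m b (\<lambda>j i. if i = j then 1 else 0))" for b :: "nat \<Rightarrow> 'k"
  proof -
    have "lincomb m b (\<lambda>j i. if i = j then 1 else 0) i = b i" if "i < m" for i
      using that by (simp add: lincomb_def if_distrib cong: if_cong)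
    then show ?thesis by (simp add: sqn_def)
  qed
  from orthonormal_in_span[OF this zero_less_one assms, where c = c]
  show ?thesis by (elim exE conjE) (intro exI conjI)
qed

text \<open>
  The quadratic form \<open>B\<close> of second moments has trace at most \<open>\<kappa> m\<close>, by Bessel's inequality at each
  point. A maximal orthonormal family of vectors on which \<open>B\<close> exceeds \<open>2 \<kappa>\<close> therefore has at most
  \<open>m / 2\<close> members, and on the orthogonal complement of the family \<open>B\<close> is bounded by \<open>2 \<kappa>\<close>, by
  maximality.
\<close>

lemma flat_orthonormal_family:
  fixes v :: "'s \<Rightarrow> nat \<Rightarrow> 'k::real_or_complex"
  assumes \<nu>: "\<And>s. s \<in> S \<Longrightarrow> 0 \<le> \<nu> s" "(\<Sum>s\<in>S. \<nu> s) \<le> \<kappa>" "0 < \<kappa>"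
    and v: "\<And>s. s \<in> S \<Longrightarrow> sqn m (v s) \<le> real m"
  shows "\<exists>d f. m \<le> 2 * d \<and> d \<le> m \<and> orthonormal m d f \<and>
    (\<forall>a. (\<Sum>s\<in>S. \<nu> s * (norm (\<Sum>i<m. lincomb d a f i * v s i))\<^sup>2) \<le> 2 * \<kappa> * sqn d a)"
proof -
  define B where "B = (\<lambda>g. \<Sum>s\<in>S. \<nu> s * (norm (\<Sum>i<m. g i * v s i))\<^sup>2)"
  define large where
    "large = (\<lambda>t. \<exists>h. orthonormal m t h \<and> (\<forall>j<t. 2 * \<kappa> < B (h j)))"
  have bound: "2 * t \<le> m" if lt: "large t" for t
  proof -
    obtain h where h: "orthonormal m t h" "\<And>j. j < t \<Longrightarrow> 2 * \<kappa> < B (h j)"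
      using lt unfolding large_def by blast
    have "real t * (2 * \<kappa>) = (\<Sum>j<t. 2 * \<kappa>)" by simp
    also have "\<dots> \<le> (\<Sum>j<t. B (h j))" using h(2) by (intro sum_mono) (auto intro: less_imp_le)
    also have "\<dots> = (\<Sum>s\<in>S. \<nu> s * (\<Sum>j<t. (norm (\<Sum>i<m. h j i * v s i))\<^sup>2))"
      unfolding B_def sum_distrib_left by (rule sum.swap)
    also have "\<dots> \<le> (\<Sum>s\<in>S. \<nu> s * real m)"
      by (intro sum_mono mult_left_mono order_trans[OF bessel_inequality[OF h(1)] v] \<nu>)
    also have "\<dots> \<le> \<kappa> * real m"
      unfolding sum_distrib_right[symmetric] using \<nu> by (intro mult_right_mono) auto
    finally have "\<kappa> * real (2 * t) \<le> \<kappa> * real m" by (simp add: mult_ac)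
    then show ?thesis using \<nu>(3) by (simp only: mult_le_cancel_left_pos of_nat_le_iff)
  qed
  have "large 0" by (simp add: large_def orthonormal_def)
  then obtain t where t: "large t" "\<And>t'. large t' \<Longrightarrow> t' \<le> t"
  proof -
    have b: "t \<le> m" if "large t" for t using bound[OF that] by simp
    show ?thesis
      by (rule that[of "Greatest large"])
        (use GreatestI_nat[of large 0 m] Greatest_le_nat[of large _ m] b \<open>large 0\<close> in blast)+
  qed
  then obtain h where h: "orthonormal m t h" "\<And>j. j < t \<Longrightarrow> 2 * \<kappa> < B (h j)"
    unfolding large_def by blast
  define d where "d = m - t"
  have tm: "2 * t \<le> m" using bound t by blast
  obtain f where f: "orthonormal m d f" "\<And>l j. l < d \<Longrightarrow> j < t \<Longrightarrow> (\<Sum>i<m. f l i * kcnj (h j i)) = 0"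
    using orthonormal_complement[of d t m "\<lambda>j i. kcnj (h j i)"] tm by (auto simp: d_def)
  have "B (lincomb d a f) \<le> 2 * \<kappa> * sqn d a" for a
  proof (rule ccontr)
    assume big: "\<not> ?thesis"
    define g where "g = lincomb d a f"
    have N: "sqn m g = sqn d a" unfolding g_def by (rule sqn_lincomb_orthonormal[OF f(1)])
    have pos: "0 < sqn d a"
    proof (rule ccontr)
      assume "\<not> 0 < sqn d a"
      then have z: "sqn d a = 0" using sqn_nonneg[of d a] by linarith
      then have "sqn m g = 0" using N by simp
      then have "g i = 0" if "i < m" for i using that by (simp add: sqn_eq_0_iff)
      then have "B g = 0" by (simp add: B_def)
      then show False using big z by (simp add: g_def)
    qed
    define \<rho> :: 'k where "\<rho> = of_real (1 / sqrt (sqn d a))"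
    define u where "u = (\<lambda>i. \<rho> * g i)"
    have nr: "(norm \<rho>)\<^sup>2 = 1 / sqn d a" using pos by (simp add: \<rho>_def power_divide norm_divide)
    have Bu: "B u = 1 / sqn d a * B g"
      unfolding B_def u_def mult.assoc sum_distrib_left[symmetric] norm_mult power_mult_distrib nr
      by (simp add: sum_distrib_left mult_ac)
    have Bu': "2 * \<kappa> < B u"
      unfolding Bu using big pos by (simp add: g_def field_simps)
    have uu: "(\<Sum>i<m. u i * kcnj (u i)) = 1"
      unfolding of_real_sqn[symmetric] u_def sqn_scale nr N using pos by simp
    have uh: "(\<Sum>i<m. u i * kcnj (h j i)) = 0" if "j < t" for j
      unfolding u_def g_def mult.assoc sum_distrib_left[symmetric] sum_lincomb
      using f(2) that by simp
    have hu: "(\<Sum>i<m. h j i * kcnj (u i)) = 0" if "j < t" for j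
      using arg_cong[OF uh[OF that], of kcnj] by (simp add: kcnj_sum kcnj_mult mult.commute)
    have "large (Suc t)"
      unfolding large_def
    proof (intro exI conjI allI impI)
      show "orthonormal m (Suc t) (h(t := u))"
        using h(1) uh hu uu unfolding orthonormal_def less_Suc_eq by simp
      show "2 * \<kappa> < B ((h(t := u)) j)" if "j < Suc t" for j
        using that h(2)[of j] Bu' by (cases "j = t") simp_all
    qed
    then show False using t(2) by fastforce
  qed
  then show ?thesis
    using f(1) tm unfolding B_def by (intro exI[of _ d] exI[of _ f]) (auto simp: d_def)
qed

section \<open>Moments of random sign combinations\<close>

lemma power_diff_le: "x ^ r - y ^ r \<le> real r * x ^ (r - 1) * (x - y)" if "0 \<le> x" "0 \<le> (y::real)"
proof (induction r)
  case (Suc r)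
  show ?case
  proof (cases r)
    case (Suc q)
    have "x ^ Suc r - y ^ Suc r = x * (x ^ r - y ^ r) + (x - y) * y ^ r"
      by (simp add: algebra_simps)
    moreover have "x * (x ^ r - y ^ r) \<le> x * (real r * x ^ (r - 1) * (x - y))"
      using Suc.IH that by (intro mult_left_mono) auto
    moreover have "(x - y) * y ^ r \<le> (x - y) * x ^ r"
      using that by (cases "y \<le> x") (auto intro: mult_left_mono mult_left_mono_neg power_mono)
    ultimately show ?thesis using Suc by (simp add: algebra_simps)
  qed simp
qed simp

text \<open>
  Convexity of \<open>z \<mapsto> \<bar>z\<bar>\<^sup>2\<^sup>r\<close>: the graph lies above its tangent at \<open>z\<close>.
\<close>

lemma norm_power_diff_le:
  fixes z h :: "'k::real_or_complex"
  shows "norm z ^ (2 * r) - norm (z - h) ^ (2 * r) \<le> 2 * real r * norm z ^ (2 * (r - 1)) * kre (h * kcnj z)"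
proof -
  have "kre (z * kcnj h) = kre (h * kcnj z)"
    using kre_kcnj[of "h * kcnj z"] by (simp add: kcnj_mult mult.commute)
  then have d: "(norm z)\<^sup>2 - (norm (z - h))\<^sup>2 \<le> 2 * kre (h * kcnj z)"
    unfolding norm_diff_square by simp
  have "norm z ^ (2 * r) - norm (z - h) ^ (2 * r)
      \<le> real r * ((norm z)\<^sup>2) ^ (r - 1) * ((norm z)\<^sup>2 - (norm (z - h))\<^sup>2)"
    unfolding power_mult by (rule power_diff_le) auto
  also have "\<dots> \<le> real r * ((norm z)\<^sup>2) ^ (r - 1) * (2 * kre (h * kcnj z))"
    by (intro mult_left_mono d) auto
  finally show ?thesis by (simp add: power_mult mult_ac)
qed

text \<open>
  \<open>F\<close> is a sum of even powers of linear functions of the signs, hence convex. A flip at \<open>i\<close>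
  decreases it by at most \<open>4 r \<bar>\<Sum>\<^sub>s \<nu>\<^sub>s \<psi>\<^sub>s c\<^sub>s\<^sub>i\<bar>\<close>, where \<open>\<psi> = \<bar>U\<bar>\<^sup>2\<^sup>r\<^sup>-\<^sup>2 U\<^sup>*\<close> does not depend on \<open>i\<close>. The
  hypothesis on \<open>\<tau>\<close>, a Bessel inequality for the functions \<open>s \<mapsto> c\<^sub>s\<^sub>i\<close>, sums the squares over \<open>i\<close> to
  a moment of order \<open>2 (2 r - 1)\<close> of \<open>U\<close>, whose average is bounded by Khinchine's inequality. In
  the application \<open>\<tau>\<close> is of order \<open>1 / d\<close>.
\<close>

lemma rademacher_moment_variance:
  fixes c :: "'s \<Rightarrow> 'i \<Rightarrow> 'k::real_or_complex"
  assumes I: "finite I" and \<nu>: "\<And>s. s \<in> S \<Longrightarrow> 0 \<le> \<nu> s" "(\<Sum>s\<in>S. \<nu> s) \<le> \<kappa>"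
    and c: "\<And>s. s \<in> S \<Longrightarrow> (\<Sum>i\<in>I. (norm (c s i))\<^sup>2) \<le> \<sigma>"
    and \<tau>: "\<And>\<psi>. (\<Sum>i\<in>I. (norm (\<Sum>s\<in>S. of_real (\<nu> s) * \<psi> s * c s i))\<^sup>2) \<le> \<tau> * (\<Sum>s\<in>S. \<nu> s * (norm (\<psi> s))\<^sup>2)"
    and "0 \<le> \<tau>" and \<sigma>: "0 \<le> \<sigma>" and "1 \<le> r"
  defines "F \<equiv> (\<lambda>e. \<Sum>s\<in>S. \<nu> s * norm (\<Sum>i\<in>I. e i *\<^sub>R c s i) ^ (2 * r))"
  shows "sign_avg I F \<le> \<kappa> * ((4 * real r + 1) * \<sigma>) ^ r"
    and "sign_avg I (\<lambda>e. (F e - sign_avg I F)\<^sup>2)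
          \<le> 8 * (real r)\<^sup>2 * \<tau> * (\<kappa> * ((4 * real (2 * r - 1) + 1) * \<sigma>) ^ (2 * r - 1))"
proof -
  define U where "U = (\<lambda>s e. \<Sum>i\<in>I. e i *\<^sub>R c s i)"
  have moment: "sign_avg I (\<lambda>e. \<Sum>s\<in>S. \<nu> s * norm (U s e) ^ (2 * q)) \<le> \<kappa> * ((4 * real q + 1) * \<sigma>) ^ q" for q
  proof -
    have "sign_avg I (\<lambda>e. \<Sum>s\<in>S. \<nu> s * norm (U s e) ^ (2 * q))
        = (\<Sum>s\<in>S. \<nu> s * sign_avg I (\<lambda>e. norm (U s e) ^ (2 * q)))"
      unfolding sign_avg_sum sign_avg_mult ..
    also have "\<dots> \<le> (\<Sum>s\<in>S. \<nu> s * ((4 * real q + 1) * \<sigma>) ^ q)"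
    proof (intro sum_mono mult_left_mono \<nu>)
      fix s assume s: "s \<in> S"
      have "sign_avg I (\<lambda>e. norm (U s e) ^ (2 * q)) \<le> ((4 * real q + 1) * (\<Sum>i\<in>I. (norm (c s i))\<^sup>2)) ^ q"
        unfolding U_def by (rule khinchine_upper[OF I order_refl])
      also have "\<dots> \<le> ((4 * real q + 1) * \<sigma>) ^ q"
        using c[OF s] by (intro power_mono mult_left_mono) (auto simp: sum_nonneg)
      finally show "sign_avg I (\<lambda>e. norm (U s e) ^ (2 * q)) \<le> ((4 * real q + 1) * \<sigma>) ^ q" .
    qed
    also have "\<dots> \<le> \<kappa> * ((4 * real q + 1) * \<sigma>) ^ q"
      unfolding sum_distrib_right[symmetric] using \<nu> \<sigma> by (intro mult_right_mono) auto
    finally show ?thesis .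
  qed
  show "sign_avg I F \<le> \<kappa> * ((4 * real r + 1) * \<sigma>) ^ r"
    unfolding F_def using moment[of r] by (simp add: U_def)
  define \<psi> where "\<psi> = (\<lambda>e s. of_real (norm (U s e) ^ (2 * (r - 1))) * kcnj (U s e))"
  have step: "(max 0 (F e - F (e(i := - e i))))\<^sup>2
      \<le> 16 * (real r)\<^sup>2 * (norm (\<Sum>s\<in>S. of_real (\<nu> s) * \<psi> e s * c s i))\<^sup>2"
    if i: "i \<in> I" and e: "e \<in> signs I" for e i
  proof -
    have flip: "U s (e(i := - e i)) = U s e - (2 * e i) *\<^sub>R c s i" for s
    proof -
      have "(\<Sum>j\<in>I - {i}. (e(i := - e i)) j *\<^sub>R c s j) = (\<Sum>j\<in>I - {i}. e j *\<^sub>R c s j)"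
        by (intro sum.cong) auto
      moreover have "(2 * e i) *\<^sub>R c s i = e i *\<^sub>R c s i + e i *\<^sub>R c s i"
        by (simp add: scaleR_left_distrib[symmetric])
      ultimately show ?thesis
        unfolding U_def sum.remove[OF I i] by simp
    qed
    have "F e - F (e(i := - e i))
        = (\<Sum>s\<in>S. \<nu> s * (norm (U s e) ^ (2 * r) - norm (U s e - (2 * e i) *\<^sub>R c s i) ^ (2 * r)))"
      unfolding F_def U_def[symmetric] flip[symmetric]
      by (simp add: sum_subtractf right_diff_distrib U_def)
    also have "\<dots> \<le> (\<Sum>s\<in>S. \<nu> s * (2 * real r * norm (U s e) ^ (2 * (r - 1)) *
                        kre ((2 * e i) *\<^sub>R c s i * kcnj (U s e))))"
      by (intro sum_mono mult_left_mono norm_power_diff_le \<nu>)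
    also have "\<dots> = 4 * real r * e i * kre (\<Sum>s\<in>S. of_real (\<nu> s) * \<psi> e s * c s i)"
    proof -
      have 1: "kre ((2 * e i) *\<^sub>R c s i * kcnj (U s e)) = 2 * e i * kre (c s i * kcnj (U s e))" for s
        using kre_scale[of "2 * e i" "c s i * kcnj (U s e)"] by (simp add: scaleR_conv_of_real mult.assoc)
      have 2: "kre (of_real (\<nu> s) * \<psi> e s * c s i)
          = \<nu> s * norm (U s e) ^ (2 * (r - 1)) * kre (c s i * kcnj (U s e))" for s
        using kre_scale[of "\<nu> s * norm (U s e) ^ (2 * (r - 1))" "c s i * kcnj (U s e)"]
        by (simp add: \<psi>_def mult_ac)
      show ?thesis
        unfolding kre_sum 1 2 sum_distrib_left by (intro sum.cong refl) simp
    qed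
    also have "\<dots> \<le> 4 * real r * norm (\<Sum>s\<in>S. of_real (\<nu> s) * \<psi> e s * c s i)"
    proof -
      have "e i * kre x \<le> norm x" for x :: 'k
        using signs_cases[OF e i] abs_kre_le[of x] by auto
      then show ?thesis
        unfolding mult.assoc by (intro mult_left_mono) auto
    qed
    finally have "max 0 (F e - F (e(i := - e i))) \<le> 4 * real r * norm (\<Sum>s\<in>S. of_real (\<nu> s) * \<psi> e s * c s i)"
      by simp
    then have "(max 0 (F e - F (e(i := - e i))))\<^sup>2 \<le> (4 * real r * norm (\<Sum>s\<in>S. of_real (\<nu> s) * \<psi> e s * c s i))\<^sup>2"
      by (intro power_mono) auto
    then show ?thesis by (simp add: power_mult_distrib)
  qed
  have psi2: "(norm (\<psi> e s))\<^sup>2 = norm (U s e) ^ (2 * (2 * r - 1))" for e s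
  proof -
    have "(norm (\<psi> e s))\<^sup>2 = (norm (U s e) ^ (2 * (r - 1) + 1))\<^sup>2"
      by (simp add: \<psi>_def norm_mult norm_power mult.commute)
    also have "\<dots> = norm (U s e) ^ (2 * (2 * r - 1))"
      unfolding power_mult[symmetric] using \<open>1 \<le> r\<close> by (intro arg_cong2[where f = power]) auto
    finally show ?thesis .
  qed
  have "sign_avg I (\<lambda>e. (F e - sign_avg I F)\<^sup>2)
      \<le> 1 / 2 * (\<Sum>i\<in>I. sign_avg I (\<lambda>e. (max 0 (F e - F (e(i := - e i))))\<^sup>2))"
    by (rule sign_variance_le[OF I])
  also have "\<dots> \<le> 1 / 2 * (\<Sum>i\<in>I. sign_avg I (\<lambda>e. 16 * (real r)\<^sup>2 * (norm (\<Sum>s\<in>S. of_real (\<nu> s) * \<psi> e s * c s i))\<^sup>2))"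
    by (intro mult_left_mono sum_mono sign_avg_mono step) auto
  also have "\<dots> = 8 * (real r)\<^sup>2 * sign_avg I (\<lambda>e. \<Sum>i\<in>I. (norm (\<Sum>s\<in>S. of_real (\<nu> s) * \<psi> e s * c s i))\<^sup>2)"
    unfolding sign_avg_sum sign_avg_mult sum_distrib_left[symmetric] by simp
  also have "\<dots> \<le> 8 * (real r)\<^sup>2 * sign_avg I (\<lambda>e. \<tau> * (\<Sum>s\<in>S. \<nu> s * norm (U s e) ^ (2 * (2 * r - 1))))"
    unfolding psi2[symmetric] by (intro mult_left_mono sign_avg_mono \<tau>) auto
  also have "\<dots> = 8 * (real r)\<^sup>2 * \<tau> * sign_avg I (\<lambda>e. \<Sum>s\<in>S. \<nu> s * norm (U s e) ^ (2 * (2 * r - 1)))"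
    unfolding sign_avg_mult by simp
  also have "\<dots> \<le> 8 * (real r)\<^sup>2 * \<tau> * (\<kappa> * ((4 * real (2 * r - 1) + 1) * \<sigma>) ^ (2 * r - 1))"
    using \<open>0 \<le> \<tau>\<close> by (intro mult_left_mono moment) auto
  finally show "sign_avg I (\<lambda>e. (F e - sign_avg I F)\<^sup>2)
          \<le> 8 * (real r)\<^sup>2 * \<tau> * (\<kappa> * ((4 * real (2 * r - 1) + 1) * \<sigma>) ^ (2 * r - 1))" .
qed

text \<open>
  The off-diagonal entries of the Gram matrix of \<open>k\<close> random sign vectors of length \<open>d\<close> have root
  mean square \<open>\<surd>d\<close>, whereas the diagonal entries are \<open>d\<close>; so the vectors are nearly orthogonal
  when \<open>d\<close> is large.
\<close>

lemma sign_avg_gram: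
  fixes k d :: nat
  assumes "j < k" "j' < k" "j \<noteq> j'"
  shows "sign_avg ({..<k} \<times> {..<d}) (\<lambda>e. (\<Sum>l<d. e (j, l) * e (j', l))\<^sup>2) = real d"
proof -
  let ?I = "{..<k} \<times> {..<d}"
  have fin: "finite ?I" by simp
  have "sign_avg ?I (\<lambda>e. (\<Sum>l<d. e (j, l) * e (j', l))\<^sup>2)
      = (\<Sum>l<d. \<Sum>l'<d. sign_avg ?I (\<lambda>e. (e (j, l) * e (j', l)) * (e (j, l') * e (j', l'))))"
    unfolding power2_eq_square sum_product sign_avg_sum ..
  also have "\<dots> = (\<Sum>l<d. \<Sum>l'<d. if l = l' then 1 else 0)"
  proof (intro sum.cong refl)
    fix l l' assume l: "l \<in> {..<d}" "l' \<in> {..<d}"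
    show "sign_avg ?I (\<lambda>e. (e (j, l) * e (j', l)) * (e (j, l') * e (j', l'))) = (if l = l' then 1 else 0)"
    proof (cases "l = l'")
      case True
      have "sign_avg ?I (\<lambda>e. (e (j, l) * e (j', l)) * (e (j, l') * e (j', l'))) = sign_avg ?I (\<lambda>e. 1)"
      proof (rule sign_avg_cong)
        fix e assume "e \<in> signs ?I"
        then have "e (j, l) * e (j, l) = 1" "e (j', l) * e (j', l) = 1"
          using assms l by (auto intro: signs_square)
        then show "(e (j, l) * e (j', l)) * (e (j, l') * e (j', l')) = 1"
          unfolding True[symmetric] by (metis mult.left_commute mult.assoc mult_1)
      qed
      then show ?thesis using True fin by simp
    next
      case False
      have "sign_avg ?I (\<lambda>e. e (j, l) * (\<lambda>e. e (j', l) * (e (j, l') * e (j', l'))) (e((j, l) := 1))) = 0"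
        using assms l by (intro sign_avg_flip) auto
      then show ?thesis using False assms by (simp add: mult.assoc)
    qed
  qed
  finally show ?thesis by simp
qed

lemma gram_lower_bound:
  fixes b :: "nat \<Rightarrow> 'k::real_or_complex" and e :: "nat \<times> nat \<Rightarrow> real"
  assumes e: "e \<in> signs ({..<k} \<times> {..<d})" and d: "0 < d"
    and G: "(\<Sum>(j, j') \<in> {(j, j'). j < k \<and> j' < k \<and> j \<noteq> j'}. ((\<Sum>l<d. e (j, l) * e (j', l)) / d)\<^sup>2) \<le> 1 / 4"
  shows "sqn k b / 2 \<le> (\<Sum>l<d. (norm (\<Sum>j<k. e (j, l) *\<^sub>R b j))\<^sup>2) / d"
proof -
  define P where "P = {(j, j'). j < k \<and> j' < k \<and> j \<noteq> j'}"
  define D where "D = {(j, j'). j < k \<and> j' < k \<and> j = j'}"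
  define g where "g = (\<lambda>(j, j'). (\<Sum>l<d. e (j, l) * e (j', l)) / d)"
  have PD: "{..<k} \<times> {..<k} = D \<union> P" "D \<inter> P = {}" by (auto simp: P_def D_def)
  have fin: "finite P" "finite D"
    by (rule finite_subset[of _ "{..<k} \<times> {..<k}"]; auto simp: P_def D_def)+
  have "(\<Sum>l<d. (norm (\<Sum>j<k. e (j, l) *\<^sub>R b j))\<^sup>2)
      = (\<Sum>l<d. \<Sum>(j, j')\<in>{..<k} \<times> {..<k}. e (j, l) * e (j', l) * kre (b j * kcnj (b j')))"
  proof (rule sum.cong[OF refl])
    fix l
    have 1: "kre ((e (j, l) *\<^sub>R b j) * kcnj (e (j', l) *\<^sub>R b j')) = e (j, l) * e (j', l) * kre (b j * kcnj (b j'))" for j j'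
      using kre_scale[of "e (j, l) * e (j', l)" "b j * kcnj (b j')"]
      by (simp add: scaleR_conv_of_real kcnj_mult mult_ac)
    show "(norm (\<Sum>j<k. e (j, l) *\<^sub>R b j))\<^sup>2
        = (\<Sum>(j, j')\<in>{..<k} \<times> {..<k}. e (j, l) * e (j', l) * kre (b j * kcnj (b j')))"
      unfolding kre_mult_kcnj[symmetric] kcnj_sum sum_product kre_sum 1
      by (simp add: sum.cartesian_product)
  qed
  also have "\<dots> / d = (\<Sum>p\<in>{..<k} \<times> {..<k}. g p * kre (b (fst p) * kcnj (b (snd p))))"
    by (subst sum.swap) (simp add: g_def case_prod_unfold sum_distrib_right sum_divide_distrib)
  also have "\<dots> = (\<Sum>p\<in>D. g p * kre (b (fst p) * kcnj (b (snd p))))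
                + (\<Sum>p\<in>P. g p * kre (b (fst p) * kcnj (b (snd p))))"
    unfolding PD(1) by (rule sum.union_disjoint[OF fin(2,1) PD(2)])
  also have "(\<Sum>p\<in>D. g p * kre (b (fst p) * kcnj (b (snd p)))) = sqn k b"
  proof -
    have D: "D = (\<lambda>j. (j, j)) ` {..<k}" by (auto simp: D_def)
    have "g (j, j) = 1" if "j < k" for j
    proof -
      have "(\<Sum>l<d. e (j, l) * e (j, l)) = (\<Sum>l<d. 1)"
        using that by (intro sum.cong refl signs_square[OF e]) auto
      then show ?thesis using d by (simp add: g_def)
    qed
    then show ?thesis
      unfolding D sqn_def by (subst sum.reindex) (auto simp: inj_on_def kre_mult_kcnj)
  qed
  finally have eq: "(\<Sum>l<d. (norm (\<Sum>j<k. e (j, l) *\<^sub>R b j))\<^sup>2) / d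
      = sqn k b + (\<Sum>p\<in>P. g p * kre (b (fst p) * kcnj (b (snd p))))" .
  have "(\<Sum>p\<in>P. g p * kre (b (fst p) * kcnj (b (snd p))))\<^sup>2
      \<le> (\<Sum>p\<in>P. (g p)\<^sup>2) * (\<Sum>p\<in>P. (kre (b (fst p) * kcnj (b (snd p))))\<^sup>2)"
    by (rule Cauchy_Schwarz_ineq_sum)
  also have "\<dots> \<le> 1 / 4 * (sqn k b)\<^sup>2"
  proof (intro mult_mono)
    show "(\<Sum>p\<in>P. (g p)\<^sup>2) \<le> 1 / 4"
      using G by (simp add: P_def g_def case_prod_unfold)
    have "(\<Sum>p\<in>P. (kre (b (fst p) * kcnj (b (snd p))))\<^sup>2)
        \<le> (\<Sum>p\<in>{..<k} \<times> {..<k}. (norm (b (fst p)))\<^sup>2 * (norm (b (snd p)))\<^sup>2)"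
    proof (rule sum_mono2[THEN order_trans[rotated]])
      show "P \<subseteq> {..<k} \<times> {..<k}" by (auto simp: P_def)
      show "(\<Sum>p\<in>P. (kre (b (fst p) * kcnj (b (snd p))))\<^sup>2)
          \<le> (\<Sum>p\<in>P. (norm (b (fst p)))\<^sup>2 * (norm (b (snd p)))\<^sup>2)"
      proof (rule sum_mono)
        fix p
        have "\<bar>kre (b (fst p) * kcnj (b (snd p)))\<bar> \<le> norm (b (fst p)) * norm (b (snd p))"
          using abs_kre_le[of "b (fst p) * kcnj (b (snd p))"] by (simp add: norm_mult)
        then show "(kre (b (fst p) * kcnj (b (snd p))))\<^sup>2 \<le> (norm (b (fst p)))\<^sup>2 * (norm (b (snd p)))\<^sup>2"
          unfolding power_mult_distrib[symmetric] by (metis abs_ge_zero power2_abs power_mono)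
      qed
    qed auto
    also have "\<dots> = (sqn k b)\<^sup>2"
      unfolding sqn_def power2_eq_square[of "sum _ _"] sum_product
      by (simp add: sum.cartesian_product case_prod_unfold)
    finally show "(\<Sum>p\<in>P. (kre (b (fst p) * kcnj (b (snd p))))\<^sup>2) \<le> (sqn k b)\<^sup>2" .
  qed (auto intro: sum_nonneg)
  also have "\<dots> = (sqn k b / 2)\<^sup>2" by (simp add: power_divide)
  finally have "\<bar>\<Sum>p\<in>P. g p * kre (b (fst p) * kcnj (b (snd p)))\<bar> \<le> sqn k b / 2"
    using abs_le_square_iff[of "\<Sum>p\<in>P. g p * kre (b (fst p) * kcnj (b (snd p)))" "sqn k b / 2"] by simp
  then show ?thesis unfolding eq by linarith
qed

text \<open>
  Signs for which the vectors \<open>u\<^sub>j = d\<^sup>-\<^sup>1\<^sup>/\<^sup>2 \<Sum>\<^sub>l e\<^sub>j\<^sub>l f\<^sub>l\<close> are nearly orthonormal whenever the \<open>f\<^sub>l\<close> are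
  orthonormal, and for which the combinations \<open>\<Sum>\<^sub>j b\<^sub>j u\<^sub>j\<close> with \<open>b\<close> in the net have moments of order
  \<open>2 r\<close> bounded by \<open>B\<close>. Here \<open>w s l\<close> is the value of \<open>f\<^sub>l\<close> at \<open>s\<close>.
\<close>

definition controlled_signs ::
  "(nat \<Rightarrow> 'k::real_or_complex) set \<Rightarrow> nat \<Rightarrow> nat \<Rightarrow> nat \<Rightarrow> real \<Rightarrow> 's set \<Rightarrow> ('s \<Rightarrow> real) \<Rightarrow>
   ('s \<Rightarrow> nat \<Rightarrow> 'k) \<Rightarrow> (nat \<times> nat \<Rightarrow> real) \<Rightarrow> bool" where
  "controlled_signs Net k d r B S \<nu> w e \<longleftrightarrow> e \<in> signs ({..<k} \<times> {..<d}) \<and>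
     (\<forall>b::nat \<Rightarrow> 'k. sqn k b / 2 \<le> (\<Sum>l<d. (norm (\<Sum>j<k. e (j, l) *\<^sub>R b j))\<^sup>2) / d) \<and>
     (\<forall>b\<in>Net. (\<Sum>s\<in>S. \<nu> s * norm (\<Sum>(j, l)\<in>{..<k} \<times> {..<d}.
        e (j, l) *\<^sub>R (b j * w s l / of_real (sqrt d))) ^ (2 * r)) \<le> B)"

text \<open>
  For each \<open>b\<close> the moment is a random variable with bounded mean and variance of order \<open>1 / d\<close>.
  The sum of all the variances over the net and of the mean square of the off-diagonal Gram
  entries is therefore less than \<open>1\<close> for large \<open>d\<close>, and a sign pattern at which the underlying
  nonnegative random variable is less than \<open>1\<close> has all the properties at once.
\<close>

lemma good_signs:
  fixes Net :: "(nat \<Rightarrow> 'k::real_or_complex) set"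
  assumes Net: "finite Net" "\<And>b. b \<in> Net \<Longrightarrow> sqn k b \<le> 4" and "0 \<le> \<kappa>" "0 \<le> \<tau>" "1 \<le> r"
  shows "\<exists>d0. \<forall>d\<ge>d0. \<forall>(S::'s set) \<nu> (w :: 's \<Rightarrow> nat \<Rightarrow> 'k).
    (\<forall>s\<in>S. 0 \<le> \<nu> s) \<longrightarrow> (\<Sum>s\<in>S. \<nu> s) \<le> \<kappa> \<longrightarrow> (\<forall>s\<in>S. sqn d (w s) \<le> 2 * real d) \<longrightarrow>
    (\<forall>a. (\<Sum>s\<in>S. \<nu> s * (norm (\<Sum>l<d. a l * w s l))\<^sup>2) \<le> \<tau> * sqn d a) \<longrightarrow>
    (\<exists>e. controlled_signs Net k d r (\<kappa> * ((4 * real r + 1) * 8) ^ r + 1) S \<nu> w e)"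
proof -
  define V where "V = 8 * (real r)\<^sup>2 * (4 * \<tau>) * (\<kappa> * ((4 * real (2 * r - 1) + 1) * 8) ^ (2 * r - 1))"
  have V0: "0 \<le> V" using assms by (simp add: V_def)
  define d0 where "d0 = Suc (nat \<lceil>real (card Net) * V + 4 * (real k)\<^sup>2\<rceil>)"
  show ?thesis
  proof (intro exI[of _ d0] allI impI)
    fix d and S :: "'s set" and \<nu> and w :: "'s \<Rightarrow> nat \<Rightarrow> 'k"
    assume d: "d0 \<le> d" and \<nu>: "\<forall>s\<in>S. 0 \<le> \<nu> s" "(\<Sum>s\<in>S. \<nu> s) \<le> \<kappa>"
      and w: "\<forall>s\<in>S. sqn d (w s) \<le> 2 * real d"
      and \<tau>: "\<forall>a. (\<Sum>s\<in>S. \<nu> s * (norm (\<Sum>l<d. a l * w s l))\<^sup>2) \<le> \<tau> * sqn d a"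
    have dbig: "real (card Net) * V + 4 * (real k)\<^sup>2 < real d" and d0: "0 < d"
      using d unfolding d0_def by linarith+
    define I where "I = {..<k} \<times> {..<d}"
    have I: "finite I" by (simp add: I_def)
    define c where "c = (\<lambda>(b::nat \<Rightarrow> 'k) s (j, l). b j * w s l / of_real (sqrt d))"
    have c2: "(norm (c b s (j, l)))\<^sup>2 = (norm (b j))\<^sup>2 * (norm (w s l))\<^sup>2 / d" for b s j l
      by (simp add: c_def norm_mult norm_divide power_divide power_mult_distrib)
    have cS: "(\<Sum>i\<in>I. (norm (c b s i))\<^sup>2) \<le> 8" if "b \<in> Net" "s \<in> S" for b s
    proof -
      have "(\<Sum>i\<in>I. (norm (c b s i))\<^sup>2) = sqn k b * sqn d (w s) / d"
        unfolding I_def sqn_def sum_product sum.cartesian_product sum_divide_distrib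
        by (intro sum.cong refl) (auto simp: c2)
      also have "\<dots> \<le> 4 * (2 * real d) / d"
        using Net(2)[OF that(1)] w that(2) by (intro divide_right_mono mult_mono) auto
      finally show ?thesis using d0 by simp
    qed
    \<comment> \<open>The hypothesis bounds the map \<open>a \<mapsto> \<Sum>\<^sub>l a\<^sub>l w\<^sub>l\<close> into the weighted \<open>L\<^sub>2\<close> space; this is the bound
      for its transpose.\<close>
    have dual: "(\<Sum>l<d. (norm (\<Sum>s\<in>S. of_real (\<nu> s) * \<psi> s * w s l))\<^sup>2) \<le> \<tau> * (\<Sum>s\<in>S. \<nu> s * (norm (\<psi> s))\<^sup>2)" for \<psi>
    proof (rule square_sum_le_by_duality)
      fix a
      have "(\<Sum>l<d. a l * (\<Sum>s\<in>S. of_real (\<nu> s) * \<psi> s * w s l))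
          = (\<Sum>s\<in>S. (of_real (sqrt (\<nu> s)) * \<psi> s) * (of_real (sqrt (\<nu> s)) * (\<Sum>l<d. a l * w s l)))"
      proof -
        have q: "of_real (\<nu> s) = of_real (sqrt (\<nu> s)) * (of_real (sqrt (\<nu> s)) :: 'k)" if "s \<in> S" for s
          using \<nu>(1) that unfolding of_real_mult[symmetric] by simp
        have "(\<Sum>l<d. a l * (\<Sum>s\<in>S. of_real (\<nu> s) * \<psi> s * w s l))
            = (\<Sum>s\<in>S. \<Sum>l<d. of_real (\<nu> s) * \<psi> s * (a l * w s l))"
          unfolding sum_distrib_left by (subst sum.swap) (simp add: mult_ac)
        also have "\<dots> = (\<Sum>s\<in>S. of_real (\<nu> s) * \<psi> s * (\<Sum>l<d. a l * w s l))"
          by (simp add: sum_distrib_left)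
        also have "\<dots> = (\<Sum>s\<in>S. (of_real (sqrt (\<nu> s)) * \<psi> s) * (of_real (sqrt (\<nu> s)) * (\<Sum>l<d. a l * w s l)))"
          by (rule sum.cong[OF refl]) (simp add: q mult_ac)
        finally show ?thesis .
      qed
      then have "(norm (\<Sum>l<d. a l * (\<Sum>s\<in>S. of_real (\<nu> s) * \<psi> s * w s l)))\<^sup>2
          \<le> (\<Sum>s\<in>S. (norm (of_real (sqrt (\<nu> s)) * \<psi> s))\<^sup>2)
            * (\<Sum>s\<in>S. (norm (of_real (sqrt (\<nu> s)) * (\<Sum>l<d. a l * w s l)))\<^sup>2)"
        by (simp only: norm_sum_mult_square_le)
      also have "\<dots> = (\<Sum>s\<in>S. \<nu> s * (norm (\<psi> s))\<^sup>2) * (\<Sum>s\<in>S. \<nu> s * (norm (\<Sum>l<d. a l * w s l))\<^sup>2)"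
        using \<nu>(1) by (intro arg_cong2[where f = "(*)"] sum.cong refl) (auto simp: norm_mult power_mult_distrib)
      also have "\<dots> \<le> (\<Sum>s\<in>S. \<nu> s * (norm (\<psi> s))\<^sup>2) * (\<tau> * sqn d a)"
        using \<tau> \<nu>(1) by (intro mult_left_mono sum_nonneg) auto
      finally show "(norm (\<Sum>l<d. a l * (\<Sum>s\<in>S. of_real (\<nu> s) * \<psi> s * w s l)))\<^sup>2
          \<le> (\<tau> * (\<Sum>s\<in>S. \<nu> s * (norm (\<psi> s))\<^sup>2)) * (\<Sum>j<d. (norm (a j))\<^sup>2)"
        by (simp add: sqn_def mult_ac)
    qed (use \<nu> \<open>0 \<le> \<tau>\<close> in \<open>auto intro!: mult_nonneg_nonneg sum_nonneg\<close>)
    have dual': "(\<Sum>i\<in>I. (norm (\<Sum>s\<in>S. of_real (\<nu> s) * \<psi> s * c b s i))\<^sup>2)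
        \<le> (4 * \<tau> / d) * (\<Sum>s\<in>S. \<nu> s * (norm (\<psi> s))\<^sup>2)" if b: "b \<in> Net" for b \<psi>
    proof -
      have 1: "(norm (\<Sum>s\<in>S. of_real (\<nu> s) * \<psi> s * c b s (j, l)))\<^sup>2
          = (norm (b j))\<^sup>2 * (norm (\<Sum>s\<in>S. of_real (\<nu> s) * \<psi> s * w s l))\<^sup>2 / d" for j l
      proof -
        have "(\<Sum>s\<in>S. of_real (\<nu> s) * \<psi> s * c b s (j, l))
            = b j / of_real (sqrt d) * (\<Sum>s\<in>S. of_real (\<nu> s) * \<psi> s * w s l)"
          unfolding sum_distrib_left by (intro sum.cong refl) (simp add: c_def)
        then show ?thesis
          by (simp add: norm_mult norm_divide power_divide power_mult_distrib)
      qed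
      have "(\<Sum>i\<in>I. (norm (\<Sum>s\<in>S. of_real (\<nu> s) * \<psi> s * c b s i))\<^sup>2)
          = sqn k b * (\<Sum>l<d. (norm (\<Sum>s\<in>S. of_real (\<nu> s) * \<psi> s * w s l))\<^sup>2) / d"
        unfolding I_def sqn_def sum_product sum.cartesian_product sum_divide_distrib
        by (intro sum.cong refl) (auto simp: 1)
      also have "\<dots> \<le> 4 * (\<tau> * (\<Sum>s\<in>S. \<nu> s * (norm (\<psi> s))\<^sup>2)) / d"
        by (intro divide_right_mono mult_mono Net(2) b dual sum_nonneg) auto
      finally show ?thesis by simp
    qed
    define F where "F = (\<lambda>(b::nat \<Rightarrow> 'k) e. \<Sum>s\<in>S. \<nu> s * norm (\<Sum>i\<in>I. e i *\<^sub>R c b s i) ^ (2 * r))"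
    have F1: "sign_avg I (F b) \<le> \<kappa> * ((4 * real r + 1) * 8) ^ r" if "b \<in> Net" for b
      unfolding F_def
      by (rule rademacher_moment_variance(1)[OF I _ _ cS[OF that] dual'[OF that]])
        (use \<nu> assms d0 in auto)
    have F2: "sign_avg I (\<lambda>e. (F b e - sign_avg I (F b))\<^sup>2) \<le> V / d" if "b \<in> Net" for b
    proof -
      have "sign_avg I (\<lambda>e. (F b e - sign_avg I (F b))\<^sup>2)
        \<le> 8 * (real r)\<^sup>2 * (4 * \<tau> / d) * (\<kappa> * ((4 * real (2 * r - 1) + 1) * 8) ^ (2 * r - 1))"
        unfolding F_def
        by (rule rademacher_moment_variance(2)[OF I _ _ cS[OF that] dual'[OF that]])
          (use \<nu> assms d0 in auto)
      then show ?thesis by (simp add: V_def)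
    qed
    define P where "P = {(j, j'). j < k \<and> j' < k \<and> j \<noteq> j'}"
    have P: "P \<subseteq> {..<k} \<times> {..<k}" by (auto simp: P_def)
    have finP: "finite P" by (rule finite_subset[OF P]) simp
    define G where "G = (\<lambda>e::nat \<times> nat \<Rightarrow> real. \<Sum>(j, j') \<in> P. ((\<Sum>l<d. e (j, l) * e (j', l)) / d)\<^sup>2)"
    have G: "sign_avg I G \<le> (real k)\<^sup>2 / d"
    proof -
      have "sign_avg I G = (\<Sum>p\<in>P. sign_avg I (\<lambda>e. 1 / (real d)\<^sup>2 * (\<Sum>l<d. e (fst p, l) * e (snd p, l))\<^sup>2))"
        unfolding G_def case_prod_unfold sign_avg_sum by (simp add: power_divide)
      also have "\<dots> = (\<Sum>p\<in>P. 1 / real d)"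
      proof (rule sum.cong[OF refl])
        fix p assume "p \<in> P"
        then show "sign_avg I (\<lambda>e. 1 / (real d)\<^sup>2 * (\<Sum>l<d. e (fst p, l) * e (snd p, l))\<^sup>2) = 1 / real d"
          unfolding sign_avg_mult I_def using d0
          by (subst sign_avg_gram) (auto simp: P_def power2_eq_square)
      qed
      also have "\<dots> = real (card P) / d" by simp
      also have "\<dots> \<le> (real k)\<^sup>2 / d"
      proof -
        have "card P \<le> k * k" using card_mono[OF _ P] by (simp add: card_cartesian_product)
        then have "real (card P) \<le> real (k * k)" by (rule of_nat_mono)
        then show ?thesis by (intro divide_right_mono) (auto simp: power2_eq_square)
      qed
      finally show ?thesis .
    qed
    have "sign_avg I (\<lambda>e. (\<Sum>b\<in>Net. (F b e - sign_avg I (F b))\<^sup>2) + 4 * G e)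
        \<le> (\<Sum>b\<in>Net. V / d) + 4 * ((real k)\<^sup>2 / d)"
      unfolding sign_avg_add sign_avg_sum sign_avg_mult
      by (intro add_mono sum_mono F2 mult_left_mono G) auto
    also have "\<dots> = (real (card Net) * V + 4 * (real k)\<^sup>2) / d"
      by (simp add: add_divide_distrib)
    also have "\<dots> < 1" using dbig d0 by simp
    finally have total: "sign_avg I (\<lambda>e. (\<Sum>b\<in>Net. (F b e - sign_avg I (F b))\<^sup>2) + 4 * G e) < 1" .
    obtain e where e: "e \<in> signs I" "(\<Sum>b\<in>Net. (F b e - sign_avg I (F b))\<^sup>2) + 4 * G e < 1"
      by (rule sign_avg_less_exists[OF I total])
    have G0: "0 \<le> G e" by (auto simp: G_def intro!: sum_nonneg)
    have N0: "0 \<le> (\<Sum>b\<in>Net. (F b e - sign_avg I (F b))\<^sup>2)" by (intro sum_nonneg) auto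
    have Ge: "G e \<le> 1 / 4" using e(2) N0 by linarith
    have Fe: "F b e \<le> \<kappa> * ((4 * real r + 1) * 8) ^ r + 1" if b: "b \<in> Net" for b
    proof -
      have "(F b e - sign_avg I (F b))\<^sup>2 \<le> (\<Sum>b\<in>Net. (F b e - sign_avg I (F b))\<^sup>2)"
        by (rule member_le_sum[OF b _ Net(1)]) auto
      then have "(F b e - sign_avg I (F b))\<^sup>2 \<le> 1\<^sup>2" using e(2) G0 by simp
      then have "F b e - sign_avg I (F b) \<le> 1" by (rule power2_le_imp_le) simp
      then show ?thesis using F1[OF b] by linarith
    qed
    show "\<exists>e. controlled_signs Net k d r (\<kappa> * ((4 * real r + 1) * 8) ^ r + 1) S \<nu> w e"
      unfolding controlled_signs_def
    proof (intro exI[of _ e] conjI allI ballI)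
      show "e \<in> signs ({..<k} \<times> {..<d})" using e(1) by (simp add: I_def)
      show "sqn k b / 2 \<le> (\<Sum>l<d. (norm (\<Sum>j<k. e (j, l) *\<^sub>R b j))\<^sup>2) / d" for b :: "nat \<Rightarrow> 'k"
        using e(1) Ge d0 unfolding I_def G_def P_def by (intro gram_lower_bound)
      show "(\<Sum>s\<in>S. \<nu> s * norm (\<Sum>(j, l)\<in>{..<k} \<times> {..<d}. e (j, l) *\<^sub>R (b j * w s l / of_real (sqrt d))) ^ (2 * r))
          \<le> \<kappa> * ((4 * real r + 1) * 8) ^ r + 1" if "b \<in> Net" for b
        using Fe[OF that] unfolding F_def I_def c_def by (simp add: case_prod_unfold)
    qed
  qed
qed

section \<open>The Hahn--Banach theorem\<close>

text \<open>
  An inequality is enough for homogeneity: for \<open>r > 0\<close> the one for \<open>1 / r\<close> gives the converse.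
\<close>

definition sublinear :: "(real \<Rightarrow> 'v \<Rightarrow> 'v::ab_group_add) \<Rightarrow> ('v \<Rightarrow> real) \<Rightarrow> bool" where
  "sublinear s q \<longleftrightarrow> (\<forall>x y. q (x + y) \<le> q x + q y) \<and> (\<forall>r x. 0 \<le> r \<longrightarrow> q (s r x) \<le> r * q x)"

text \<open>
  The three infima used below (over a chain, over a half-line and over a subspace) all have this
  form.
\<close>

lemma sublinear_INF:
  assumes "I \<noteq> {}"
    and bdd: "\<And>x. bdd_below ((\<lambda>t. h t x) ` I)"
    and add: "\<And>t t' x y. t \<in> I \<Longrightarrow> t' \<in> I \<Longrightarrow> \<exists>t''\<in>I. h t'' (x + y) \<le> h t x + h t' y"
    and hom: "\<And>t r x. t \<in> I \<Longrightarrow> 0 \<le> r \<Longrightarrow> \<exists>t'\<in>I. h t' (s r x) \<le> r * h t x"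
  shows "sublinear s (\<lambda>x. INF t\<in>I. h t x)"
  unfolding sublinear_def
proof (intro conjI allI impI)
  fix x y
  have 1: "(INF t\<in>I. h t (x + y)) \<le> h t x + h t' y" if tt: "t \<in> I" "t' \<in> I" for t t'
  proof -
    obtain t'' where "t'' \<in> I" "h t'' (x + y) \<le> h t x + h t' y" using add[OF tt] by blast
    then show ?thesis using cINF_lower[OF bdd, of t''] by (meson order_trans)
  qed
  have 2: "(INF t\<in>I. h t (x + y)) - h t x \<le> (INF t\<in>I. h t y)" if t: "t \<in> I" for t
  proof (rule cINF_greatest[OF \<open>I \<noteq> {}\<close>])
    fix t' assume "t' \<in> I"
    from 1[OF t this] show "(INF t\<in>I. h t (x + y)) - h t x \<le> h t' y" by simp
  qed
  have "(INF t\<in>I. h t (x + y)) - (INF t\<in>I. h t y) \<le> (INF t\<in>I. h t x)"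
  proof (rule cINF_greatest[OF \<open>I \<noteq> {}\<close>])
    fix t assume "t \<in> I"
    from 2[OF this] show "(INF t\<in>I. h t (x + y)) - (INF t\<in>I. h t y) \<le> h t x" by simp
  qed
  then show "(INF t\<in>I. h t (x + y)) \<le> (INF t\<in>I. h t x) + (INF t\<in>I. h t y)" by simp
next
  fix r :: real and x assume r: "0 \<le> r"
  have le: "(INF t\<in>I. h t (s r x)) \<le> r * h t x" if t: "t \<in> I" for t
  proof -
    obtain t' where "t' \<in> I" "h t' (s r x) \<le> r * h t x" using hom[OF t r] by blast
    then show ?thesis using cINF_lower[OF bdd, of t'] by (meson order_trans)
  qed
  show "(INF t\<in>I. h t (s r x)) \<le> r * (INF t\<in>I. h t x)"
  proof (cases "r = 0")
    case True
    then show ?thesis using le \<open>I \<noteq> {}\<close> by auto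
  next
    case False
    then have "0 < r" using r by simp
    then have "(INF t\<in>I. h t (s r x)) / r \<le> (INF t\<in>I. h t x)"
      using le \<open>I \<noteq> {}\<close> by (intro cINF_greatest) (auto simp: pos_divide_le_eq mult.commute)
    then show ?thesis using \<open>0 < r\<close> by (simp add: pos_divide_le_eq mult.commute)
  qed
qed

context
  fixes s :: "real \<Rightarrow> 'v \<Rightarrow> 'v::ab_group_add"
  assumes vs: "vector_space s"
begin

lemma sublinear_zero: "sublinear s q \<Longrightarrow> q 0 = 0"
proof -
  assume q: "sublinear s q"
  interpret vector_space s by (rule vs)
  have "q (0 + 0) \<le> q 0 + q 0" "q (s 0 0) \<le> 0 * q 0"
    using q unfolding sublinear_def by blast+
  then show "q 0 = 0" by simp
qed

lemma sublinear_minus: "sublinear s q \<Longrightarrow> - q (- x) \<le> q x"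
proof -
  assume q: "sublinear s q"
  then have "q (x + - x) \<le> q x + q (- x)" unfolding sublinear_def by blast
  then show ?thesis using sublinear_zero[OF q] by simp
qed

lemma minimal_sublinear:
  assumes p: "sublinear s p"
  shows "\<exists>q. sublinear s q \<and> (\<forall>x. q x \<le> p x) \<and>
    (\<forall>q'. sublinear s q' \<longrightarrow> (\<forall>x. q' x \<le> q x) \<longrightarrow> q' = q)"
proof -
  define A where "A = {q. sublinear s q \<and> (\<forall>x. q x \<le> p x)}"
  define P where "P = (\<lambda>a b :: 'v \<Rightarrow> real. \<forall>x. b x \<le> a x)"
  have "\<exists>m\<in>A. \<forall>a\<in>A. P m a \<longrightarrow> a = m"
  proof (rule predicate_Zorn)
    show "partial_order_on A (relation_of P A)"
      by (rule partial_order_on_relation_ofI) (auto simp: P_def fun_eq_iff intro: order_trans antisym)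
    fix C assume C: "C \<in> Chains (relation_of P A)"
    have CA: "C \<subseteq> A" and tot: "\<And>a b. a \<in> C \<Longrightarrow> b \<in> C \<Longrightarrow> P a b \<or> P b a"
      using C by (auto simp: Chains_def relation_of_def)
    show "\<exists>u\<in>A. \<forall>a\<in>C. P a u"
    proof (cases "C = {}")
      case True
      then show ?thesis using p by (auto simp: A_def)
    next
      case False
      have low: "- p (- x) \<le> q x" if "q \<in> C" for q x
      proof -
        have "- q (- x) \<le> q x" "q (- x) \<le> p (- x)"
          using that CA sublinear_minus by (auto simp: A_def)
        then show ?thesis by linarith
      qed
      have bdd: "bdd_below ((\<lambda>q. q x) ` C)" for x
        using low by (auto intro!: bdd_belowI2[where m = "- p (- x)"])
      define u where "u = (\<lambda>x. INF q\<in>C. q x)"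
      have sub: "sublinear s q" if "q \<in> C" for q using that CA by (auto simp: A_def)
      have "sublinear s u"
        unfolding u_def
      proof (rule sublinear_INF[OF False bdd])
        fix q q' x y assume q: "q \<in> C" "q' \<in> C"
        have *: "a (x + y) \<le> a x + a y" if "a \<in> C" for a
          using sub[OF that] by (simp add: sublinear_def)
        from tot[OF q] show "\<exists>t\<in>C. t (x + y) \<le> q x + q' y"
        proof
          assume "P q q'"
          then show ?thesis
            using *[OF q(2)] q(2) by (intro bexI[of _ q']) (auto simp: P_def intro: order_trans)
        next
          assume "P q' q"
          then show ?thesis
            using *[OF q(1)] q(1) by (intro bexI[of _ q]) (auto simp: P_def intro: order_trans)
        qed
      next
        fix q x and r :: real assume "q \<in> C" "0 \<le> r"
        then show "\<exists>t'\<in>C. t' (s r x) \<le> r * q x"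
          using sub[of q] unfolding sublinear_def by blast
      qed
      moreover have le: "u x \<le> q x" if "q \<in> C" for q x
        unfolding u_def using bdd that by (rule cINF_lower)
      moreover have "u x \<le> p x" for x
      proof -
        obtain q where "q \<in> C" using False by blast
        then show ?thesis using le[of q x] CA by (auto simp: A_def intro: order_trans)
      qed
      ultimately show ?thesis by (intro bexI[of _ u]) (auto simp: A_def P_def)
    qed
  qed
  then obtain m where m: "m \<in> A" "\<And>a. a \<in> A \<Longrightarrow> P m a \<Longrightarrow> a = m" by blast
  show ?thesis
  proof (intro exI[of _ m] conjI allI impI)
    fix q' assume "sublinear s q'" "\<forall>x. q' x \<le> m x"
    then show "q' = m" using m(1) by (intro m(2)) (auto simp: A_def P_def intro: order_trans)
  qed (use m(1) in \<open>auto simp: A_def\<close>)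
qed

text \<open>
  Replacing \<open>q x\<close> by the infimum of \<open>q (x + t a) - t q a\<close> over \<open>t \<ge> 0\<close> gives a smaller sublinear
  functional. By minimality nothing changes, and \<open>t = 1\<close> yields superadditivity.
\<close>

lemma minimal_sublinear_additive:
  assumes q: "sublinear s q" and min: "\<And>q'. sublinear s q' \<Longrightarrow> (\<And>x. q' x \<le> q x) \<Longrightarrow> q' = q"
  shows "q (x + a) = q x + q a"
proof -
  interpret vector_space s by (rule vs)
  have qa: "q (x + y) \<le> q x + q y" for x y using q by (simp add: sublinear_def)
  have qh: "0 \<le> r \<Longrightarrow> q (s r x) \<le> r * q x" for r x using q by (simp add: sublinear_def)
  define h where "h = (\<lambda>t x. q (x + s t a) - t * q a)"
  have bdd: "bdd_below ((\<lambda>t. h t x) ` {0..})" for x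
  proof (rule bdd_belowI2[where m = "- q (- x)"])
    fix t :: real assume "t \<in> {0..}"
    have "q (s t a) \<le> q (x + s t a) + q (- x)" using qa[of "x + s t a" "- x"] by simp
    moreover have "t * q a \<le> q (s t a)"
    proof (cases "t = 0")
      case True
      then show ?thesis using sublinear_zero[OF q] by simp
    next
      case False
      then have t: "0 < t" using \<open>t \<in> {0..}\<close> by simp
      have "q (s (1 / t) (s t a)) \<le> 1 / t * q (s t a)" using t by (intro qh) simp
      then show ?thesis using t by (simp add: field_simps)
    qed
    ultimately show "- q (- x) \<le> h t x" by (simp add: h_def)
  qed
  have "sublinear s (\<lambda>x. INF t\<in>{0..}. h t x)"
  proof (rule sublinear_INF[OF _ bdd])
    fix t t' :: real and x y assume t: "t \<in> {0..}" "t' \<in> {0..}"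
    have "q (x + y + s (t + t') a) \<le> q (x + s t a) + q (y + s t' a)"
      using qa[of "x + s t a" "y + s t' a"] by (simp add: scale_left_distrib algebra_simps)
    then show "\<exists>t''\<in>{0..}. h t'' (x + y) \<le> h t x + h t' y"
      using t by (intro bexI[of _ "t + t'"]) (auto simp: h_def algebra_simps)
  next
    fix t r :: real and x assume t: "t \<in> {0..}" and r: "0 \<le> r"
    have "q (s r x + s (r * t) a) \<le> r * q (x + s t a)"
      using qh[OF r, of "x + s t a"] by (simp add: scale_right_distrib)
    then show "\<exists>t'\<in>{0..}. h t' (s r x) \<le> r * h t x"
      using t r by (intro bexI[of _ "r * t"]) (auto simp: h_def algebra_simps)
  qed simp
  moreover have "(INF t\<in>{0..}. h t x) \<le> q x" for x
    using cINF_lower[OF bdd, of 0 x] by (simp add: h_def)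
  ultimately have "(\<lambda>x. INF t\<in>{0..}. h t x) = q" by (rule min)
  then have "q x \<le> h 1 x"
    using cINF_lower[OF bdd, of 1 x] by (simp add: fun_eq_iff)
  then show ?thesis using qa[of x a] by (simp add: h_def)
qed

text \<open>
  The functional \<open>f\<close> is built into the sublinear functional: anything linear below the infimum of
  \<open>p (x - m) + f m\<close> over \<open>m \<in> M\<close> lies below \<open>p\<close> everywhere and below \<open>f\<close> on \<open>M\<close>, hence agrees with
  \<open>f\<close> on \<open>M\<close>. A minimal sublinear functional below it is linear.
\<close>

lemma hahn_banach_real:
  assumes p: "sublinear s p"
    and M: "0 \<in> M" "\<And>x y. x \<in> M \<Longrightarrow> y \<in> M \<Longrightarrow> x + y \<in> M" "\<And>r x. x \<in> M \<Longrightarrow> s r x \<in> M"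
    and f: "\<And>x y. x \<in> M \<Longrightarrow> y \<in> M \<Longrightarrow> f (x + y) = f x + f y" "\<And>r x. x \<in> M \<Longrightarrow> f (s r x) = r * f x"
      "\<And>x. x \<in> M \<Longrightarrow> f x \<le> p x"
  shows "\<exists>u. (\<forall>x y. u (x + y) = u x + u y) \<and> (\<forall>r x. u (s r x) = r * u x) \<and>
           (\<forall>x. u x \<le> p x) \<and> (\<forall>x\<in>M. u x = f x)"
proof -
  interpret vector_space s by (rule vs)
  have pa: "p (x + y) \<le> p x + p y" for x y using p by (simp add: sublinear_def)
  have ph: "0 \<le> r \<Longrightarrow> p (s r x) \<le> r * p x" for r x using p by (simp add: sublinear_def)
  have f0: "f 0 = 0" using f(2)[OF M(1), of 0] by simp
  have neg: "- x \<in> M \<and> f (- x) = - f x" if "x \<in> M" for x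
    using M(3)[OF that, of "- 1"] f(2)[OF that, of "- 1"] by simp
  define h where "h = (\<lambda>m x. p (x - m) + f m)"
  have bdd: "bdd_below ((\<lambda>m. h m x) ` M)" for x
  proof (rule bdd_belowI2[where m = "- p (- x)"])
    fix m assume m: "m \<in> M"
    have "f (- m) \<le> p (- m)" using neg[OF m] by (intro f(3)) simp
    also have "\<dots> \<le> p (x - m) + p (- x)" using pa[of "x - m" "- x"] by simp
    finally show "- p (- x) \<le> h m x" using neg[OF m] by (simp add: h_def)
  qed
  have "sublinear s (\<lambda>x. INF m\<in>M. h m x)"
  proof (rule sublinear_INF[OF _ bdd])
    show "M \<noteq> {}" using M(1) by blast
  next
    fix m m' x y assume m: "m \<in> M" "m' \<in> M"
    have "p (x + y - (m + m')) \<le> p (x - m) + p (y - m')"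
      using pa[of "x - m" "y - m'"] by (simp add: algebra_simps)
    then show "\<exists>t''\<in>M. h t'' (x + y) \<le> h m x + h m' y"
      using m M f(1) by (intro bexI[of _ "m + m'"]) (auto simp: h_def)
  next
    fix m x and r :: real assume m: "m \<in> M" and r: "0 \<le> r"
    have "p (s r x - s r m) \<le> r * p (x - m)"
      using ph[OF r, of "x - m"] by (simp add: scale_right_diff_distrib)
    then show "\<exists>t'\<in>M. h t' (s r x) \<le> r * h m x"
      using m M f(2) by (intro bexI[of _ "s r m"]) (auto simp: h_def algebra_simps)
  qed
  from minimal_sublinear[OF this] obtain u where u: "sublinear s u" "\<And>x. u x \<le> (INF m\<in>M. h m x)"
    "\<And>q'. sublinear s q' \<Longrightarrow> (\<And>x. q' x \<le> u x) \<Longrightarrow> q' = u" by blast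
  have ua: "u (x + y) = u x + u y" for x y
    by (rule minimal_sublinear_additive[OF u(1,3)])
  have u0: "u 0 = 0" by (rule sublinear_zero[OF u(1)])
  have um: "u (- x) = - u x" for x using ua[of x "- x"] u0 by simp
  have uh: "u (s r x) = r * u x" if "0 \<le> r" for r x
  proof (cases "r = 0")
    case True
    then show ?thesis using u0 by simp
  next
    case False
    have "u (s r x) \<le> r * u x" "u (s r (- x)) \<le> r * u (- x)"
      using u(1) that unfolding sublinear_def by blast+
    then show ?thesis by (simp add: um)
  qed
  have uh': "u (s r x) = r * u x" for r x
  proof (cases "0 \<le> r")
    case False
    then have "u (s (- r) x) = (- r) * u x" by (intro uh) simp
    then show ?thesis by (simp add: um)
  qed (rule uh)
  have uh_le: "u x \<le> h m x" if "m \<in> M" for m x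
    using u(2)[of x] cINF_lower[OF bdd that, of x] by linarith
  have up: "u x \<le> p x" for x using uh_le[OF M(1), of x] by (simp add: h_def f0)
  have ule: "u x \<le> f x" if "x \<in> M" for x
    using uh_le[OF that, of x] sublinear_zero[OF p] by (simp add: h_def)
  have "u x = f x" if "x \<in> M" for x
    using ule[OF that] ule[of "- x"] neg[OF that] um[of x] by simp
  then show ?thesis using ua uh' up by blast
qed

end

lemma linear_with_real_part:
  fixes scale :: "'k::real_or_complex \<Rightarrow> 'v::ab_group_add \<Rightarrow> 'v"
  assumes "vector_space scale"
    and u: "\<And>x y. u (x + y) = u x + u y" "\<And>r x. u (scale (of_real r) x) = r * u x"
  shows "\<exists>g. (\<forall>x y. g (x + y) = g x + g y) \<and> (\<forall>c x. g (scale c x) = c * g x) \<and> (\<forall>x. kre (g x) = u x)"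
proof -
  interpret vector_space scale by (rule assms(1))
  show ?thesis
  proof (cases rule: scalar_cases[where ?'k = 'k])
    case real
    have "of_real (u (scale c x)) = c * of_real (u x)" for c :: 'k and x
    proof -
      obtain r where "c = of_real r" by (rule that[OF real(1)])
      then show ?thesis using u(2) by simp
    qed
    then show ?thesis by (intro exI[of _ "\<lambda>x. of_real (u x)"]) (simp add: u(1))
  next
    case (complex i im)
    define g where "g = (\<lambda>x. of_real (u x) + of_real (- u (scale i x)) * i)"
    have ga: "g (x + y) = g x + g y" for x y
      by (simp add: g_def u(1) scale_right_distrib algebra_simps)
    have gr: "g (scale (of_real r) x) = of_real r * g x" for r x
      using u(2)[of r "scale i x"] by (simp add: g_def u(2) algebra_simps)
    have um: "u (- x) = - u x" for x using u(2)[of "- 1" x] by simp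
    have ii: "i * (i * z) = - z" for z
      unfolding mult.assoc[symmetric] complex(1) by simp
    have gi: "g (scale i x) = i * g x" for x
      by (simp add: g_def complex(1) um algebra_simps ii)
    have "g (scale c x) = c * g x" for c x
    proof -
      obtain a b where c: "c = of_real a + of_real b * i" by (rule that[OF complex(2)])
      have e: "scale c x = scale (of_real a) x + scale (of_real b) (scale i x)"
        by (simp add: c scale_left_distrib)
      show ?thesis unfolding e ga gr gi by (simp add: c algebra_simps)
    qed
    moreover have "kre (g x) = u x" for x unfolding g_def by (rule complex(3))
    ultimately show ?thesis using ga by blast
  qed
qed

text \<open>
  The extension of the real part of \<open>f\<close> is the real part of a unique linear functional. That
  functional has the right bound because every value becomes its own real part after
  multiplication with a scalar of modulus one.
\<close>

theorem hahn_banach: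
  fixes scale :: "'k::real_or_complex \<Rightarrow> 'v::ab_group_add \<Rightarrow> 'v"
  assumes vs: "vector_space scale"
    and p: "\<And>x y. p (x + y) \<le> p x + p y" "\<And>c x. p (scale c x) = norm c * p x"
    and M: "0 \<in> M" "\<And>x y. x \<in> M \<Longrightarrow> y \<in> M \<Longrightarrow> x + y \<in> M" "\<And>c x. x \<in> M \<Longrightarrow> scale c x \<in> M"
    and f: "\<And>x y. x \<in> M \<Longrightarrow> y \<in> M \<Longrightarrow> f (x + y) = f x + f y" "\<And>c x. x \<in> M \<Longrightarrow> f (scale c x) = c * f x"
      "\<And>x. x \<in> M \<Longrightarrow> norm (f x) \<le> p x"
  shows "\<exists>g. (\<forall>x y. g (x + y) = g x + g y) \<and> (\<forall>c x. g (scale c x) = c * g x) \<and>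
           (\<forall>x. norm (g x) \<le> p x) \<and> (\<forall>x\<in>M. g x = f x)"
proof -
  interpret vector_space scale by (rule vs)
  let ?s = "\<lambda>r. scale (of_real r)"
  have vsr: "vector_space ?s"
    by unfold_locales (simp_all add: scale_left_distrib scale_right_distrib)
  have "\<exists>u. (\<forall>x y. u (x + y) = u x + u y) \<and> (\<forall>r x. u (?s r x) = r * u x) \<and>
           (\<forall>x. u x \<le> p x) \<and> (\<forall>x\<in>M. u x = kre (f x))"
  proof (rule hahn_banach_real[OF vsr])
    show "sublinear ?s p" using p by (auto simp: sublinear_def)
    show "kre (f (?s r x)) = r * kre (f x)" if "x \<in> M" for r x
      using f(2)[OF that] by (simp add: kre_scale)
    show "kre (f x) \<le> p x" if "x \<in> M" for x
      using f(3)[OF that] kre_le[of "f x"] by linarith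
  qed (use M f in \<open>auto simp: kre_add\<close>)
  then obtain u where u: "\<And>x y. u (x + y) = u x + u y" "\<And>r x. u (?s r x) = r * u x"
    "\<And>x. u x \<le> p x" "\<And>x. x \<in> M \<Longrightarrow> u x = kre (f x)" by blast
  obtain g where g: "\<And>x y. g (x + y) = g x + g y" "\<And>c x. g (scale c x) = c * g x" "\<And>x. kre (g x) = u x"
    using linear_with_real_part[OF vs u(1,2)] by blast
  have "norm (g x) \<le> p x" for x
  proof (cases "g x = 0")
    case True
    have "p (x + - x) \<le> p x + p (- x)" by (rule p(1))
    moreover have "p 0 = 0" using p(2)[of 0 x] by simp
    moreover have "p (- x) = p x" using p(2)[of "- 1" x] by simp
    ultimately show ?thesis using True by simp
  next
    case False
    define c where "c = kcnj (g x) / of_real (norm (g x))"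
    have nc: "norm c = 1" using False by (simp add: c_def norm_divide)
    have "g (scale c x) = of_real (norm (g x))"
      using False mult_kcnj[of "g x"] by (simp add: g(2) c_def mult.commute power2_eq_square)
    then have "norm (g x) = u (scale c x)" using g(3)[of "scale c x"] by simp
    also have "\<dots> \<le> p x" using u(3)[of "scale c x"] p(2)[of c x] nc by simp
    finally show ?thesis .
  qed
  moreover have "g x = f x" if x: "x \<in> M" for x
  proof -
    define d where "d = g x - f x"
    have "kre (kcnj d * d) = kre (g (scale (kcnj d) x)) - kre (f (scale (kcnj d) x))"
      unfolding g(2) f(2)[OF x] kre_diff[symmetric] by (simp add: d_def algebra_simps)
    also have "\<dots> = 0" using u(4)[OF M(3)[OF x]] g(3) by simp
    finally have "(norm d)\<^sup>2 = 0" by (simp add: mult.commute[of "kcnj d"] kre_mult_kcnj)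
    then show ?thesis by (simp add: d_def)
  qed
  ultimately show ?thesis using g(1,2) by blast
qed

section \<open>Copies of \<open>\<ell>\<^sub>p\<^sup>n\<close> inside an \<open>\<L>\<^sub>p\<close>-space\<close>

lemma holder_sum:
  fixes x y :: "'i \<Rightarrow> real"
  assumes pq: "1 < p" "1 < q" "1 / p + 1 / q = 1"
    and nn: "\<And>i. i \<in> I \<Longrightarrow> 0 \<le> x i" "\<And>i. i \<in> I \<Longrightarrow> 0 \<le> y i"
  shows "(\<Sum>i\<in>I. x i * y i) \<le> (\<Sum>i\<in>I. x i powr p) powr (1 / p) * (\<Sum>i\<in>I. y i powr q) powr (1 / q)"
proof (cases "finite I")
  case fin: True
  define A B where "A = (\<Sum>i\<in>I. x i powr p)" and "B = (\<Sum>i\<in>I. y i powr q)"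
  have AB0: "0 \<le> A" "0 \<le> B" by (simp_all add: A_def B_def sum_nonneg)
  show ?thesis
  proof (cases "A = 0 \<or> B = 0")
    case True
    then have "x i * y i = 0" if "i \<in> I" for i
      using that fin by (auto simp: A_def B_def sum_nonneg_eq_0_iff)
    then have "(\<Sum>i\<in>I. x i * y i) = 0" by (intro sum.neutral) blast
    then show ?thesis by simp
  next
    case False
    then have AB: "0 < A" "0 < B" using AB0 by auto
    define \<alpha> \<beta> where "\<alpha> = A powr (1 / p)" and "\<beta> = B powr (1 / q)"
    have \<alpha>\<beta>: "0 < \<alpha>" "0 < \<beta>" "\<alpha> powr p = A" "\<beta> powr q = B"
      using AB pq by (auto simp: \<alpha>_def \<beta>_def powr_powr)
    have "(\<Sum>i\<in>I. (x i / \<alpha>) * (y i / \<beta>)) \<le> (\<Sum>i\<in>I. (x i / \<alpha>) powr p / p + (y i / \<beta>) powr q / q)"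
      using nn \<alpha>\<beta> by (intro sum_mono Youngs_inequality pq) auto
    also have "\<dots> = (\<Sum>i\<in>I. x i powr p / A / p + y i powr q / B / q)"
      using nn \<alpha>\<beta> by (intro sum.cong refl) (simp add: powr_divide)
    also have "\<dots> = A / A / p + B / B / q"
      unfolding sum.distrib sum_divide_distrib[symmetric] by (simp add: A_def B_def)
    also have "\<dots> = 1" using AB pq by simp
    finally have "(\<Sum>i\<in>I. x i * y i) / (\<alpha> * \<beta>) \<le> 1"
      by (simp add: sum_divide_distrib)
    then show ?thesis using \<alpha>\<beta> by (simp add: A_def[symmetric] B_def[symmetric] \<alpha>_def[symmetric] \<beta>_def[symmetric])
  qed
qed simp

text \<open>
  This crude comparison replaces Hoelder's inequality between different exponents, as constants
  are irrelevant.
\<close>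

lemma powr_le_1_plus_power:
  assumes "0 \<le> t" "0 < p" "p \<le> 2 * real r"
  shows "t powr p \<le> 1 + t ^ (2 * r)"
proof (cases "t \<le> 1")
  case True
  have "t powr p \<le> 1" using True assms by (simp add: powr_le1)
  moreover have "0 \<le> t ^ (2 * r)" using assms by simp
  ultimately show ?thesis by linarith
next
  case False
  then have "t powr p \<le> t powr real (2 * r)" using assms by (intro powr_mono) auto
  also have "\<dots> = t ^ (2 * r)" using False by (subst powr_realpow) auto
  finally show ?thesis by simp
qed

lemma khinchine_powr:
  fixes c :: "'i \<Rightarrow> 'k::real_or_complex"
  assumes "finite I" "0 < p" "p \<le> 2 * real r"
  shows "sign_avg I (\<lambda>e. norm (\<Sum>i\<in>I. e i *\<^sub>R c i) powr p)
          \<le> (1 + (4 * real r + 1) ^ r) * (\<Sum>i\<in>I. (norm (c i))\<^sup>2) powr (p / 2)"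
proof -
  define S where "S = (\<Sum>i\<in>I. (norm (c i))\<^sup>2)"
  have S0: "0 \<le> S" by (simp add: S_def sum_nonneg)
  show ?thesis
  proof (cases "S = 0")
    case True
    then have "c i = 0" if "i \<in> I" for i
      using that assms by (simp add: S_def sum_nonneg_eq_0_iff)
    then have "sign_avg I (\<lambda>e. norm (\<Sum>i\<in>I. e i *\<^sub>R c i) powr p) = sign_avg I (\<lambda>e. 0)"
      by (intro sign_avg_cong) simp
    then show ?thesis using assms by simp
  next
    case False
    then have S: "0 < S" using S0 by simp
    define \<sigma> where "\<sigma> = sqrt S"
    have \<sigma>: "0 < \<sigma>" "\<sigma>\<^sup>2 = S" using S by (auto simp: \<sigma>_def)
    have \<sigma>p: "\<sigma> powr p = S powr (p / 2)"
      unfolding \<sigma>_def using S by (simp add: powr_half_sqrt[symmetric] powr_powr)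
    let ?A = "\<lambda>e. norm (\<Sum>i\<in>I. e i *\<^sub>R c i)"
    have "sign_avg I (\<lambda>e. ?A e powr p) \<le> sign_avg I (\<lambda>e. \<sigma> powr p * (1 + 1 / \<sigma> ^ (2 * r) * ?A e ^ (2 * r)))"
    proof (rule sign_avg_mono)
      fix e
      have "?A e powr p = \<sigma> powr p * (?A e / \<sigma>) powr p"
        using \<sigma> by (simp add: powr_divide)
      also have "\<dots> \<le> \<sigma> powr p * (1 + (?A e / \<sigma>) ^ (2 * r))"
        using \<sigma> assms by (intro mult_left_mono powr_le_1_plus_power) auto
      finally show "?A e powr p \<le> \<sigma> powr p * (1 + 1 / \<sigma> ^ (2 * r) * ?A e ^ (2 * r))"
        by (simp add: power_divide)
    qed
    also have "\<dots> = \<sigma> powr p * (1 + 1 / \<sigma> ^ (2 * r) * sign_avg I (\<lambda>e. ?A e ^ (2 * r)))"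
      by (simp only: sign_avg_mult sign_avg_add sign_avg_const[OF assms(1)])
    also have "\<dots> \<le> \<sigma> powr p * (1 + 1 / \<sigma> ^ (2 * r) * ((4 * real r + 1) * S) ^ r)"
      unfolding S_def using \<sigma>(1)
      by (intro mult_left_mono add_left_mono khinchine_upper assms order_refl) auto
    also have "\<dots> = (1 + (4 * real r + 1) ^ r) * S powr (p / 2)"
      using \<sigma>(1) S by (simp add: \<sigma>p power_mult \<sigma>(2) power_mult_distrib)
    finally show ?thesis by (simp add: S_def)
  qed
qed

definition lpn :: "real \<Rightarrow> 'i set \<Rightarrow> ('i \<Rightarrow> 'k::real_normed_vector) \<Rightarrow> real" where
  "lpn p I a = (\<Sum>i\<in>I. norm (a i) powr p) powr (1 / p)"

lemma lpn_nonneg [simp]: "0 \<le> lpn p I a"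
  by (simp add: lpn_def)

lemma lpn_eq_0:
  assumes "finite I" "0 < p" "lpn p I a = 0" "i \<in> I" shows "a i = 0"
  using assms by (auto simp: lpn_def sum_nonneg_eq_0_iff)

lemma lpn_mult:
  fixes a :: "'i \<Rightarrow> 'k::real_normed_field"
  assumes "0 < p" shows "lpn p I (\<lambda>i. c * a i) = norm c * lpn p I a"
  using assms
  by (simp add: lpn_def norm_mult powr_mult sum_distrib_left[symmetric] sum_nonneg powr_powr)

context normed_space_over
begin

definition combo :: "'i set \<Rightarrow> ('i \<Rightarrow> 'k) \<Rightarrow> ('i \<Rightarrow> 'x) \<Rightarrow> 'x" where
  "combo I a u = (\<Sum>i\<in>I. scale (a i) (u i))"

text \<open>
  A basis of a finite-dimensional subspace, indexed by \<open>I\<close>, that is \<open>K\<close>-equivalent to the unit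
  vector basis of \<open>\<ell>\<^sub>p\<close> with the normalization put on the lower estimate.
\<close>

definition lp_frame :: "real \<Rightarrow> real \<Rightarrow> 'i set \<Rightarrow> ('i \<Rightarrow> 'x) \<Rightarrow> bool" where
  "lp_frame p K I u \<longleftrightarrow> finite I \<and>
     (\<forall>a. lpn p I a \<le> norm (combo I a u) \<and> norm (combo I a u) \<le> K * lpn p I a)"

lemma combo_add: "combo I (\<lambda>i. a i + b i) u = combo I a u + combo I b u"
  by (simp add: combo_def scale_left_distrib sum.distrib)

lemma combo_mult: "combo I (\<lambda>i. c * a i) u = scale c (combo I a u)"
  by (simp add: combo_def scale_sum_right)

lemma lp_frame_coefficients_unique:
  assumes "lp_frame p K I u" "0 < p" "combo I a u = combo I b u" "i \<in> I"
  shows "a i = b i"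
proof -
  have "combo I (\<lambda>i. a i + (- 1) * b i) u = 0"
    using assms(3) unfolding combo_add combo_mult by simp
  moreover have "lpn p I (\<lambda>i. a i + (- 1) * b i) \<le> norm (combo I (\<lambda>i. a i + (- 1) * b i) u)"
    using assms(1) unfolding lp_frame_def by blast
  ultimately have "lpn p I (\<lambda>i. a i + (- 1) * b i) \<le> 0"
    by (simp only: norm_zero)
  then have "lpn p I (\<lambda>i. a i + (- 1) * b i) = 0"
    using lpn_nonneg by (rule antisym)
  note z = this
  have "finite I" using assms(1) by (simp add: lp_frame_def)
  from lpn_eq_0[OF this assms(2) z assms(4)] show ?thesis by simp
qed

lemma lp_frame_subfamily:
  assumes fr: "lp_frame p K I u" and g: "inj_on g J" "g ` J \<subseteq> I"
  shows "lp_frame p K J (u \<circ> g)"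
  unfolding lp_frame_def
proof (intro conjI allI)
  have finI: "finite I" using fr by (simp add: lp_frame_def)
  show finJ: "finite J" using finI g by (metis finite_imageD finite_subset)
  fix a :: "_ \<Rightarrow> 'k"
  define b where "b = (\<lambda>i. if i \<in> g ` J then a (inv_into J g i) else 0)"
  have bg: "b (g j) = a j" if "j \<in> J" for j using that g by (simp add: b_def)
  have "(\<Sum>i\<in>I. norm (b i) powr p) = (\<Sum>i\<in>g ` J. norm (b i) powr p)"
    using g(2) finI by (intro sum.mono_neutral_right) (auto simp: b_def)
  also have "\<dots> = (\<Sum>j\<in>J. norm (a j) powr p)"
    using g(1) bg by (simp add: sum.reindex)
  finally have 1: "lpn p I b = lpn p J a" by (simp add: lpn_def)
  have "combo I b u = (\<Sum>i\<in>g ` J. scale (b i) (u i))"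
    unfolding combo_def using g(2) finI by (intro sum.mono_neutral_right) (auto simp: b_def)
  also have "\<dots> = combo J a (u \<circ> g)"
    unfolding combo_def using g(1) bg by (simp add: sum.reindex)
  finally have 2: "combo I b u = combo J a (u \<circ> g)" .
  show "lpn p J a \<le> norm (combo J a (u \<circ> g))" "norm (combo J a (u \<circ> g)) \<le> K * lpn p J a"
    using fr unfolding lp_frame_def 1[symmetric] 2[symmetric] by blast+
qed

lemma norm_scaleR_scale: "r *\<^sub>R x = scale (of_real r) x"
  by (simp add: scale_of_real)

text \<open>
  An isomorphism \<open>S\<close> whose norm and inverse norm have product below \<open>C + 1\<close> is rescaled by its
  norm. The norms are extended reals, so a product \<open>0 \<cdot> \<infinity>\<close> must be excluded; this is why the zero
  space is treated separately.
\<close>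

lemma banach_mazur_frame:
  assumes p: "1 < p" and C: "1 \<le> C" and N: "finite_dimensional N"
    and bm: "banach_mazur_distance N scale norm (lp_carrier n) lp_scale (lp_norm p n) \<le> ereal C"
  shows "\<exists>u. lp_frame p (C + 1) {..<n} u \<and> N \<subseteq> range (\<lambda>a. combo {..<n} a u)"
proof -
  have subN: "subspace N" using N by (simp add: finite_dimensional_def)
  have lp: "lp_norm p n a = lpn p {..<n} a" for a :: "nat \<Rightarrow> 'k"
    by (simp add: lp_norm_def lpn_def)
  have "banach_mazur_distance N scale norm (lp_carrier n) lp_scale (lp_norm p n) < ereal (C + 1)"
    by (rule le_less_trans[OF bm]) simp
  then obtain S where S: "linear_isomorphism_on N scale (lp_carrier n :: (nat \<Rightarrow> 'k) set) lp_scale S"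
    and prod: "operator_norm_on N norm (lp_norm p n) S *
      operator_norm_on (lp_carrier n) (lp_norm p n) norm (inv_into N S) < ereal (C + 1)"
    unfolding banach_mazur_distance_def by (auto simp: INF_less_iff)
  define R where "R = inv_into N S"
  have bij: "bij_betw S N (lp_carrier n)" and Sadd: "\<And>x y. x \<in> N \<Longrightarrow> y \<in> N \<Longrightarrow> S (x + y) = S x + S y"
    and Sscale: "\<And>c x. x \<in> N \<Longrightarrow> S (scale c x) = lp_scale c (S x)"
    using S by (auto simp: linear_isomorphism_on_def)
  have RN: "R a \<in> N" and SR: "S (R a) = a" if "a \<in> lp_carrier n" for a
    using bij that unfolding R_def bij_betw_def by (auto intro: inv_into_into f_inv_into_f)
  have RS: "R (S x) = x" and SN: "S x \<in> lp_carrier n" if "x \<in> N" for x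
    using bij that unfolding R_def by (auto simp: bij_betw_def)
  have zeroN: "0 \<in> N" using subN by (rule subspace_0)
  have S0: "S 0 = 0"
    using Sscale[OF zeroN, of 0] by (simp add: lp_scale_def zero_fun_def)
  show ?thesis
  proof (cases "N = {0}")
    case True
    have "n = 0"
    proof (rule ccontr)
      assume "n \<noteq> 0"
      define e :: "nat \<Rightarrow> 'k" where "e = (\<lambda>i. if i = 0 then 1 else 0)"
      have "e \<in> lp_carrier n" using \<open>n \<noteq> 0\<close> by (auto simp: lp_carrier_def e_def)
      then have "e = S 0" using RN SR True by force
      then have "e 0 = 0" using S0 by simp
      then show False by (simp add: e_def)
    qed
    then have "lp_frame p (C + 1) {..<n} (\<lambda>_. 0)" "N \<subseteq> range (\<lambda>a. combo {..<n} a (\<lambda>_. 0))"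
      using True p by (auto simp: lp_frame_def lpn_def combo_def)
    then show ?thesis by blast
  next
    case False
    then obtain x0 where x0: "x0 \<in> N" "x0 \<noteq> 0" using zeroN by blast
    define A where "A = operator_norm_on N norm (lp_norm p n) S"
    define B where "B = operator_norm_on (lp_carrier n) (lp_norm p n) norm R"
    have AB: "A * B < ereal (C + 1)" using prod by (simp add: A_def B_def R_def)
    have Ale: "ereal (lpn p {..<n} (S x)) \<le> A" if "x \<in> N" "norm x \<le> 1" for x
      unfolding A_def operator_norm_on_def lp using that by (intro SUP_upper) auto
    have Ble: "ereal (norm (R a)) \<le> B" if "a \<in> lp_carrier n" "lpn p {..<n} a \<le> 1" for a
      unfolding B_def operator_norm_on_def lp using that by (intro SUP_upper) auto
    have lpnS: "0 < lpn p {..<n} (S x)" if x: "x \<in> N" "x \<noteq> 0" for x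
    proof (rule ccontr)
      assume "\<not> ?thesis"
      then have "lpn p {..<n} (S x) = 0" using lpn_nonneg[of p "{..<n}" "S x"] by linarith
      then have "S x i = 0" if "i < n" for i using lpn_eq_0[of "{..<n}" p "S x" i] that p by simp
      then have "S x = 0" using SN[OF x(1)] by (auto simp: lp_carrier_def fun_eq_iff not_less[symmetric])
      then have "x = 0" using RS[OF x(1)] RS[OF zeroN] S0 by simp
      then show False using x by simp
    qed
    define x1 where "x1 = scale (of_real (1 / norm x0)) x0"
    have x1: "x1 \<in> N" "x1 \<noteq> 0" "norm x1 = 1"
      using x0 subN by (auto simp: x1_def subspace_scale norm_scale norm_divide)
    have Apos: "0 < A"
      using lpnS[OF x1(1,2)] Ale[of x1] x1 by (metis ereal_less(2) order_less_le_trans order_refl)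
    define a1 where "a1 = lp_scale (of_real (1 / lpn p {..<n} (S x0))) (S x0)"
    have x2: "scale (of_real (1 / lpn p {..<n} (S x0))) x0 \<in> N" using subN x0 by (intro subspace_scale)
    have a1: "a1 \<in> lp_carrier n" "lpn p {..<n} a1 = 1"
    proof -
      show "a1 \<in> lp_carrier n" using SN[OF x0(1)] by (auto simp: a1_def lp_carrier_def lp_scale_def)
      show "lpn p {..<n} a1 = 1"
        using lpnS[OF x0] p unfolding a1_def lp_scale_def by (subst lpn_mult) (auto simp: norm_divide)
    qed
    have Ra1: "R a1 = scale (of_real (1 / lpn p {..<n} (S x0))) x0"
      unfolding a1_def Sscale[OF x0(1), symmetric] by (rule RS[OF x2])
    have "0 < norm (R a1)" using lpnS[OF x0] x0 by (simp add: Ra1 norm_scale)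
    then have Bpos: "0 < B"
      using Ble[OF a1(1)] a1(2) by (metis ereal_less(2) order_less_le_trans order_refl)
    have "A \<noteq> \<infinity>" "B \<noteq> \<infinity>" using AB Apos Bpos by (auto split: if_splits)
    then obtain \<alpha> \<beta> where \<alpha>\<beta>: "A = ereal \<alpha>" "B = ereal \<beta>" "0 < \<alpha>" "0 < \<beta>"
      using Apos Bpos by (cases A; cases B) auto
    have prod': "\<alpha> * \<beta> < C + 1" using AB by (simp add: \<alpha>\<beta>)
    have Sle: "lpn p {..<n} (S x) \<le> \<alpha> * norm x" if x: "x \<in> N" for x
    proof (cases "x = 0")
      case True
      then show ?thesis using S0 by (simp add: lpn_def)
    next
      case False
      have "scale (of_real (1 / norm x)) x \<in> N" "norm (scale (of_real (1 / norm x)) x) \<le> 1"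
        using False x subN by (auto simp: subspace_scale norm_scale norm_divide)
      from Ale[OF this] have "lpn p {..<n} (lp_scale (of_real (1 / norm x)) (S x)) \<le> \<alpha>"
        using x by (simp add: \<alpha>\<beta> Sscale)
      then have "1 / norm x * lpn p {..<n} (S x) \<le> \<alpha>"
        using p unfolding lp_scale_def by (subst (asm) lpn_mult) (auto simp: norm_divide)
      then show ?thesis using False by (simp add: field_simps)
    qed
    have Rle: "norm (R a) \<le> \<beta> * lpn p {..<n} a" if a: "a \<in> lp_carrier n" for a
    proof (cases "R a = 0")
      case False
      have ra: "R a \<in> N" using RN[OF a] .
      have pos: "0 < lpn p {..<n} a" using lpnS[OF ra False] SR[OF a] by simp
      let ?c = "of_real (1 / lpn p {..<n} a) :: 'k"
      have "scale ?c (R a) \<in> N" using subN ra by (rule subspace_scale)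
      then have 1: "R (lp_scale ?c a) = scale ?c (R a)"
        using RS[of "scale ?c (R a)"] Sscale[OF ra] SR[OF a] by simp
      have "lp_scale ?c a \<in> lp_carrier n" "lpn p {..<n} (lp_scale ?c a) \<le> 1"
        using a pos p unfolding lp_scale_def
        by (simp add: lp_carrier_def, subst lpn_mult, auto simp: norm_divide)
      from Ble[OF this] have "1 / lpn p {..<n} a * norm (R a) \<le> \<beta>"
        using pos unfolding 1 by (simp add: \<alpha>\<beta> norm_scale norm_divide)
      then show ?thesis using pos by (simp add: field_simps)
    qed (use \<alpha>\<beta> in simp)
    define e :: "nat \<Rightarrow> nat \<Rightarrow> 'k" where "e = (\<lambda>j i. if i = j then 1 else 0)"
    have eN: "R (e j) \<in> N" and Se: "S (R (e j)) = e j" if "j < n" for j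
      using RN[of "e j"] SR[of "e j"] that by (auto simp: e_def lp_carrier_def)
    define u where "u = (\<lambda>j. scale (of_real \<alpha>) (R (e j)))"
    have uN: "u j \<in> N" if "j < n" for j unfolding u_def using subN eN[OF that] by (rule subspace_scale)
    have Su: "S (u j) = lp_scale (of_real \<alpha>) (e j)" if "j < n" for j
      unfolding u_def using Sscale[OF eN[OF that]] Se[OF that] by simp
    have part: "combo {..<k} a u \<in> N \<and> S (combo {..<k} a u) = (\<lambda>i. if i < k then of_real \<alpha> * a i else 0)"
      if "k \<le> n" for k a
      using that
    proof (induction k)
      case 0
      then show ?case using zeroN S0 by (simp add: combo_def zero_fun_def)
    next
      case (Suc k)
      then have k: "k < n" and IH: "combo {..<k} a u \<in> N"
        "S (combo {..<k} a u) = (\<lambda>i. if i < k then of_real \<alpha> * a i else 0)" by auto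
      have 1: "combo {..<Suc k} a u = combo {..<k} a u + scale (a k) (u k)" by (simp add: combo_def)
      have 2: "scale (a k) (u k) \<in> N" using subN uN[OF k] by (rule subspace_scale)
      have "S (combo {..<Suc k} a u) = S (combo {..<k} a u) + lp_scale (a k) (S (u k))"
        unfolding 1 Sadd[OF IH(1) 2] Sscale[OF uN[OF k]] ..
      then show ?case
        unfolding IH(2) Su[OF k] 1 using subN IH(1) 2
        by (auto simp: subspace_add fun_eq_iff lp_scale_def e_def less_Suc_eq)
    qed
    define tr where "tr = (\<lambda>a :: nat \<Rightarrow> 'k. \<lambda>i. if i < n then of_real \<alpha> * a i else 0)"
    have trC: "tr a \<in> lp_carrier n" for a by (simp add: tr_def lp_carrier_def)
    have cN: "combo {..<n} a u \<in> N" and Sc: "S (combo {..<n} a u) = tr a" for a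
      using part[of n a] by (auto simp: tr_def)
    have lpt: "lpn p {..<n} (tr a) = \<alpha> * lpn p {..<n} a" for a
    proof -
      have "lpn p {..<n} (tr a) = lpn p {..<n} (\<lambda>i. of_real \<alpha> * a i)"
        unfolding lpn_def by (simp add: tr_def)
      then show ?thesis using p \<alpha>\<beta> by (simp add: lpn_mult)
    qed
    have "lp_frame p (C + 1) {..<n} u"
      unfolding lp_frame_def
    proof (intro conjI allI)
      fix a
      have "\<alpha> * lpn p {..<n} a \<le> \<alpha> * norm (combo {..<n} a u)"
        using Sle[OF cN[of a]] unfolding Sc lpt .
      then show "lpn p {..<n} a \<le> norm (combo {..<n} a u)" using \<alpha>\<beta> by simp
      have "norm (combo {..<n} a u) \<le> \<beta> * (\<alpha> * lpn p {..<n} a)"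
        using Rle[OF trC[of a]] RS[OF cN[of a]] unfolding Sc lpt by simp
      also have "\<dots> = (\<alpha> * \<beta>) * lpn p {..<n} a" by (simp only: mult_ac)
      also have "\<dots> \<le> (C + 1) * lpn p {..<n} a"
        using prod' by (intro mult_right_mono) auto
      finally show "norm (combo {..<n} a u) \<le> (C + 1) * lpn p {..<n} a" .
    qed simp
    moreover have "N \<subseteq> range (\<lambda>a. combo {..<n} a u)"
    proof
      fix x assume x: "x \<in> N"
      define a where "a = (\<lambda>i. S x i / of_real \<alpha>)"
      have "tr a = S x" using SN[OF x] \<alpha>\<beta> by (auto simp: tr_def a_def lp_carrier_def fun_eq_iff)
      then have "S (combo {..<n} a u) = S x" by (simp add: Sc)
      then have "x = combo {..<n} a u" by (metis RS[OF cN[of a]] RS[OF x])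
      then show "x \<in> range (\<lambda>a. combo {..<n} a u)" by (rule range_eqI[of x "\<lambda>a. combo {..<n} a u" a])
    qed
    ultimately show ?thesis by blast
  qed
qed

lemma script_Lp_frames:
  assumes "script_Lp_space p" "1 < p"
  obtains K where "1 \<le> K"
    "\<And>F. finite F \<Longrightarrow> \<exists>n u. lp_frame p K {..<n::nat} u \<and> F \<subseteq> range (\<lambda>a. combo {..<n} a u) \<and>
        (independent F \<longrightarrow> card F \<le> n)"
proof -
  obtain C where C: "1 \<le> C" and ex: "\<And>M. finite_dimensional M \<Longrightarrow> \<exists>N. finite_dimensional N \<and> M \<subseteq> N \<and>
      banach_mazur_distance N scale norm (lp_carrier (dim N)) lp_scale (lp_norm p (dim N)) \<le> ereal C"
    using assms(1) unfolding script_Lp_space_def by blast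
  have "\<exists>n u. lp_frame p (C + 1) {..<n::nat} u \<and> F \<subseteq> range (\<lambda>a. combo {..<n} a u) \<and>
        (independent F \<longrightarrow> card F \<le> n)" if F: "finite F" for F
  proof -
    have "finite_dimensional (span F)" using F by (auto simp: finite_dimensional_def)
    then obtain N where N: "finite_dimensional N" "span F \<subseteq> N"
      "banach_mazur_distance N scale norm (lp_carrier (dim N)) lp_scale (lp_norm p (dim N)) \<le> ereal C"
      using ex by blast
    obtain u where u: "lp_frame p (C + 1) {..<dim N} u" "N \<subseteq> range (\<lambda>a. combo {..<dim N} a u)"
      using banach_mazur_frame[OF assms(2) C N(1,3)] by blast
    have FN: "F \<subseteq> range (\<lambda>a. combo {..<dim N} a u)" using span_superset N(2) u(2) by blast
    have "card F \<le> dim N" if ind: "independent F"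
    proof -
      have "range (\<lambda>a. combo {..<dim N} a u) \<subseteq> span (u ` {..<dim N})"
      proof (rule image_subsetI)
        show "combo {..<dim N} a u \<in> span (u ` {..<dim N})" for a
          unfolding combo_def by (intro span_sum span_scale span_base) auto
      qed
      then have "card F \<le> card (u ` {..<dim N})"
        using independent_span_bound[of "u ` {..<dim N}" F] ind FN by auto
      also have "\<dots> \<le> dim N" using card_image_le[of "{..<dim N}" u] by simp
      finally show ?thesis .
    qed
    then show ?thesis using u(1) FN by blast
  qed
  then show ?thesis using that[of "C + 1"] C by auto
qed

text \<open>
  A copy of \<open>\<ell>\<^sub>p\<close> that contains many linearly independent vectors has large dimension, and part of
  its basis is a basis of the required size.
\<close>

lemma large_frame:
  assumes frames: "\<And>F. finite F \<Longrightarrow> \<exists>n u. lp_frame p K {..<n::nat} u \<and> F \<subseteq> range (\<lambda>a. combo {..<n} a u) \<and>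
        (independent F \<longrightarrow> card F \<le> n)"
    and inf: "\<not> finite_dimensional UNIV" and J: "finite (J :: 'j set)"
  shows "\<exists>u :: 'j \<Rightarrow> 'x. lp_frame p K J u"
proof -
  obtain B where B: "independent B" "span B = UNIV"
    using basis_exists[of UNIV] by (metis subset_UNIV subset_antisym)
  have "infinite B" using inf B by (auto simp: finite_dimensional_def subspace_UNIV)
  then obtain F where F: "finite F" "card F = card J" "F \<subseteq> B"
    using infinite_arbitrarily_large by metis
  have "independent F" using B F independent_mono by blast
  then obtain n u where u: "lp_frame p K {..<n::nat} u" "card J \<le> n"
    using frames[OF F(1)] F(2) by metis
  obtain g where g: "bij_betw g J {..<card J}"
    using ex_bij_betw_finite_nat[OF J] atLeast0LessThan by metis
  have "lp_frame p K J (u \<circ> g)"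
    using g u(2) by (intro lp_frame_subfamily[OF u(1)]) (auto simp: bij_betw_def)
  then show ?thesis by blast
qed

section \<open>Rademacher systems\<close>

text \<open>
  The coordinates of \<open>\<ell>\<^sub>p\<close> are indexed by the sign patterns, so that the \<open>i\<close>-th Rademacher function
  is \<open>e \<mapsto> e i\<close>, up to normalization, and averages over signs are norms in \<open>\<ell>\<^sub>p\<close>.
\<close>

lemma rademacher_system:
  assumes fr: "lp_frame p K (signs {..<m}) u" and p: "1 < p" "p \<le> 2 * real r" and K: "0 \<le> K"
  defines "\<delta> \<equiv> (1 / 2 ^ m) powr (1 / p)"
  shows "norm (\<Sum>i<m. scale (a i) (combo (signs {..<m}) (\<lambda>e. of_real (\<delta> * e i)) u))
          \<le> K * (1 + (4 * real r + 1) ^ r) powr (1 / p) * sqrt (sqn m a)"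
proof -
  let ?\<Omega> = "signs {..<m}"
  let ?A = "\<lambda>e. \<Sum>i<m. e i *\<^sub>R a i"
  let ?C = "1 + (4 * real r + 1) ^ r"
  have C: "0 < ?C" by (intro add_pos_nonneg) auto
  have \<delta>: "0 < \<delta>" "\<delta> powr p = 1 / 2 ^ m" using p by (auto simp: \<delta>_def powr_powr)
  have "(\<Sum>i<m. scale (a i) (combo ?\<Omega> (\<lambda>e. of_real (\<delta> * e i)) u)) = combo ?\<Omega> (\<lambda>e. of_real \<delta> * ?A e) u"
  proof -
    have "(\<Sum>i<m. scale (a i) (combo ?\<Omega> (\<lambda>e. of_real (\<delta> * e i)) u))
        = (\<Sum>i<m. \<Sum>e\<in>?\<Omega>. scale (of_real \<delta> * (e i *\<^sub>R a i)) (u e))"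
      by (simp add: combo_def scale_sum_right scaleR_conv_of_real mult_ac)
    also have "\<dots> = combo ?\<Omega> (\<lambda>e. of_real \<delta> * ?A e) u"
      unfolding combo_def sum_distrib_left scale_sum_left by (rule sum.swap)
    finally show ?thesis .
  qed
  then have "norm (\<Sum>i<m. scale (a i) (combo ?\<Omega> (\<lambda>e. of_real (\<delta> * e i)) u)) \<le> K * lpn p ?\<Omega> (\<lambda>e. of_real \<delta> * ?A e)"
    using fr by (simp add: lp_frame_def)
  also have "lpn p ?\<Omega> (\<lambda>e. of_real \<delta> * ?A e) = (sign_avg {..<m} (\<lambda>e. norm (?A e) powr p)) powr (1 / p)"
    using \<delta> by (simp add: lpn_def sign_avg_def norm_mult powr_mult sum_divide_distrib)
  also have "\<dots> \<le> (?C * sqn m a powr (p / 2)) powr (1 / p)"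
    unfolding sqn_def using p by (intro powr_mono2 khinchine_powr sign_avg_nonneg) auto
  also have "\<dots> = ?C powr (1 / p) * sqrt (sqn m a)"
    using p C by (simp add: powr_mult powr_powr powr_half_sqrt)
  finally show ?thesis using K by (simp add: mult_left_mono mult.assoc)
qed

text \<open>
  Coordinatewise, Cauchy--Schwarz gives \<open>\<surd>m\<close> times the square function of \<open>(c\<^sub>1, \<dots>, c\<^sub>m)\<close>, which
  Khinchine's inequality replaces by a random sum \<open>\<Sum> \<epsilon>\<^sub>i c\<^sub>i\<close>. Only such random sums have a meaning
  in \<open>X\<close>.
\<close>

lemma rademacher_functional_bound:
  assumes fr: "lp_frame p K (signs {..<m}) u" and pq: "1 < p" "1 < q" "1 / p + 1 / q = 1"
  defines "\<eta> \<equiv> (1 / 2 ^ m) powr (1 / q)"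
  shows "norm (\<Sum>i<m. \<Sum>e\<in>signs {..<m}. of_real (\<eta> * e i) * c i e)
    \<le> 24 * sqrt m * sign_avg {..<m} (\<lambda>e'. norm (\<Sum>i<m. e' i *\<^sub>R combo (signs {..<m}) (c i) u))"
proof -
  let ?\<Omega> = "signs {..<m}"
  have \<eta>: "0 \<le> \<eta>" "\<eta> powr q = 1 / 2 ^ m" using pq by (auto simp: \<eta>_def powr_powr)
  have "(\<Sum>i<m. \<Sum>e\<in>?\<Omega>. of_real (\<eta> * e i) * c i e) = (\<Sum>e\<in>?\<Omega>. of_real \<eta> * (\<Sum>i<m. of_real (e i) * c i e))"
    unfolding sum_distrib_left by (subst sum.swap) (simp add: mult.assoc)
  then have "norm (\<Sum>i<m. \<Sum>e\<in>?\<Omega>. of_real (\<eta> * e i) * c i e)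
      \<le> (\<Sum>e\<in>?\<Omega>. norm (of_real \<eta> * (\<Sum>i<m. of_real (e i) * c i e)))"
    by (simp only: norm_sum)
  also have "\<dots> \<le> (\<Sum>e\<in>?\<Omega>. \<eta> * (24 * sqrt m * sign_avg {..<m} (\<lambda>e'. norm (\<Sum>i<m. e' i *\<^sub>R c i e))))"
  proof (rule sum_mono)
    fix e assume e: "e \<in> ?\<Omega>"
    have "(norm (\<Sum>i<m. of_real (e i) * c i e))\<^sup>2 \<le> (\<Sum>i<m. (norm (of_real (e i) :: 'k))\<^sup>2) * (\<Sum>i<m. (norm (c i e))\<^sup>2)"
      by (rule norm_sum_mult_square_le)
    also have "(\<Sum>i<m. (norm (of_real (e i) :: 'k))\<^sup>2) = (\<Sum>i<m. 1)"
      using signs_abs[OF e] by (intro sum.cong) auto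
    finally have "norm (\<Sum>i<m. of_real (e i) * c i e) \<le> sqrt (m * (\<Sum>i<m. (norm (c i e))\<^sup>2))"
      by (intro real_le_rsqrt) simp
    also have "\<dots> \<le> sqrt m * (24 * sign_avg {..<m} (\<lambda>e'. norm (\<Sum>i<m. e' i *\<^sub>R c i e)))"
      unfolding real_sqrt_mult by (intro mult_left_mono khinchine_lower) auto
    finally show "norm (of_real \<eta> * (\<Sum>i<m. of_real (e i) * c i e))
        \<le> \<eta> * (24 * sqrt m * sign_avg {..<m} (\<lambda>e'. norm (\<Sum>i<m. e' i *\<^sub>R c i e)))"
      using \<eta>(1) unfolding norm_mult by (simp add: mult_left_mono mult_ac)
  qed
  also have "\<dots> = 24 * sqrt m * sign_avg {..<m} (\<lambda>e'. \<Sum>e\<in>?\<Omega>. norm (\<Sum>i<m. e' i *\<^sub>R c i e) * \<eta>)"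
    unfolding sign_avg_sum sum_distrib_left
    by (intro sum.cong refl) (simp add: sign_avg_mult[symmetric] mult_ac)
  also have "\<dots> \<le> 24 * sqrt m * sign_avg {..<m} (\<lambda>e'. norm (\<Sum>i<m. e' i *\<^sub>R combo ?\<Omega> (c i) u))"
  proof (intro mult_left_mono sign_avg_mono)
    fix e' :: "nat \<Rightarrow> real"
    let ?d = "\<lambda>e. \<Sum>i<m. e' i *\<^sub>R c i e"
    have "(\<Sum>e\<in>?\<Omega>. norm (?d e) * \<eta>) \<le> (\<Sum>e\<in>?\<Omega>. norm (?d e) powr p) powr (1 / p) * (\<Sum>e\<in>?\<Omega>. \<eta> powr q) powr (1 / q)"
      using \<eta>(1) by (intro holder_sum pq) auto
    also have "(\<Sum>e\<in>?\<Omega>. \<eta> powr q) = 1"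
      unfolding \<eta>(2) by (simp add: card_signs)
    also have "(\<Sum>e\<in>?\<Omega>. norm (?d e) powr p) powr (1 / p) * 1 powr (1 / q) = lpn p ?\<Omega> ?d"
      by (simp add: lpn_def)
    also have "\<dots> \<le> norm (combo ?\<Omega> ?d u)"
      using fr by (simp add: lp_frame_def)
    also have "combo ?\<Omega> ?d u = (\<Sum>i<m. e' i *\<^sub>R combo ?\<Omega> (c i) u)"
      unfolding combo_def norm_scaleR_scale scale_sum_left scale_sum_right
      by (subst sum.swap) (simp add: scaleR_conv_of_real)
    finally show "(\<Sum>e\<in>?\<Omega>. norm (?d e) * \<eta>) \<le> norm (\<Sum>i<m. e' i *\<^sub>R combo ?\<Omega> (c i) u)" .
  qed auto
  finally show ?thesis .
qed

text \<open>
  A norm on \<open>X\<^sup>m\<close>, as a seminorm on all sequences; in a lattice like \<open>\<ell>\<^sub>p\<close> it is equivalent to the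
  norm of the square function.
\<close>

definition randomized_norm :: "nat \<Rightarrow> (nat \<Rightarrow> 'x) \<Rightarrow> real" where
  "randomized_norm m y = sign_avg {..<m} (\<lambda>e. norm (\<Sum>i<m. e i *\<^sub>R y i))"

definition linear_form :: "('x \<Rightarrow> 'k) \<Rightarrow> bool" where
  "linear_form f \<longleftrightarrow> (\<forall>x y. f (x + y) = f x + f y) \<and> (\<forall>c x. f (scale c x) = c * f x)"

text \<open>
  The constant \<open>24\<close> is that of the lower Khinchine inequality.
\<close>

definition randomly_bounded :: "nat \<Rightarrow> (nat \<Rightarrow> 'x \<Rightarrow> 'k) \<Rightarrow> bool" where
  "randomly_bounded m \<phi> \<longleftrightarrow> (\<forall>i. linear_form (\<phi> i)) \<and>
     (\<forall>y. norm (\<Sum>i<m. \<phi> i (y i)) \<le> 24 * sqrt m * randomized_norm m y)"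

lemma randomized_norm_single:
  assumes "i < m"
  shows "randomized_norm m (\<lambda>j. if j = i then x else 0) = norm x"
proof -
  have "randomized_norm m (\<lambda>j. if j = i then x else 0) = sign_avg {..<m} (\<lambda>_. norm x)"
    unfolding randomized_norm_def
  proof (rule sign_avg_cong)
    fix e :: "nat \<Rightarrow> real" assume e: "e \<in> signs {..<m}"
    have "(\<Sum>j<m. e j *\<^sub>R (if j = i then x else 0)) = (\<Sum>j<m. if j = i then e i *\<^sub>R x else 0)"
      by (intro sum.cong) auto
    then show "norm (\<Sum>j<m. e j *\<^sub>R (if j = i then x else 0)) = norm x"
      using assms signs_abs[OF e, of i] by simp
  qed
  then show ?thesis by simp
qed

text \<open>
  The functional \<open>(y\<^sub>1, \<dots>, y\<^sub>m) \<mapsto> \<Sum> \<phi>\<^sub>i(y\<^sub>i)\<close>, where \<open>\<phi>\<^sub>i\<close> is the \<open>i\<close>-th Rademacher coefficient, is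
  extended from \<open>m\<close>-tuples in the copy of \<open>\<ell>\<^sub>p\<close> to \<open>m\<close>-tuples in \<open>X\<close> in one application of the
  Hahn--Banach theorem. Extending each \<open>\<phi>\<^sub>i\<close> separately would lose the joint estimate.
\<close>

lemma randomized_biorthogonal_system:
  assumes fr: "lp_frame p K (signs {..<m}) u" and pq: "1 < p" "1 < q" "1 / p + 1 / q = 1"
    and r: "p \<le> 2 * real r" and K: "0 \<le> K"
  shows "\<exists>x \<phi>. randomly_bounded m \<phi> \<and> (\<forall>i<m. \<forall>j<m. \<phi> i (x j) = (if i = j then 1 else 0)) \<and>
    (\<forall>a. norm (\<Sum>i<m. scale (a i) (x i)) \<le> K * (1 + (4 * real r + 1) ^ r) powr (1 / p) * sqrt (sqn m a))"
proof -
  let ?\<Omega> = "signs {..<m}"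
  define \<delta> where "\<delta> = (1 / 2 ^ m :: real) powr (1 / p)"
  define \<eta> where "\<eta> = (1 / 2 ^ m :: real) powr (1 / q)"
  have \<delta>\<eta>: "\<eta> * \<delta> = 1 / 2 ^ m"
    unfolding \<delta>_def \<eta>_def powr_add[symmetric] using pq by (simp add: add.commute)
  define x where "x = (\<lambda>i. combo ?\<Omega> (\<lambda>e. of_real (\<delta> * e i)) u)"
  define coef where "coef = (\<lambda>y. SOME a. y = combo ?\<Omega> a u)"
  define U where "U = range (\<lambda>a. combo ?\<Omega> a u)"
  have coef: "y = combo ?\<Omega> (coef y) u" if y: "y \<in> U" for y
  proof -
    obtain a where "y = combo ?\<Omega> a u" using y by (auto simp: U_def)
    then show ?thesis unfolding coef_def by (rule someI[of "\<lambda>a. y = combo ?\<Omega> a u"])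
  qed
  have coef_eq: "coef (combo ?\<Omega> a u) e = a e" if "e \<in> ?\<Omega>" for a e
    using lp_frame_coefficients_unique[OF fr, of "coef (combo ?\<Omega> a u)" a e] coef[of "combo ?\<Omega> a u"] that pq
    by (auto simp: U_def)
  have U0: "0 \<in> U" unfolding U_def by (rule range_eqI[of _ _ "\<lambda>_. 0"]) (simp add: combo_def)
  have Uadd: "y + z \<in> U" if "y \<in> U" "z \<in> U" for y z
    using that unfolding U_def by (auto simp: combo_add[symmetric])
  have Uscale: "scale c y \<in> U" if "y \<in> U" for c y
    using that unfolding U_def by (auto simp: combo_mult[symmetric])
  have coef_add: "coef (y + z) e = coef y e + coef z e" if yz: "y \<in> U" "z \<in> U" and e: "e \<in> ?\<Omega>" for y z e
  proof -
    obtain a b where ab: "y = combo ?\<Omega> a u" "z = combo ?\<Omega> b u" using yz by (auto simp: U_def)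
    show ?thesis using e unfolding ab combo_add[symmetric] by (simp add: coef_eq)
  qed
  have coef_scale: "coef (scale c y) e = c * coef y e" if y: "y \<in> U" and e: "e \<in> ?\<Omega>" for c y e
  proof -
    obtain a where a: "y = combo ?\<Omega> a u" using y by (auto simp: U_def)
    show ?thesis using e unfolding a combo_mult[symmetric] by (simp add: coef_eq)
  qed
  define s :: "'k \<Rightarrow> (nat \<Rightarrow> 'x) \<Rightarrow> (nat \<Rightarrow> 'x)" where "s = (\<lambda>c y i. scale c (y i))"
  define M where "M = {y :: nat \<Rightarrow> 'x. \<forall>i<m. y i \<in> U}"
  define f where "f = (\<lambda>y. \<Sum>i<m. \<Sum>e\<in>?\<Omega>. of_real (\<eta> * e i) * coef (y i) e)"
  have "\<exists>g. (\<forall>y z. g (y + z) = g y + g z) \<and> (\<forall>c y. g (s c y) = c * g y) \<and>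
           (\<forall>y. norm (g y) \<le> 24 * sqrt m * randomized_norm m y) \<and> (\<forall>y\<in>M. g y = f y)"
  proof (rule hahn_banach)
    show "vector_space s"
      by unfold_locales (auto simp: s_def fun_eq_iff scale_right_distrib scale_left_distrib)
    show "24 * sqrt m * randomized_norm m (y + z) \<le> 24 * sqrt m * randomized_norm m y + 24 * sqrt m * randomized_norm m z" for y z
    proof -
      have "randomized_norm m (y + z) \<le> randomized_norm m y + randomized_norm m z"
        unfolding randomized_norm_def sign_avg_add[symmetric]
        by (intro sign_avg_mono) (simp add: scaleR_right_distrib sum.distrib norm_triangle_ineq)
      then have "24 * sqrt m * randomized_norm m (y + z) \<le> 24 * sqrt m * (randomized_norm m y + randomized_norm m z)"
        by (intro mult_left_mono) auto
      then show ?thesis by (simp add: distrib_left)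
    qed
    show "24 * sqrt m * randomized_norm m (s c y) = norm c * (24 * sqrt m * randomized_norm m y)" for c y
    proof -
      have "norm (\<Sum>i<m. e i *\<^sub>R s c y i) = norm c * norm (\<Sum>i<m. e i *\<^sub>R y i)" for e :: "nat \<Rightarrow> real"
      proof -
        have "(\<Sum>i<m. e i *\<^sub>R s c y i) = scale c (\<Sum>i<m. e i *\<^sub>R y i)"
          by (simp add: s_def scale_sum_right norm_scaleR_scale mult.commute)
        then show ?thesis by (simp add: norm_scale)
      qed
      then show ?thesis by (simp add: randomized_norm_def sign_avg_mult)
    qed
    show "0 \<in> M" using U0 by (simp add: M_def)
    show "y + z \<in> M" if "y \<in> M" "z \<in> M" for y z using that Uadd by (simp add: M_def)
    show "s c y \<in> M" if "y \<in> M" for c y using that Uscale by (simp add: M_def s_def)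
    show "f (y + z) = f y + f z" if "y \<in> M" "z \<in> M" for y z
    proof -
      have "f (y + z) = (\<Sum>i<m. \<Sum>e\<in>?\<Omega>. of_real (\<eta> * e i) * coef (y i) e + of_real (\<eta> * e i) * coef (z i) e)"
        unfolding f_def using that by (intro sum.cong refl) (auto simp: M_def coef_add distrib_left)
      then show ?thesis by (simp add: f_def sum.distrib)
    qed
    show "f (s c y) = c * f y" if "y \<in> M" for c y
    proof -
      have "f (s c y) = (\<Sum>i<m. \<Sum>e\<in>?\<Omega>. c * (of_real (\<eta> * e i) * coef (y i) e))"
        unfolding f_def using that by (intro sum.cong refl) (auto simp: M_def s_def coef_scale)
      then show ?thesis by (simp add: f_def sum_distrib_left)
    qed
    show "norm (f y) \<le> 24 * sqrt m * randomized_norm m y" if y: "y \<in> M" for y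
    proof -
      have "randomized_norm m y = sign_avg {..<m} (\<lambda>e'. norm (\<Sum>i<m. e' i *\<^sub>R combo ?\<Omega> (coef (y i)) u))"
      proof -
        have "(\<Sum>i<m. e' i *\<^sub>R y i) = (\<Sum>i<m. e' i *\<^sub>R combo ?\<Omega> (coef (y i)) u)" for e' :: "nat \<Rightarrow> real"
          using y by (intro sum.cong refl arg_cong[of _ _ "scaleR _"] coef) (auto simp: M_def)
        then show ?thesis unfolding randomized_norm_def by (simp only:)
      qed
      then show ?thesis
        unfolding f_def using rademacher_functional_bound[OF fr pq, of "\<lambda>i. coef (y i)"]
        by (simp add: \<eta>_def)
    qed
  qed
  then obtain g where g: "\<And>y z. g (y + z) = g y + g z" "\<And>c y. g (s c y) = c * g y"
    "\<And>y. norm (g y) \<le> 24 * sqrt m * randomized_norm m y" "\<And>y. y \<in> M \<Longrightarrow> g y = f y" by blast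
  define \<phi> where "\<phi> = (\<lambda>i y. g (\<lambda>j. if j = i then y else 0))" for i :: nat
  have \<phi>add: "\<phi> i (y + z) = \<phi> i y + \<phi> i z" for i y z
    unfolding \<phi>_def g(1)[symmetric] by (rule arg_cong[of _ _ g]) auto
  have \<phi>scale: "\<phi> i (scale c y) = c * \<phi> i y" for i c y
    unfolding \<phi>_def g(2)[symmetric] s_def by (rule arg_cong[of _ _ g]) auto
  have gsum: "g y = (\<Sum>i<m. \<phi> i (y i))" for y
  proof -
    define tr where "tr = (\<lambda>k j. if j < k then y j else 0)" for k
    have "g (tr k) = (\<Sum>i<k. \<phi> i (y i))" for k
    proof (induction k)
      case 0
      have "tr 0 = s 0 y" by (auto simp: tr_def s_def)
      then show ?case by (simp add: g(2))
    next
      case (Suc k)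
      have e: "tr (Suc k) = tr k + (\<lambda>j. if j = k then y k else 0)" by (auto simp: tr_def)
      show ?case unfolding e g(1) Suc by (simp add: \<phi>_def)
    qed
    moreover have "g y = g (tr m) + g (\<lambda>j. if j < m then 0 else y j)"
      unfolding g(1)[symmetric] by (rule arg_cong[of _ _ g]) (auto simp: tr_def)
    moreover have "randomized_norm m (\<lambda>j. if j < m then 0 else y j) = 0"
      unfolding randomized_norm_def by (simp cong: sign_avg_cong)
    then have "g (\<lambda>j. if j < m then 0 else y j) = 0"
      using g(3)[of "\<lambda>j. if j < m then 0 else y j"] by simp
    ultimately show ?thesis by simp
  qed
  have biorth: "\<phi> i (x j) = (if i = j then 1 else 0)" if ij: "i < m" "j < m" for i j
  proof -
    let ?y = "\<lambda>l. if l = i then x j else 0"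
    have xU: "x j \<in> U" by (auto simp: x_def U_def)
    have coef0: "coef 0 e = 0" if "e \<in> ?\<Omega>" for e
      using coef_eq[OF that, of "\<lambda>_. 0"] by (simp add: combo_def)
    have "?y \<in> M" using xU U0 by (auto simp: M_def)
    then have "\<phi> i (x j) = f ?y" unfolding \<phi>_def by (rule g(4))
    also have "\<dots> = (\<Sum>l<m. if l = i then (\<Sum>e\<in>?\<Omega>. of_real (\<eta> * e i) * coef (x j) e) else 0)"
      unfolding f_def by (intro sum.cong refl) (auto simp: coef0)
    also have "\<dots> = (\<Sum>e\<in>?\<Omega>. of_real (\<eta> * e i) * coef (x j) e)" using ij by simp
    also have "\<dots> = (\<Sum>e\<in>?\<Omega>. of_real (\<eta> * e i) * of_real (\<delta> * e j))"
      unfolding x_def by (intro sum.cong refl) (simp add: coef_eq)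
    also have "\<dots> = of_real (\<Sum>e\<in>?\<Omega>. (\<eta> * \<delta>) * (e i * e j))"
      by (simp add: mult_ac)
    also have "(\<Sum>e\<in>?\<Omega>. (\<eta> * \<delta>) * (e i * e j)) = sign_avg {..<m} (\<lambda>e. e i * e j)"
      unfolding \<delta>\<eta> sum_distrib_left[symmetric] by (simp add: sign_avg_def)
    also have "\<dots> = (if i = j then 1 else 0)"
      using ij by (intro sign_avg_orthogonal) auto
    finally show ?thesis by simp
  qed
  show ?thesis
  proof (rule exI[of _ x], rule exI[of _ \<phi>], intro conjI allI impI)
    show "norm (\<Sum>i<m. scale (a i) (x i)) \<le> K * (1 + (4 * real r + 1) ^ r) powr (1 / p) * sqrt (sqn m a)" for a
      unfolding x_def \<delta>_def by (rule rademacher_system[OF fr pq(1) r K])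
    show "randomly_bounded m \<phi>"
      unfolding randomly_bounded_def linear_form_def gsum[symmetric] using \<phi>add \<phi>scale g(3) by blast
  qed (use biorth in auto)
qed

end

lemma square_powr_half: "0 \<le> t \<Longrightarrow> (t\<^sup>2) powr (p / 2) = t powr (p::real)"
proof (cases "t = 0")
  case False
  assume "0 \<le> t"
  then have "t\<^sup>2 = t powr 2" using False by (simp add: powr_numeral)
  then show ?thesis by (simp add: powr_powr)
qed simp

context normed_space_over
begin

lemma linear_form_zero: "linear_form f \<Longrightarrow> f 0 = 0"
  unfolding linear_form_def by (metis mult_zero_left scale_zero_left)

lemma linear_form_sum: "linear_form f \<Longrightarrow> f (\<Sum>i\<in>I. y i) = (\<Sum>i\<in>I. f (y i))"
  by (induction I rule: infinite_finite_induct) (auto simp: linear_form_zero, auto simp: linear_form_def)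

lemma linear_form_combo: "linear_form f \<Longrightarrow> f (combo I a u) = (\<Sum>i\<in>I. a i * f (u i))"
  unfolding combo_def by (simp add: linear_form_sum) (simp add: linear_form_def)

text \<open>
  On the copy of \<open>\<ell>\<^sub>p\<close> spanned by \<open>u\<close> the randomized norm is at most a multiple of the \<open>\<ell>\<^sub>p\<close> norm of
  the square function. So \<open>g\<^sub>i(s) = \<phi>\<^sub>i(u\<^sub>s)\<close> defines a functional on \<open>\<ell>\<^sub>p\<close> with values in \<open>\<ell>\<^sub>2\<^sup>m\<close> whose
  norm is the \<open>\<ell>\<^sub>q\<close> norm of its square function \<open>\<surd>m G\<close>; the lemma bounds this norm by testing the
  functional at the element \<open>z\<close> at which it is attained.
\<close>

lemma coefficient_square_function_bound:
  assumes fr: "lp_frame p K I u" and pq: "1 < p" "1 < q" "1 / p + 1 / q = 1"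
    and r: "p \<le> 2 * real r" and K: "0 \<le> K"
    and rb: "randomly_bounded m \<phi>"
  shows "(\<Sum>s\<in>I. sqrt (sqn m (\<lambda>i. \<phi> i (u s)) / m) powr q) \<le> (24 * K * (2 + (4 * real r + 1) ^ r)) powr q"
proof -
  have finI: "finite I" using fr by (simp add: lp_frame_def)
  have lin: "linear_form (\<phi> i)" for i using rb by (simp add: randomly_bounded_def)
  have \<phi>: "norm (\<Sum>i<m. \<phi> i (y i)) \<le> 24 * sqrt m * randomized_norm m y" for y
    using rb by (simp add: randomly_bounded_def)
  define g where "g = (\<lambda>s i. \<phi> i (u s))"
  define G where "G = (\<lambda>s. sqrt (sqn m (g s) / m))"
  define S where "S = (\<Sum>s\<in>I. G s powr q)"
  define C where "C = (4 * real r + 1) ^ r"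
  have C0: "0 \<le> C" by (simp add: C_def)
  have G0: "0 \<le> G s" for s by (simp add: G_def)
  have S0: "0 \<le> S" by (simp add: S_def sum_nonneg)
  have "S \<le> (24 * K * (2 + C)) powr q"
  proof (cases "S = 0 \<or> m = 0")
    case True
    then show ?thesis
    proof
      assume "m = 0"
      then have "G s = 0" for s by (simp add: G_def)
      then show ?thesis using pq by (simp add: S_def)
    qed simp
  next
    case False
    then have S: "0 < S" and m: "0 < m" using S0 by auto
    have sqg: "sqn m (g s) = m * (G s)\<^sup>2" for s using m by (simp add: G_def)
    \<comment> \<open>Where \<open>G s = 0\<close> this vanishes by the convention \<open>0 powr a = 0\<close>, also for \<open>q < 2\<close>.\<close>
    define c where "c = (\<lambda>s. G s powr (q - 2) / (sqrt m * S powr (1 / p)))"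
    have c0: "0 \<le> c s" for s by (simp add: c_def)
    define z where "z = (\<lambda>s i. of_real (c s) * kcnj (g s i))"
    define y where "y = (\<lambda>i. combo I (\<lambda>s. z s i) u)"
    have Gpow: "G s powr (q - 2) * G s = G s powr (q - 1)" "G s powr (q - 2) * (G s)\<^sup>2 = G s powr q" for s
    proof -
      consider "G s = 0" | "0 < G s" using G0[of s] by linarith
      then have "G s powr (q - 2) * G s = G s powr (q - 1) \<and> G s powr (q - 2) * (G s)\<^sup>2 = G s powr q"
      proof cases
        case 2
        have "G s powr (q - 2) * G s powr 1 = G s powr (q - 1)"
          "G s powr (q - 2) * G s powr real 2 = G s powr q"
          unfolding powr_add[symmetric] by simp_all
        then show ?thesis using 2 by (simp add: powr_realpow[of "G s" 2])
      qed simp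
      then show "G s powr (q - 2) * G s = G s powr (q - 1)" "G s powr (q - 2) * (G s)\<^sup>2 = G s powr q" by auto
    qed
    have "(\<Sum>i<m. \<phi> i (y i)) = (\<Sum>s\<in>I. \<Sum>i<m. z s i * g s i)"
      unfolding y_def linear_form_combo[OF lin] by (subst sum.swap) (simp add: g_def)
    also have "\<dots> = (\<Sum>s\<in>I. of_real (c s * sqn m (g s)))"
      unfolding of_real_mult of_real_sqn z_def sum_distrib_left by (simp add: mult_ac)
    also have "\<dots> = of_real (\<Sum>s\<in>I. c s * sqn m (g s))" by simp
    also have "(\<Sum>s\<in>I. c s * sqn m (g s)) = (\<Sum>s\<in>I. sqrt m / S powr (1 / p) * G s powr q)"
    proof (rule sum.cong[OF refl])
      fix s
      have "c s * sqn m (g s) = m / sqrt m / S powr (1 / p) * (G s powr (q - 2) * (G s)\<^sup>2)"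
        by (simp add: c_def sqg)
      then show "c s * sqn m (g s) = sqrt m / S powr (1 / p) * G s powr q"
        using m unfolding Gpow by (simp add: real_div_sqrt)
    qed
    also have "\<dots> = sqrt m * (S powr 1 / S powr (1 / p))"
      unfolding sum_distrib_left[symmetric] S_def[symmetric] using S by simp
    also have "\<dots> = sqrt m * S powr (1 / q)"
    proof -
      have "1 - 1 / p = 1 / q" using pq by simp
      then show ?thesis unfolding powr_diff[symmetric] by simp
    qed
    finally have e: "(\<Sum>i<m. \<phi> i (y i)) = of_real (sqrt m * S powr (1 / q))" .
    have pairing: "norm (\<Sum>i<m. \<phi> i (y i)) = sqrt m * S powr (1 / q)"
      unfolding e norm_of_real by simp
    have zp: "sqn m (z s) powr (p / 2) = G s powr q / S" for s
    proof -
      have "sqn m (z s) = (c s * sqrt m * G s)\<^sup>2"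
        unfolding z_def sqn_scale sqn_kcnj sqg by (simp add: power_mult_distrib)
      then have "sqn m (z s) powr (p / 2) = (c s * sqrt m * G s) powr p"
        using c0[of s] G0[of s] by (simp add: square_powr_half)
      also have "c s * sqrt m * G s = G s powr (q - 1) / S powr (1 / p)"
        using m unfolding Gpow(1)[symmetric] by (simp add: c_def)
      also have "\<dots> powr p = G s powr ((q - 1) * p) / S"
        using pq S by (simp add: powr_divide powr_powr)
      also have "(q - 1) * p = q" using pq by (simp add: field_simps)
      finally show ?thesis .
    qed
    let ?A = "\<lambda>e s. \<Sum>i<m. e i *\<^sub>R z s i"
    have "randomized_norm m y \<le> sign_avg {..<m} (\<lambda>e. K * (1 + (\<Sum>s\<in>I. norm (?A e s) powr p)))"
      unfolding randomized_norm_def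
    proof (rule sign_avg_mono)
      fix e :: "nat \<Rightarrow> real"
      have "(\<Sum>i<m. e i *\<^sub>R y i) = combo I (?A e) u"
        unfolding y_def combo_def norm_scaleR_scale scale_sum_left scale_sum_right
        by (subst sum.swap) (simp add: scaleR_conv_of_real)
      then have "norm (\<Sum>i<m. e i *\<^sub>R y i) \<le> K * lpn p I (?A e)"
        using fr by (simp add: lp_frame_def)
      also have "lpn p I (?A e) \<le> 1 + (\<Sum>s\<in>I. norm (?A e s) powr p)"
      proof -
        define t where "t = (\<Sum>s\<in>I. norm (?A e s) powr p)"
        have t: "0 \<le> t" by (simp add: t_def sum_nonneg)
        have "t powr (1 / p) \<le> 1 + t"
        proof (cases "t \<le> 1")
          case True
          then have "t powr (1 / p) \<le> 1" using t pq by (simp add: powr_le1)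
          then show ?thesis using t by linarith
        next
          case False
          then have "t powr (1 / p) \<le> t powr 1" using pq by (intro powr_mono) auto
          then show ?thesis using False by simp
        qed
        then show ?thesis by (simp add: lpn_def t_def)
      qed
      finally show "norm (\<Sum>i<m. e i *\<^sub>R y i) \<le> K * (1 + (\<Sum>s\<in>I. norm (?A e s) powr p))"
        using K by (simp add: mult_left_mono)
    qed
    also have "\<dots> = K * (1 + (\<Sum>s\<in>I. sign_avg {..<m} (\<lambda>e. norm (?A e s) powr p)))"
      by (simp add: sign_avg_mult sign_avg_add sign_avg_sum)
    also have "\<dots> \<le> K * (1 + (\<Sum>s\<in>I. (1 + C) * (G s powr q / S)))"
    proof (intro mult_left_mono add_left_mono sum_mono K)
      fix s
      show "sign_avg {..<m} (\<lambda>e. norm (?A e s) powr p) \<le> (1 + C) * (G s powr q / S)"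
        unfolding zp[symmetric] C_def sqn_def using pq r by (intro khinchine_powr) auto
    qed
    also have "\<dots> = K * (2 + C)"
      using S by (simp add: sum_distrib_left[symmetric] sum_divide_distrib[symmetric] S_def[symmetric])
    finally have rn: "randomized_norm m y \<le> K * (2 + C)" .
    have "sqrt m * S powr (1 / q) \<le> 24 * sqrt m * randomized_norm m y"
      using \<phi>[of y] pairing by simp
    also have "\<dots> \<le> 24 * sqrt m * (K * (2 + C))"
      by (intro mult_left_mono rn) auto
    finally have "sqrt m * S powr (1 / q) \<le> sqrt m * (24 * K * (2 + C))" by (simp add: mult_ac)
    then have "S powr (1 / q) \<le> 24 * K * (2 + C)" using m by simp
    then have "(S powr (1 / q)) powr q \<le> (24 * K * (2 + C)) powr q"
      using pq by (intro powr_mono2) auto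
    then show ?thesis using pq S by (simp add: powr_powr)
  qed
  then show ?thesis by (simp add: S_def G_def g_def C_def)
qed

end

section \<open>Passing from averages to all directions\<close>

lemma finite_ball_net:
  obtains Net :: "(nat \<Rightarrow> 'k::real_or_complex) set" where "finite Net"
    "\<And>b. b \<in> Net \<Longrightarrow> sqn k b \<le> 4"
    "\<And>b. sqn k b \<le> 1 \<Longrightarrow> \<exists>b'\<in>Net. sqn k (\<lambda>j. b j - b' j) \<le> 1 / 4"
proof -
  define \<delta> where "\<delta> = 1 / (2 * (real k + 1))"
  have \<delta>: "0 < \<delta>" by (simp add: \<delta>_def)
  obtain D :: "'k set" where D: "finite D" "\<And>z. norm z \<le> 1 \<Longrightarrow> \<exists>d\<in>D. norm (z - d) \<le> \<delta>"
    using finite_scalar_net[OF \<delta>] by blast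
  define Fs where "Fs = {b. \<forall>j. (j \<in> {..<k} \<longrightarrow> b j \<in> D) \<and> (j \<notin> {..<k} \<longrightarrow> b j = (0::'k))}"
  have finFs: "finite Fs" unfolding Fs_def by (rule finite_set_of_finite_funs) (auto simp: D)
  show thesis
  proof (rule that)
    show "finite {b \<in> Fs. sqn k b \<le> 4}" using finFs by simp
    show "sqn k b \<le> 4" if "b \<in> {b \<in> Fs. sqn k b \<le> 4}" for b using that by simp
    fix b :: "nat \<Rightarrow> 'k" assume b: "sqn k b \<le> 1"
    have "\<exists>d\<in>D. norm (b j - d) \<le> \<delta>" if "j < k" for j
    proof (rule D(2))
      have "(norm (b j))\<^sup>2 \<le> 1\<^sup>2" using norm_le_sqn[OF that, of b] b by simp
      then show "norm (b j) \<le> 1" by (rule power2_le_imp_le) simp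
    qed
    then obtain d where d: "\<And>j. j < k \<Longrightarrow> d j \<in> D \<and> norm (b j - d j) \<le> \<delta>" by metis
    define b' where "b' = (\<lambda>j. if j < k then d j else 0)"
    have "sqn k (\<lambda>j. b j - b' j) \<le> (\<Sum>j<k. \<delta>\<^sup>2)"
      unfolding sqn_def using d by (intro sum_mono power_mono) (auto simp: b'_def)
    also have "\<dots> = real k * \<delta>\<^sup>2" by simp
    also have "\<dots> \<le> (real k + 1) * ((real k + 1) * \<delta>\<^sup>2)"
      by (simp add: algebra_simps)
    also have "\<dots> = ((real k + 1) * \<delta>)\<^sup>2" by (simp add: power2_eq_square)
    also have "(real k + 1) * \<delta> = 1 / 2" unfolding \<delta>_def using of_nat_0_le_iff[of k] by (simp add: divide_simps)
    also have "(1 / 2 :: real)\<^sup>2 = 1 / 4" by (simp add: power2_eq_square)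
    finally have diff: "sqn k (\<lambda>j. b j - b' j) \<le> 1 / 4" .
    have "sqn k b' \<le> (\<Sum>j<k. 2 * (norm (b j))\<^sup>2 + 2 * (norm (b j - b' j))\<^sup>2)"
      unfolding sqn_def
    proof (rule sum_mono)
      fix j
      have "norm (b' j) \<le> norm (b j) + norm (b j - b' j)"
        using norm_triangle_ineq4[of "b j" "b j - b' j"] by simp
      then have "(norm (b' j))\<^sup>2 \<le> (norm (b j) + norm (b j - b' j))\<^sup>2" by (intro power_mono) auto
      also have "\<dots> \<le> 2 * (norm (b j))\<^sup>2 + 2 * (norm (b j - b' j))\<^sup>2"
        using sum_squares_bound[of "norm (b j)" "norm (b j - b' j)"] by (simp add: power2_sum)
      finally show "(norm (b' j))\<^sup>2 \<le> 2 * (norm (b j))\<^sup>2 + 2 * (norm (b j - b' j))\<^sup>2" .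
    qed
    also have "\<dots> = 2 * sqn k b + 2 * sqn k (\<lambda>j. b j - b' j)"
      by (simp add: sqn_def sum.distrib sum_distrib_left)
    also have "\<dots> \<le> 4" using b diff by linarith
    finally have "sqn k b' \<le> 4" .
    moreover have "b' \<in> Fs" using d by (auto simp: Fs_def b'_def)
    ultimately show "\<exists>b'\<in>{b \<in> Fs. sqn k b \<le> 4}. sqn k (\<lambda>j. b j - b' j) \<le> 1 / 4"
      using diff by blast
  qed
qed

text \<open>
  The Euclidean norm \<open>N\<close> of \<open>L\<close> is attained at some unit vector. The nearest point of the net
  misses it by at most \<open>1 / 2\<close> in norm, so \<open>N \<le> B + N / 2\<close>.
\<close>

lemma sqn_le_by_net:
  fixes L :: "nat \<Rightarrow> 'k::real_or_complex"
  assumes net: "\<And>b. sqn k b \<le> 1 \<Longrightarrow> \<exists>b'\<in>Net. sqn k (\<lambda>j. b j - b' j) \<le> 1 / 4"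
    and le: "\<And>b. b \<in> Net \<Longrightarrow> norm (\<Sum>j<k. b j * L j) \<le> B"
  shows "sqn k L \<le> (2 * B)\<^sup>2"
proof -
  define N where "N = sqrt (sqn k L)"
  have N0: "0 \<le> N" and N2: "N\<^sup>2 = sqn k L" by (simp_all add: N_def)
  define b where "b = (\<lambda>j. of_real (1 / N) * kcnj (L j))"
  have "sqn k b \<le> 1"
    unfolding b_def sqn_scale sqn_kcnj N2[symmetric] by (cases "N = 0") (auto simp: norm_divide power_divide)
  then obtain b' where b': "b' \<in> Net" "sqn k (\<lambda>j. b j - b' j) \<le> 1 / 4" using net by blast
  have "(\<Sum>j<k. b j * L j) = of_real (1 / N) * of_real (N\<^sup>2)"
    unfolding b_def N2 of_real_sqn sum_distrib_left by (simp add: mult_ac)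
  also have "\<dots> = of_real N" by (cases "N = 0") (auto simp: power2_eq_square)
  finally have "N = norm (\<Sum>j<k. b j * L j)" using N0 by simp
  also have "\<dots> = norm ((\<Sum>j<k. b' j * L j) + (\<Sum>j<k. (b j - b' j) * L j))"
    by (simp add: sum.distrib[symmetric] algebra_simps)
  also have "\<dots> \<le> norm (\<Sum>j<k. b' j * L j) + norm (\<Sum>j<k. (b j - b' j) * L j)"
    by (rule norm_triangle_ineq)
  also have "norm (\<Sum>j<k. b' j * L j) \<le> B" by (rule le[OF b'(1)])
  also have "norm (\<Sum>j<k. (b j - b' j) * L j) \<le> N / 2"
  proof (rule power2_le_imp_le)
    have "(norm (\<Sum>j<k. (b j - b' j) * L j))\<^sup>2 \<le> sqn k (\<lambda>j. b j - b' j) * sqn k L"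
      by (rule norm_pairing_le)
    also have "\<dots> \<le> 1 / 4 * sqn k L" by (intro mult_right_mono b') simp
    finally show "(norm (\<Sum>j<k. (b j - b' j) * L j))\<^sup>2 \<le> (N / 2)\<^sup>2" by (simp add: power_divide N2)
  qed (use N0 in simp)
  finally have "N \<le> 2 * B" by simp
  then have "N\<^sup>2 \<le> (2 * B)\<^sup>2" using N0 by (intro power_mono) auto
  then show ?thesis by (simp add: N2)
qed

lemma sqrt_sqn_add: "sqrt (sqn k (\<lambda>j. a j + b j)) \<le> sqrt (sqn k a) + sqrt (sqn k b)"
proof -
  have "L2_set (\<lambda>j. norm (a j + b j)) {..<k} \<le> L2_set (\<lambda>j. norm (a j) + norm (b j)) {..<k}"
    by (rule L2_set_mono) (auto intro: norm_triangle_ineq)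
  also have "\<dots> \<le> L2_set (\<lambda>j. norm (a j)) {..<k} + L2_set (\<lambda>j. norm (b j)) {..<k}"
    by (rule L2_set_triangle_ineq)
  finally show ?thesis by (simp add: L2_set_def sqn_def)
qed

lemma sqn_add_le: "sqn k (\<lambda>j. a j + b j) \<le> 2 * sqn k a + 2 * sqn k b"
proof -
  have "(norm (a j + b j))\<^sup>2 \<le> 2 * (norm (a j))\<^sup>2 + 2 * (norm (b j))\<^sup>2" for j
  proof -
    have "(norm (a j + b j))\<^sup>2 \<le> (norm (a j) + norm (b j))\<^sup>2"
      by (intro power_mono norm_triangle_ineq) simp
    also have "\<dots> \<le> 2 * (norm (a j))\<^sup>2 + 2 * (norm (b j))\<^sup>2"
      using sum_squares_bound[of "norm (a j)" "norm (b j)"] by (simp add: power2_sum)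
    finally show ?thesis .
  qed
  then have "sqn k (\<lambda>j. a j + b j) \<le> (\<Sum>j<k. 2 * (norm (a j))\<^sup>2 + 2 * (norm (b j))\<^sup>2)"
    unfolding sqn_def by (intro sum_mono)
  then show ?thesis by (simp add: sqn_def sum.distrib sum_distrib_left)
qed

lemma lincomb_lincomb:
  assumes "\<And>j. j < k \<Longrightarrow> h j = lincomb k' (\<beta> j) a"
  shows "lincomb k c h = lincomb k' (\<lambda>j'. \<Sum>j<k. c j * \<beta> j j') a"
proof
  fix i
  have "lincomb k c h i = (\<Sum>j<k. \<Sum>j'<k'. c j * \<beta> j j' * a j' i)"
    unfolding lincomb_def using assms
    by (intro sum.cong refl) (simp add: lincomb_def sum_distrib_left mult.assoc)
  also have "\<dots> = lincomb k' (\<lambda>j'. \<Sum>j<k. c j * \<beta> j j') a i"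
    by (subst sum.swap) (simp add: lincomb_def sum_distrib_right)
  finally show "lincomb k c h i = lincomb k' (\<lambda>j'. \<Sum>j<k. c j * \<beta> j j') a i" .
qed

context normed_space_over
begin

text \<open>
  Near orthonormality is required up to the factor \<open>1 / 2\<close> only, which leaves room for rounding
  the entries. They are bounded, so that the rounded vectors are finite in number.
\<close>

definition adapted_vectors ::
  "(nat \<Rightarrow> 'x \<Rightarrow> 'k) \<Rightarrow> real \<Rightarrow> nat \<Rightarrow> nat \<Rightarrow> 'x set \<Rightarrow> (nat \<Rightarrow> nat \<Rightarrow> 'k) \<Rightarrow> bool" where
  "adapted_vectors \<phi> B k m F a \<longleftrightarrow> (\<forall>j<k. \<forall>i<m. norm (a j i) \<le> 1) \<and>
     (\<forall>b. sqn k b / 2 \<le> sqn m (lincomb k b a)) \<and>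
     (\<forall>y\<in>F. sqn k (\<lambda>j. \<Sum>i<m. a j i * \<phi> i y) \<le> (B * norm y)\<^sup>2)"

text \<open>
  The measure with weights \<open>\<nu> = G\<^sup>q\<close> changes the density: with \<open>v = g / G\<close> one has \<open>\<bar>v\<bar> \<le> \<surd>m\<close>
  everywhere, and the \<open>\<ell>\<^sub>q\<close> norm of \<open>\<Sum> a\<^sub>i g\<^sub>i\<close> is the \<open>L\<^sub>q(\<nu>)\<close> norm of \<open>\<Sum> a\<^sub>i v\<^sub>i\<close>, for which a moment
  of order \<open>2 r \<ge> q\<close> is enough. The vectors \<open>a\<^sub>j\<close> are random sign combinations of a flat
  orthonormal family. The constant \<open>B\<close> does not depend on \<open>k\<close>, whereas \<open>m\<close> does.
\<close>

lemma frame_adapted_vectors: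
  fixes k r :: nat and p q K :: real
  assumes pq: "1 < p" "1 < q" "1 / p + 1 / q = 1" and r: "1 \<le> r" "p \<le> 2 * real r" "q \<le> 2 * real r"
    and K: "0 \<le> K"
  defines "\<kappa> \<equiv> (24 * K * (2 + (4 * real r + 1) ^ r)) powr q + 1"
  defines "B \<equiv> (2 * \<kappa> + \<kappa> * ((4 * real r + 1) * 8) ^ r + 1) powr (1 / q)"
  shows "\<exists>m. \<forall>\<phi> (I :: nat set) u. randomly_bounded m \<phi> \<longrightarrow> lp_frame p K I u \<longrightarrow>
      (\<exists>a. adapted_vectors \<phi> (2 * B) k m (range (\<lambda>c. combo I c u)) a)"
proof -
  have \<kappa>: "0 < \<kappa>" unfolding \<kappa>_def by (intro add_nonneg_pos) auto
  define c8 where "c8 = ((4 * real r + 1) * 8) ^ r"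
  have c8: "0 \<le> c8" by (simp add: c8_def)
  obtain Net :: "(nat \<Rightarrow> 'k) set" where Net: "finite Net" "\<And>b. b \<in> Net \<Longrightarrow> sqn k b \<le> 4"
    "\<And>b. sqn k b \<le> 1 \<Longrightarrow> \<exists>b'\<in>Net. sqn k (\<lambda>j. b j - b' j) \<le> 1 / 4"
    using finite_ball_net[where k = k and ?'k = 'k] by metis
  have "0 \<le> \<kappa>" "0 \<le> 2 * \<kappa>" using \<kappa> by auto
  from good_signs[where ?'s = nat, OF Net(1,2) this r(1)] obtain d0 where
    d0: "\<forall>d\<ge>d0. \<forall>(S::nat set) \<nu> (w :: nat \<Rightarrow> nat \<Rightarrow> 'k).
    (\<forall>s\<in>S. 0 \<le> \<nu> s) \<longrightarrow> (\<Sum>s\<in>S. \<nu> s) \<le> \<kappa> \<longrightarrow> (\<forall>s\<in>S. sqn d (w s) \<le> 2 * real d) \<longrightarrow>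
    (\<forall>a. (\<Sum>s\<in>S. \<nu> s * (norm (\<Sum>l<d. a l * w s l))\<^sup>2) \<le> 2 * \<kappa> * sqn d a) \<longrightarrow>
    (\<exists>e. controlled_signs Net k d r (\<kappa> * c8 + 1) S \<nu> w e)"
    unfolding c8_def by blast
  \<comment> \<open>Half of the dimensions may be lost to the flat family, and \<open>d0\<close> must remain.\<close>
  define m where "m = 2 * d0 + 1"
  show ?thesis
  proof (intro exI[of _ m] allI impI)
    fix \<phi> and I :: "nat set" and u
    assume rb: "randomly_bounded m \<phi>" and fr: "lp_frame p K I u"
    have lin: "linear_form (\<phi> i)" for i using rb by (simp add: randomly_bounded_def)
    define g where "g = (\<lambda>s i. \<phi> i (u s))"
    define G where "G = (\<lambda>s. sqrt (sqn m (g s) / m))"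
    define \<nu> where "\<nu> = (\<lambda>s. G s powr q)"
    \<comment> \<open>Where \<open>G s = 0\<close> also \<open>g s = 0\<close>, and division by zero gives the value \<open>0\<close> that is wanted.\<close>
    define v where "v = (\<lambda>s i. g s i / of_real (G s))"
    have m0: "0 < m" by (simp add: m_def)
    have G0: "0 \<le> G s" for s by (simp add: G_def)
    have sqg: "sqn m (g s) = m * (G s)\<^sup>2" for s using m0 by (simp add: G_def)
    have gv: "g s i = of_real (G s) * v s i" if "i < m" for s i
    proof (cases "G s = 0")
      case True
      then have "sqn m (g s) = 0" using sqg by simp
      then show ?thesis using that True by (simp add: sqn_eq_0_iff)
    qed (simp add: v_def)
    have vm: "sqn m (v s) \<le> m" for s
    proof -
      have "sqn m (v s) = sqn m (\<lambda>i. of_real (1 / G s) * g s i)" by (simp add: v_def)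
      then show ?thesis
        unfolding sqn_scale sqg by (cases "G s = 0") (auto simp: norm_divide power_divide)
    qed
    have \<nu>0: "0 \<le> \<nu> s" for s by (simp add: \<nu>_def)
    have \<nu>s: "(\<Sum>s\<in>I. \<nu> s) \<le> \<kappa>"
      using coefficient_square_function_bound[OF fr pq r(2) K rb]
      by (simp add: \<nu>_def G_def g_def \<kappa>_def)
    obtain d f where d: "m \<le> 2 * d" "d \<le> m" and f: "orthonormal m d f"
      and flat: "\<And>a. (\<Sum>s\<in>I. \<nu> s * (norm (\<Sum>i<m. lincomb d a f i * v s i))\<^sup>2) \<le> 2 * \<kappa> * sqn d a"
      using flat_orthonormal_family[of I \<nu> \<kappa> m v, OF \<nu>0 \<nu>s \<kappa> vm] by blast
    have d0': "d0 \<le> d" "0 < d" using d by (auto simp: m_def)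
    define w where "w = (\<lambda>s l. \<Sum>i<m. f l i * v s i)"
    have wd: "sqn d (w s) \<le> 2 * real d" for s
    proof -
      have "sqn d (w s) \<le> sqn m (v s)"
        unfolding sqn_def[of d] w_def by (rule bessel_inequality[OF f])
      also have "\<dots> \<le> m" by (rule vm)
      also have "\<dots> \<le> 2 * real d" using d by linarith
      finally show ?thesis .
    qed
    have form: "(\<Sum>s\<in>I. \<nu> s * (norm (\<Sum>l<d. a l * w s l))\<^sup>2) \<le> 2 * \<kappa> * sqn d a" for a
      using flat[of a] unfolding sum_lincomb w_def .
    obtain e where "controlled_signs Net k d r (\<kappa> * c8 + 1) I \<nu> w e"
      using d0[rule_format, OF d0'(1), of I \<nu> w] \<nu>0 \<nu>s wd form by blast
    then have e: "e \<in> signs ({..<k} \<times> {..<d})"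
      and low: "\<And>b::nat \<Rightarrow> 'k. sqn k b / 2 \<le> (\<Sum>l<d. (norm (\<Sum>j<k. e (j, l) *\<^sub>R b j))\<^sup>2) / d"
      and up: "\<And>b. b \<in> Net \<Longrightarrow> (\<Sum>s\<in>I. \<nu> s * norm (\<Sum>(j, l)\<in>{..<k} \<times> {..<d}. e (j, l) *\<^sub>R (b j * w s l / of_real (sqrt d))) ^ (2 * r))
          \<le> \<kappa> * c8 + 1"
      unfolding controlled_signs_def by blast+
    define \<beta> where "\<beta> = (\<lambda>j l. of_real (e (j, l) / sqrt d) :: 'k)"
    define a where "a = (\<lambda>j. lincomb d (\<beta> j) f)"
    have comb: "lincomb k b a = lincomb d (\<lambda>l. \<Sum>j<k. b j * \<beta> j l) f" for b
      by (rule lincomb_lincomb) (simp add: a_def)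
    have b\<beta>: "(\<Sum>j<k. b j * \<beta> j l) = (\<Sum>j<k. e (j, l) *\<^sub>R b j) / of_real (sqrt d)" for b l
      by (simp add: \<beta>_def sum_divide_distrib scaleR_conv_of_real mult.commute)
    have a_low: "sqn k b / 2 \<le> sqn m (lincomb k b a)" for b
    proof -
      have "sqn m (lincomb k b a) = sqn d (\<lambda>l. \<Sum>j<k. b j * \<beta> j l)"
        unfolding comb by (rule sqn_lincomb_orthonormal[OF f])
      also have "\<dots> = (\<Sum>l<d. (norm ((\<Sum>j<k. e (j, l) *\<^sub>R b j) / of_real (sqrt d)))\<^sup>2)"
        unfolding sqn_def b\<beta> ..
      also have "\<dots> = (\<Sum>l<d. (norm (\<Sum>j<k. e (j, l) *\<^sub>R b j))\<^sup>2) / d"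
        by (simp add: norm_divide power_divide sum_divide_distrib[symmetric])
      finally show ?thesis using low by simp
    qed
    have a_le: "norm (a j i) \<le> 1" if "j < k" "i < m" for j i
    proof -
      have "(norm (a j i))\<^sup>2 \<le> sqn m (a j)" by (rule norm_le_sqn[OF that(2)])
      also have "\<dots> = sqn d (\<beta> j)" unfolding a_def by (rule sqn_lincomb_orthonormal[OF f])
      also have "\<dots> = (\<Sum>l<d. 1 / real d)"
        unfolding sqn_def
      proof (rule sum.cong[OF refl])
        fix l assume "l \<in> {..<d}"
        then have "\<bar>e (j, l)\<bar> = 1" using signs_abs[OF e] that by auto
        then show "(norm (\<beta> j l))\<^sup>2 = 1 / real d"
          unfolding \<beta>_def norm_of_real by (simp add: power_divide)
      qed
      also have "\<dots> = 1\<^sup>2" using d0' by simp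
      finally show ?thesis by (rule power2_le_imp_le) simp
    qed
    have est: "norm (\<Sum>j<k. b j * (\<Sum>i<m. a j i * \<phi> i (combo I c u))) \<le> B * norm (combo I c u)"
      if b: "b \<in> Net" for b c
    proof -
      define W where "W = (\<lambda>s. \<Sum>i<m. lincomb k b a i * v s i)"
      have W: "W s = (\<Sum>(j, l)\<in>{..<k} \<times> {..<d}. e (j, l) *\<^sub>R (b j * w s l / of_real (sqrt d)))" for s
      proof -
        have "W s = (\<Sum>l<d. (\<Sum>j<k. b j * \<beta> j l) * w s l)"
          unfolding W_def comb sum_lincomb w_def ..
        also have "\<dots> = (\<Sum>j<k. \<Sum>l<d. b j * \<beta> j l * w s l)"
          unfolding sum_distrib_right by (rule sum.swap)
        also have "\<dots> = (\<Sum>j<k. \<Sum>l<d. e (j, l) *\<^sub>R (b j * w s l / of_real (sqrt d)))"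
          by (simp add: \<beta>_def scaleR_conv_of_real mult_ac)
        finally show ?thesis by (simp add: sum.cartesian_product)
      qed
      have "(\<Sum>j<k. b j * (\<Sum>i<m. a j i * \<phi> i (combo I c u))) = (\<Sum>i<m. lincomb k b a i * \<phi> i (combo I c u))"
        by (rule sum_lincomb[symmetric])
      also have "\<dots> = (\<Sum>i<m. \<Sum>s\<in>I. c s * (lincomb k b a i * g s i))"
        using lin by (simp add: linear_form_combo sum_distrib_left g_def mult_ac)
      also have "\<dots> = (\<Sum>s\<in>I. c s * (\<Sum>i<m. lincomb k b a i * g s i))"
        by (subst sum.swap) (simp add: sum_distrib_left)
      also have "\<dots> = (\<Sum>s\<in>I. c s * (of_real (G s) * W s))"
        unfolding W_def sum_distrib_left by (intro sum.cong refl) (simp add: gv mult_ac)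
      finally have "norm (\<Sum>j<k. b j * (\<Sum>i<m. a j i * \<phi> i (combo I c u))) = norm (\<Sum>s\<in>I. c s * (of_real (G s) * W s))"
        by simp
      also have "\<dots> \<le> (\<Sum>s\<in>I. norm (c s) * (G s * norm (W s)))"
        using G0 by (intro sum_norm_le) (simp add: norm_mult)
      also have "\<dots> \<le> lpn p I c * (\<Sum>s\<in>I. (G s * norm (W s)) powr q) powr (1 / q)"
        unfolding lpn_def using G0 by (intro holder_sum pq) auto
      also have "\<dots> \<le> norm (combo I c u) * B"
      proof (intro mult_mono)
        show "lpn p I c \<le> norm (combo I c u)" using fr by (simp add: lp_frame_def)
        have "(\<Sum>s\<in>I. (G s * norm (W s)) powr q) \<le> (\<Sum>s\<in>I. \<nu> s + \<nu> s * norm (W s) ^ (2 * r))"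
        proof (rule sum_mono)
          fix s
          have "(G s * norm (W s)) powr q = \<nu> s * norm (W s) powr q"
            using G0 by (simp add: \<nu>_def powr_mult)
          also have "\<dots> \<le> \<nu> s * (1 + norm (W s) ^ (2 * r))"
            using pq r by (intro mult_left_mono powr_le_1_plus_power \<nu>0) auto
          finally show "(G s * norm (W s)) powr q \<le> \<nu> s + \<nu> s * norm (W s) ^ (2 * r)"
            by (simp add: distrib_left)
        qed
        also have "\<dots> \<le> \<kappa> + (\<kappa> * c8 + 1)"
          unfolding sum.distrib using up[OF b] \<nu>s by (intro add_mono) (simp_all add: W)
        also have "\<dots> \<le> 2 * \<kappa> + \<kappa> * c8 + 1" using \<kappa> by simp
        finally show "(\<Sum>s\<in>I. (G s * norm (W s)) powr q) powr (1 / q) \<le> B"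
          unfolding B_def c8_def[symmetric] using pq by (intro powr_mono2 sum_nonneg) auto
      qed auto
      finally show ?thesis by (simp add: mult.commute)
    qed
    have "sqn k (\<lambda>j. \<Sum>i<m. a j i * \<phi> i (combo I c u)) \<le> (2 * (B * norm (combo I c u)))\<^sup>2" for c
      by (rule sqn_le_by_net[OF Net(3) est])
    then have "adapted_vectors \<phi> (2 * B) k m (range (\<lambda>c. combo I c u)) a"
      using a_le a_low by (auto simp: adapted_vectors_def mult.assoc)
    then show "\<exists>a. adapted_vectors \<phi> (2 * B) k m (range (\<lambda>c. combo I c u)) a"
      by (rule exI[of _ a])
  qed
qed

text \<open>
  If each of the finitely many rounded matrices failed at some vector, vectors adapted to this
  finite set of failures would, when rounded, not fail at theirs. The mesh \<open>\<delta>\<close> is so fine,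
  relative to the number of entries and to the norms of the \<open>\<phi>\<^sub>i\<close>, that rounding costs at most \<open>1\<close>
  in the upper bound and still leaves \<open>1 / 8\<close> in the lower one.
\<close>

lemma globally_adapted_vectors:
  fixes k m :: nat and \<phi> :: "nat \<Rightarrow> 'x \<Rightarrow> 'k"
  assumes B: "0 \<le> B"
    and \<phi>: "\<And>i y. i < m \<Longrightarrow> norm (\<phi> i y) \<le> \<Phi> * norm y" "0 \<le> \<Phi>"
    and loc: "\<And>F. finite F \<Longrightarrow> \<exists>a. adapted_vectors \<phi> B k m F a"
  shows "\<exists>a. (\<forall>b. 1 / 8 * sqn k b \<le> sqn m (lincomb k b a)) \<and>
        (\<forall>y. sqn k (\<lambda>j. \<Sum>i<m. a j i * \<phi> i y) \<le> ((B + 1) * norm y)\<^sup>2)"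
proof (rule ccontr)
  assume contra: "\<not> ?thesis"
  define \<delta> where "\<delta> = 1 / (8 * (real k + 1) * (real m + 1) * (\<Phi> + 1))"
  have \<delta>: "0 < \<delta>" using \<phi>(2) by (simp add: \<delta>_def)
  have \<delta>_eq: "8 * (real k + 1) * (real m + 1) * (\<Phi> + 1) * \<delta> = 1"
    unfolding \<delta>_def using \<phi>(2) by (simp add: add_nonneg_eq_0_iff)
  obtain D :: "'k set" where D: "finite D" "\<And>z. norm z \<le> 1 \<Longrightarrow> \<exists>d\<in>D. norm (z - d) \<le> \<delta>"
    using finite_scalar_net[OF \<delta>] by blast
  define Mat where "Mat = {c. \<forall>z. (z \<in> {..<k} \<times> {..<m} \<longrightarrow> c z \<in> D) \<and> (z \<notin> {..<k} \<times> {..<m} \<longrightarrow> c z = (0::'k))}"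
  have finMat: "finite Mat" unfolding Mat_def by (rule finite_set_of_finite_funs) (auto simp: D)
  define bad where "bad = (\<lambda>c y. \<not> sqn k (\<lambda>j. \<Sum>i<m. c (j, i) * \<phi> i y) \<le> ((B + 1) * norm y)\<^sup>2)"
  define F where "F = (\<lambda>c. SOME y. bad c y) ` Mat"
  have "finite F" using finMat by (simp add: F_def)
  from loc[OF this] obtain a where "adapted_vectors \<phi> B k m F a" ..
  then have a: "\<And>j i. j < k \<Longrightarrow> i < m \<Longrightarrow> norm (a j i) \<le> 1"
    "\<And>b. sqn k b / 2 \<le> sqn m (lincomb k b a)"
    "\<And>y. y \<in> F \<Longrightarrow> sqn k (\<lambda>j. \<Sum>i<m. a j i * \<phi> i y) \<le> (B * norm y)\<^sup>2"
    unfolding adapted_vectors_def by blast+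
  define R where "R = (\<lambda>j i. SOME d. d \<in> D \<and> norm (a j i - d) \<le> \<delta>)"
  have R: "R j i \<in> D \<and> norm (a j i - R j i) \<le> \<delta>" if ji: "j < k" "i < m" for j i
  proof -
    have "\<exists>d. d \<in> D \<and> norm (a j i - d) \<le> \<delta>" using D(2)[OF a(1)[OF ji]] by blast
    then show ?thesis unfolding R_def by (rule someI_ex)
  qed
  define c where "c = (\<lambda>(j, i). if j < k \<and> i < m then R j i else 0)"
  have cM: "c \<in> Mat" using R by (auto simp: Mat_def c_def)
  define a' where "a' = (\<lambda>j i. c (j, i))"
  have diff: "norm (a j i - a' j i) \<le> \<delta>" if "j < k" "i < m" for j i
    using R that by (simp add: a'_def c_def)
  have low: "1 / 8 * sqn k b \<le> sqn m (lincomb k b a')" for b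
  proof -
    define D' where "D' = (\<lambda>i. \<Sum>j<k. b j * (a j i - a' j i))"
    have "sqn m D' \<le> (\<Sum>i<m. sqn k b * (real k * \<delta>\<^sup>2))"
      unfolding sqn_def[of m]
    proof (rule sum_mono)
      fix i assume i: "i \<in> {..<m}"
      have "(norm (D' i))\<^sup>2 \<le> sqn k b * sqn k (\<lambda>j. a j i - a' j i)"
        unfolding D'_def by (rule norm_pairing_le)
      also have "sqn k (\<lambda>j. a j i - a' j i) \<le> (\<Sum>j<k. \<delta>\<^sup>2)"
        unfolding sqn_def using diff i by (intro sum_mono power_mono) auto
      finally show "(norm (D' i))\<^sup>2 \<le> sqn k b * (real k * \<delta>\<^sup>2)"
        by (simp add: mult_left_mono)
    qed
    also have "\<dots> = (real m * real k * \<delta>\<^sup>2) * sqn k b" by simp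
    also have "\<dots> \<le> 1 / 8 * sqn k b"
    proof (intro mult_right_mono)
      have d1: "(real k + 1) * (real m + 1) * \<delta> \<le> 1 / 8"
      proof -
        have "8 * ((real k + 1) * (real m + 1) * \<delta>) * 1 \<le> 8 * ((real k + 1) * (real m + 1) * \<delta>) * (\<Phi> + 1)"
          using \<delta> \<phi>(2) by (intro mult_left_mono) auto
        also have "\<dots> = 8 * (real k + 1) * (real m + 1) * (\<Phi> + 1) * \<delta>" by (simp only: mult_ac)
        also have "\<dots> = 1" by (rule \<delta>_eq)
        finally show ?thesis by simp
      qed
      have d2: "\<delta> \<le> (real k + 1) * (real m + 1) * \<delta>"
      proof -
        have "1 * 1 \<le> (real k + 1) * (real m + 1)" by (intro mult_mono) auto
        then show ?thesis using \<delta> by simp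
      qed
      have "real m * real k * \<delta>\<^sup>2 = (real k * real m * \<delta>) * \<delta>" by (simp add: power2_eq_square)
      also have "\<dots> \<le> ((real k + 1) * (real m + 1) * \<delta>) * \<delta>"
        using \<delta> by (intro mult_right_mono mult_mono) auto
      also have "\<dots> \<le> 1 / 8 * (1 / 8)"
        using order_trans[OF d2 d1] \<delta> by (intro mult_mono d1) auto
      finally show "real m * real k * \<delta>\<^sup>2 \<le> 1 / 8" by simp
    qed simp
    finally have D': "sqn m D' \<le> 1 / 8 * sqn k b" .
    have "lincomb k b a = (\<lambda>i. lincomb k b a' i + D' i)"
      by (simp add: lincomb_def D'_def fun_eq_iff sum.distrib[symmetric] algebra_simps)
    then have "sqn m (lincomb k b a) \<le> 2 * sqn m (lincomb k b a') + 2 * sqn m D'"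
      by (simp add: sqn_add_le)
    then show ?thesis using a(2)[of b] D' by linarith
  qed
  have "\<exists>y. bad c y"
    using contra low unfolding bad_def a'_def by blast
  then have badc: "bad c (SOME y. bad c y)" by (rule someI_ex)
  define y where "y = (SOME y. bad c y)"
  have yF: "y \<in> F" using cM by (auto simp: F_def y_def)
  let ?L = "\<lambda>a j. \<Sum>i<m. a j i * \<phi> i y"
  have "sqrt (sqn k (\<lambda>j. ?L a' j - ?L a j)) \<le> norm y"
  proof (rule real_le_lsqrt)
    have "sqn k (\<lambda>j. ?L a' j - ?L a j) \<le> (\<Sum>j<k. (real m * (\<delta> * (\<Phi> * norm y)))\<^sup>2)"
      unfolding sqn_def
    proof (intro sum_mono power_mono)
      fix j assume j: "j \<in> {..<k}"
      have "norm (?L a' j - ?L a j) = norm (\<Sum>i<m. (a' j i - a j i) * \<phi> i y)"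
        by (simp add: sum_subtractf left_diff_distrib)
      also have "\<dots> \<le> (\<Sum>i<m. \<delta> * (\<Phi> * norm y))"
        using diff[of j] j \<phi> \<delta>
        by (intro sum_norm_le) (auto simp: norm_mult norm_minus_commute intro!: mult_mono)
      finally show "norm (?L a' j - ?L a j) \<le> real m * (\<delta> * (\<Phi> * norm y))" by simp
    qed auto
    also have "\<dots> = real k * (real m * \<delta> * \<Phi>)\<^sup>2 * (norm y)\<^sup>2" by (simp add: power2_eq_square mult_ac)
    also have "\<dots> \<le> ((real k + 1) * (real m * \<delta> * \<Phi>))\<^sup>2 * (norm y)\<^sup>2"
    proof (intro mult_right_mono)
      have "real k \<le> (real k + 1)\<^sup>2" by (simp add: power2_eq_square algebra_simps)
      then show "real k * (real m * \<delta> * \<Phi>)\<^sup>2 \<le> ((real k + 1) * (real m * \<delta> * \<Phi>))\<^sup>2"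
        unfolding power_mult_distrib by (intro mult_right_mono) auto
    qed simp
    also have "\<dots> \<le> 1\<^sup>2 * (norm y)\<^sup>2"
    proof (intro mult_right_mono power_mono)
      have "(real k + 1) * (real m * \<delta> * \<Phi>) \<le> (real k + 1) * ((real m + 1) * \<delta> * (\<Phi> + 1))"
        using \<delta> \<phi>(2) by (intro mult_left_mono mult_mono) auto
      also have "\<dots> \<le> 8 * (real k + 1) * (real m + 1) * (\<Phi> + 1) * \<delta>"
        using \<delta> \<phi>(2) by (simp add: mult_ac)
      finally show "(real k + 1) * (real m * \<delta> * \<Phi>) \<le> 1" unfolding \<delta>_eq .
    qed (use \<delta> \<phi>(2) in auto)
    finally show "sqn k (\<lambda>j. ?L a' j - ?L a j) \<le> (norm y)\<^sup>2" by simp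
  qed auto
  moreover have "sqrt (sqn k (?L a)) \<le> B * norm y"
    using a(3)[OF yF] B by (intro real_le_lsqrt) auto
  moreover have "sqrt (sqn k (?L a')) \<le> sqrt (sqn k (?L a)) + sqrt (sqn k (\<lambda>j. ?L a' j - ?L a j))"
    using sqrt_sqn_add[of k "?L a" "\<lambda>j. ?L a' j - ?L a j"] by simp
  ultimately have "sqrt (sqn k (?L a')) \<le> (B + 1) * norm y" by (simp add: distrib_right)
  then have "sqn k (?L a') \<le> ((B + 1) * norm y)\<^sup>2" by (rule sqrt_le_D)
  moreover have "bad c y" unfolding y_def by (rule badc)
  ultimately show False unfolding bad_def a'_def by blast
qed

text \<open>
  Conjugates enter the \<open>X\<^sub>j\<close> but not the \<open>Q\<^sub>j\<close>, so that \<open>Q\<^sub>i(X\<^sub>j)\<close> is the inner product of \<open>h\<^sub>i\<close> and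
  \<open>h\<^sub>j\<close>. The bound for the \<open>Q\<^sub>j\<close> passes from the \<open>a\<^sub>j\<close> to the orthonormal \<open>h\<^sub>j\<close> in their span with the
  factor \<open>\<surd>8 < 3\<close>, because coefficients with respect to the \<open>a\<^sub>j\<close> are at most \<open>\<surd>8\<close> times as large.
\<close>

lemma orthonormal_system_to_biorthogonal:
  fixes \<phi> :: "nat \<Rightarrow> 'x \<Rightarrow> 'k" and h :: "nat \<Rightarrow> nat \<Rightarrow> 'k"
  assumes h: "orthonormal m k h" "\<And>j. j < k \<Longrightarrow> h j = lincomb k' (\<beta> j) a"
    and low: "\<And>b. 1 / 8 * sqn k' b \<le> sqn m (lincomb k' b a)"
    and up: "\<And>y. sqn k' (\<lambda>j. \<Sum>i<m. a j i * \<phi> i y) \<le> (B * norm y)\<^sup>2"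
    and x: "\<And>a. norm (\<Sum>i<m. scale (a i) (x i)) \<le> A * sqrt (sqn m a)"
    and bi: "\<And>i j. i < m \<Longrightarrow> j < m \<Longrightarrow> \<phi> i (x j) = (if i = j then 1 else 0)"
    and lin: "\<And>i. linear_form (\<phi> i)" and B: "0 \<le> B"
  defines "X \<equiv> (\<lambda>j. \<Sum>i<m. scale (kcnj (h j i)) (x i))"
    and "Q \<equiv> (\<lambda>j y. \<Sum>i<m. h j i * \<phi> i y)"
  shows "\<And>j. linear_form (Q j)"
    and "\<And>i j. i < k \<Longrightarrow> j < k \<Longrightarrow> Q i (X j) = (if i = j then 1 else 0)"
    and "\<And>c. norm (\<Sum>j<k. scale (c j) (X j)) \<le> A * sqrt (sqn k c)"
    and "\<And>y. sqrt (sqn k (\<lambda>j. Q j y)) \<le> 3 * B * norm y"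
proof -
  show "linear_form (Q j)" for j
    using lin unfolding Q_def linear_form_def
    by (simp add: distrib_left sum.distrib sum_distrib_left mult.left_commute)
  show "Q i (X j) = (if i = j then 1 else 0)" if "i < k" "j < k" for i j
  proof -
    have "\<phi> l (X j) = kcnj (h j l)" if "l < m" for l
    proof -
      have "\<phi> l (X j) = (\<Sum>i<m. kcnj (h j i) * \<phi> l (x i))"
        using linear_form_combo[OF lin[of l], of "{..<m}" "\<lambda>i. kcnj (h j i)" x] by (simp add: X_def combo_def)
      also have "\<dots> = (\<Sum>i<m. if i = l then kcnj (h j i) else 0)"
        using bi that by (intro sum.cong) auto
      finally show ?thesis using that by simp
    qed
    then have "Q i (X j) = (\<Sum>l<m. h i l * kcnj (h j l))" by (simp add: Q_def)
    then show ?thesis using h(1) that by (simp add: orthonormal_def)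
  qed
  show "norm (\<Sum>j<k. scale (c j) (X j)) \<le> A * sqrt (sqn k c)" for c
  proof -
    have "(\<Sum>j<k. scale (c j) (X j)) = (\<Sum>i<m. scale (\<Sum>j<k. c j * kcnj (h j i)) (x i))"
      unfolding X_def scale_sum_right scale_sum_left by (subst sum.swap) simp
    also have "norm \<dots> \<le> A * sqrt (sqn m (\<lambda>i. \<Sum>j<k. c j * kcnj (h j i)))" by (rule x)
    also have "sqn m (\<lambda>i. \<Sum>j<k. c j * kcnj (h j i)) = sqn m (\<lambda>i. kcnj (lincomb k (\<lambda>j. kcnj (c j)) h i))"
      by (simp add: lincomb_def kcnj_sum kcnj_mult)
    also have "\<dots> = sqn k c" unfolding sqn_kcnj sqn_lincomb_orthonormal[OF h(1)] sqn_kcnj ..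
    finally show ?thesis .
  qed
  show "sqrt (sqn k (\<lambda>j. Q j y)) \<le> 3 * B * norm y" for y
  proof (rule real_le_lsqrt)
    have "sqn k (\<lambda>j. Q j y) \<le> 8 * (B * norm y)\<^sup>2"
      unfolding sqn_def
    proof (rule square_sum_le_by_duality)
      fix c
      let ?b = "\<lambda>j'. \<Sum>j<k. c j * \<beta> j j'"
      have comb: "lincomb k c h = lincomb k' ?b a" by (rule lincomb_lincomb[OF h(2)])
      have "(\<Sum>j<k. c j * Q j y) = (\<Sum>i<m. lincomb k c h i * \<phi> i y)"
        unfolding Q_def by (rule sum_lincomb[symmetric])
      also have "\<dots> = (\<Sum>j<k'. ?b j * (\<Sum>i<m. a j i * \<phi> i y))"
        unfolding comb by (rule sum_lincomb)
      finally have "(norm (\<Sum>j<k. c j * Q j y))\<^sup>2 \<le> sqn k' ?b * sqn k' (\<lambda>j. \<Sum>i<m. a j i * \<phi> i y)"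
        by (simp only: norm_pairing_le)
      also have "\<dots> \<le> (8 * sqn k c) * (B * norm y)\<^sup>2"
      proof (intro mult_mono up)
        have "sqn m (lincomb k c h) = sqn k c" by (rule sqn_lincomb_orthonormal[OF h(1)])
        then show "sqn k' ?b \<le> 8 * sqn k c" using low[of ?b] unfolding comb by simp
      qed auto
      finally show "(norm (\<Sum>j<k. c j * Q j y))\<^sup>2 \<le> 8 * (B * norm y)\<^sup>2 * (\<Sum>j<k. (norm (c j))\<^sup>2)"
        by (simp add: sqn_def mult_ac)
    qed simp
    also have "\<dots> \<le> (3 * B * norm y)\<^sup>2" by (simp add: power_mult_distrib)
    finally show "sqn k (\<lambda>j. Q j y) \<le> (3 * B * norm y)\<^sup>2" .
  qed (use B in auto)
qed

section \<open>Uniformly complemented Hilbert spaces\<close>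

text \<open>
  Copies of \<open>\<ell>\<^sub>2\<^sup>k\<close> with basis \<open>X\<^sub>j\<close> and projection \<open>z \<mapsto> \<Sum>\<^sub>j Q\<^sub>j(z) X\<^sub>j\<close>, uniformly in \<open>k\<close>, in the
  kernel of given functionals \<open>\<psi>\<^sub>t\<close> and with projections that annihilate given vectors \<open>y\<^sub>t\<close>. The
  constant is independent of the number of these constraints.
\<close>

definition complemented_hilbert_copies :: "real \<Rightarrow> bool" where
  "complemented_hilbert_copies A \<longleftrightarrow> 0 \<le> A \<and> (\<forall>k (T::nat) \<psi> y. (\<forall>t<T. linear_form (\<psi> t)) \<longrightarrow>
    (\<exists>X Q. (\<forall>j. linear_form (Q j)) \<and>
      (\<forall>i<k. \<forall>j<k. Q i (X j) = (if i = j then 1 else 0)) \<and>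
      (\<forall>c. norm (\<Sum>j<k. scale (c j) (X j)) \<le> A * sqrt (sqn k c)) \<and>
      (\<forall>z. sqrt (sqn k (\<lambda>j. Q j z)) \<le> A * norm z) \<and>
      (\<forall>j<k. \<forall>t<T. \<psi> t (X j) = 0) \<and> (\<forall>j<k. \<forall>t<T. Q j (y t) = 0)))"

text \<open>
  The \<open>2 T\<close> constraints are met by choosing \<open>k\<close> orthonormal vectors in the span of \<open>k + 2 T\<close>
  globally adapted ones.
\<close>

theorem uniformly_complemented_hilbert_spaces:
  assumes "script_Lp_space p" "1 < p" "\<not> finite_dimensional UNIV"
  shows "\<exists>A. complemented_hilbert_copies A"
proof -
  obtain K where K: "1 \<le> K" and frames: "\<And>F. finite F \<Longrightarrow> \<exists>n u. lp_frame p K {..<n::nat} u \<and>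
      F \<subseteq> range (\<lambda>a. combo {..<n} a u) \<and> (independent F \<longrightarrow> card F \<le> n)"
    using script_Lp_frames[OF assms(1,2)] by blast
  have K0: "0 \<le> K" using K by simp
  define q where "q = p / (p - 1)"
  have pq: "1 < p" "1 < q" "1 / p + 1 / q = 1"
    using assms(2) by (auto simp: q_def field_simps)
  define r where "r = Suc (nat \<lceil>p\<rceil> + nat \<lceil>q\<rceil>)"
  have r: "1 \<le> r" "p \<le> 2 * real r" "q \<le> 2 * real r"
    unfolding r_def using real_nat_ceiling_ge[of p] real_nat_ceiling_ge[of q] by auto
  define B where "B = (2 * ((24 * K * (2 + (4 * real r + 1) ^ r)) powr q + 1) +
    ((24 * K * (2 + (4 * real r + 1) ^ r)) powr q + 1) * ((4 * real r + 1) * 8) ^ r + 1) powr (1 / q)"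
  have B0: "0 \<le> B" by (simp add: B_def)
  define A1 where "A1 = K * (1 + (4 * real r + 1) ^ r) powr (1 / p)"
  have A1: "0 \<le> A1" using K0 by (simp add: A1_def)
  define A where "A = max A1 (3 * (2 * B + 1))"
  show ?thesis
    unfolding complemented_hilbert_copies_def
  proof (intro exI[of _ A] conjI allI impI)
    show "0 \<le> A" using A1 by (simp add: A_def)
    fix k T :: nat and \<psi> :: "nat \<Rightarrow> 'x \<Rightarrow> 'k" and y :: "nat \<Rightarrow> 'x"
    assume \<psi>: "\<forall>t<T. linear_form (\<psi> t)"
    define k' where "k' = k + 2 * T"
    from frame_adapted_vectors[OF pq r K0, of k'] obtain m where m:
      "\<forall>\<phi> (I :: nat set) u. randomly_bounded m \<phi> \<longrightarrow> lp_frame p K I u \<longrightarrow>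
      (\<exists>a. adapted_vectors \<phi> (2 * B) k' m (range (\<lambda>c. combo I c u)) a)"
      unfolding B_def[symmetric] by blast
    obtain u where u: "lp_frame p K (signs {..<m}) u"
      using large_frame[OF frames assms(3), of "signs {..<m}"] by auto
    obtain x \<phi> where rb: "randomly_bounded m \<phi>"
      and bi: "\<forall>i<m. \<forall>j<m. \<phi> i (x j) = (if i = j then 1 else 0)"
      and x: "\<forall>a. norm (\<Sum>i<m. scale (a i) (x i)) \<le> K * (1 + (4 * real r + 1) ^ r) powr (1 / p) * sqrt (sqn m a)"
      using randomized_biorthogonal_system[OF u pq r(2) K0] by (elim exE conjE)
    have lin: "linear_form (\<phi> i)" for i using rb by (simp add: randomly_bounded_def)
    have \<phi>b: "norm (\<phi> i z) \<le> 24 * sqrt m * norm z" if i: "i < m" for i z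
    proof -
      have "(\<Sum>l<m. \<phi> l (if l = i then z else 0)) = (\<Sum>l<m. if l = i then \<phi> i z else 0)"
        using linear_form_zero[OF lin] by (intro sum.cong) auto
      then have "(\<Sum>l<m. \<phi> l (if l = i then z else 0)) = \<phi> i z" using i by simp
      then show ?thesis
        using rb[unfolded randomly_bounded_def, THEN conjunct2, rule_format, of "\<lambda>l. if l = i then z else 0"]
          randomized_norm_single[OF i, of z] by simp
    qed
    have loc: "\<exists>a. adapted_vectors \<phi> (2 * B) k' m F a" if F: "finite F" for F
    proof -
      obtain n u where nu: "lp_frame p K {..<n::nat} u" "F \<subseteq> range (\<lambda>a. combo {..<n} a u)"
        using frames[OF F] by blast
      show ?thesis using m[rule_format, OF rb nu(1)] nu(2) unfolding adapted_vectors_def by blast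
    qed
    obtain a where low: "\<forall>b. 1 / 8 * sqn k' b \<le> sqn m (lincomb k' b a)"
      and up: "\<forall>y. sqn k' (\<lambda>j. \<Sum>i<m. a j i * \<phi> i y) \<le> ((2 * B + 1) * norm y)\<^sup>2"
      using globally_adapted_vectors[OF _ \<phi>b _ loc] B0 by fastforce
    define c where "c = (\<lambda>t i. if t < T then kcnj (\<psi> t (x i)) else \<phi> i (y (t - T)))"
    obtain h \<beta> where h: "orthonormal m k h" "\<forall>j<k. h j = lincomb k' (\<beta> j) a"
      and hc: "\<forall>j<k. \<forall>t<2 * T. (\<Sum>i<m. h j i * c t i) = 0"
      using orthonormal_in_span[of "1 / 8" k' m a k "2 * T" c] low by (auto simp: k'_def)
    define X where "X = (\<lambda>j. \<Sum>i<m. scale (kcnj (h j i)) (x i))"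
    define Q where "Q = (\<lambda>j y. \<Sum>i<m. h j i * \<phi> i y)"
    note sys = orthonormal_system_to_biorthogonal[OF h(1) h(2)[rule_format] low[rule_format] up[rule_format]
        x[rule_format, folded A1_def] bi[rule_format] lin]
    have \<psi>X: "\<psi> t (X j) = 0" if "j < k" "t < T" for j t
    proof -
      have "\<psi> t (X j) = (\<Sum>i<m. kcnj (h j i) * \<psi> t (x i))"
        using linear_form_combo[of "\<psi> t" "{..<m}" "\<lambda>i. kcnj (h j i)" x] \<psi> that by (simp add: X_def combo_def)
      also have "\<dots> = kcnj (\<Sum>i<m. h j i * c t i)"
        using that by (simp add: kcnj_sum kcnj_mult c_def)
      also have "\<dots> = 0" using hc that by simp
      finally show ?thesis .
    qed
    have Qy: "Q j (y t) = 0" if "j < k" "t < T" for j t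
      using hc[rule_format, of j "T + t"] that by (simp add: c_def Q_def)
    show "\<exists>X Q. (\<forall>j. linear_form (Q j)) \<and>
      (\<forall>i<k. \<forall>j<k. Q i (X j) = (if i = j then 1 else 0)) \<and>
      (\<forall>c. norm (\<Sum>j<k. scale (c j) (X j)) \<le> A * sqrt (sqn k c)) \<and>
      (\<forall>z. sqrt (sqn k (\<lambda>j. Q j z)) \<le> A * norm z) \<and>
      (\<forall>j<k. \<forall>t<T. \<psi> t (X j) = 0) \<and> (\<forall>j<k. \<forall>t<T. Q j (y t) = 0)"
    proof (intro exI[of _ X] exI[of _ Q] conjI allI impI)
      show "linear_form (Q j)" for j unfolding Q_def by (rule sys(1)) (use B0 in auto)
      show "Q i (X j) = (if i = j then 1 else 0)" if "i < k" "j < k" for i j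
        unfolding Q_def X_def by (rule sys(2)) (use B0 that in auto)
      have "norm (\<Sum>j<k. scale (c j) (X j)) \<le> A1 * sqrt (sqn k c)" for c
        unfolding X_def by (rule sys(3)) (use B0 in auto)
      then show "norm (\<Sum>j<k. scale (c j) (X j)) \<le> A * sqrt (sqn k c)" for c
        by (rule order_trans) (auto simp: A_def intro: mult_right_mono)
      have "sqrt (sqn k (\<lambda>j. Q j z)) \<le> 3 * (2 * B + 1) * norm z" for z
        unfolding Q_def by (rule sys(4)) (use B0 in auto)
      then show "sqrt (sqn k (\<lambda>j. Q j z)) \<le> A * norm z" for z
        by (rule order_trans) (auto simp: A_def intro: mult_right_mono)
    qed (use \<psi>X Qy in auto)
  qed
qed

end

section \<open>Compact operators on \<open>\<ell>\<^sub>2\<close>\<close>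

lift_definition unit_ell2 :: "nat \<Rightarrow> 'k::real_or_complex ell2" is "\<lambda>i j. if j = i then 1 else 0"
  by (rule summable_finite[of "{_}"]) auto

definition finite_part :: "nat set \<Rightarrow> (nat \<Rightarrow> 'k) \<Rightarrow> 'k::real_or_complex ell2" where
  "finite_part I c = (\<Sum>i\<in>I. ell2_scale (c i) (unit_ell2 i))"

lemma coord_zero [simp]: "coord 0 i = 0" by transfer simp
lemma coord_add: "coord (x + y) i = coord x i + coord y i" by transfer simp
lemma coord_diff: "coord (x - y) i = coord x i - coord y i" by transfer simp
lemma coord_scale: "coord (ell2_scale c x) i = c * coord x i" by transfer simp
lemma coord_unit: "coord (unit_ell2 i) j = (if j = i then 1 else 0)" by transfer simp

lemma coord_sum: "coord (\<Sum>i\<in>I. f i) j = (\<Sum>i\<in>I. coord (f i) j)"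
  by (induction I rule: infinite_finite_induct) (auto simp: coord_add)

lemma coord_finite_part: "finite I \<Longrightarrow> coord (finite_part I c) j = (if j \<in> I then c j else 0)"
  by (simp add: finite_part_def coord_sum coord_scale coord_unit if_distrib cong: if_cong)

lemma ell2_summable: "summable (\<lambda>i. (norm (coord x i))\<^sup>2)"
  by transfer

lemma norm_ell2_square: "(norm x)\<^sup>2 = (\<Sum>i. (norm (coord x i))\<^sup>2)"
  unfolding norm_ell2.rep_eq by (intro real_sqrt_pow2 suminf_nonneg ell2_summable) auto

lemma norm_finite_part: "finite I \<Longrightarrow> (norm (finite_part I c))\<^sup>2 = (\<Sum>i\<in>I. (norm (c i))\<^sup>2)"
  unfolding norm_ell2_square by (subst suminf_finite[of I]) (auto simp: coord_finite_part)

lemma sum_coord_le: "finite I \<Longrightarrow> (\<Sum>i\<in>I. (norm (coord x i))\<^sup>2) \<le> (norm x)\<^sup>2"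
  unfolding norm_ell2_square by (intro sum_le_suminf ell2_summable) auto

lemma norm_add_disjoint:
  assumes "\<And>i. coord x i = 0 \<or> coord y i = 0"
  shows "(norm (x + y))\<^sup>2 = (norm x)\<^sup>2 + (norm y)\<^sup>2"
proof -
  have "(norm (coord (x + y) i))\<^sup>2 = (norm (coord x i))\<^sup>2 + (norm (coord y i))\<^sup>2" for i
    using assms[of i] by (auto simp: coord_add)
  then show ?thesis
    unfolding norm_ell2_square by (simp add: suminf_add[OF ell2_summable ell2_summable])
qed

lemma finite_part_tendsto: "(\<lambda>n. finite_part {..<n} (coord x)) \<longlonglongrightarrow> x"
proof -
  have "(norm (finite_part {..<n} (coord x) - x))\<^sup>2 = (norm x)\<^sup>2 - (\<Sum>i<n. (norm (coord x i))\<^sup>2)" for n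
  proof -
    let ?f = "finite_part {..<n} (coord x)"
    have "x = ?f + (x - ?f)" by simp
    then have "(norm x)\<^sup>2 = (norm ?f)\<^sup>2 + (norm (x - ?f))\<^sup>2"
      by (metis (no_types, lifting) norm_add_disjoint coord_diff coord_finite_part finite_lessThan eq_iff_diff_eq_0)
    then show ?thesis by (simp add: norm_finite_part norm_minus_commute)
  qed
  moreover have "(\<lambda>n. (norm x)\<^sup>2 - (\<Sum>i<n. (norm (coord x i))\<^sup>2)) \<longlonglongrightarrow> (norm x)\<^sup>2 - (norm x)\<^sup>2"
    unfolding norm_ell2_square by (intro tendsto_intros summable_LIMSEQ ell2_summable)
  ultimately have "(\<lambda>n. (norm (finite_part {..<n} (coord x) - x))\<^sup>2) \<longlonglongrightarrow> 0" by simp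
  then have "(\<lambda>n. sqrt ((norm (finite_part {..<n} (coord x) - x))\<^sup>2)) \<longlonglongrightarrow> sqrt 0"
    by (rule tendsto_real_sqrt)
  then have "(\<lambda>n. norm (finite_part {..<n} (coord x) - x)) \<longlonglongrightarrow> 0" by simp
  then show ?thesis by (simp add: LIM_zero_iff tendsto_norm_zero_iff)
qed

lemma bounded_operator_bound:
  assumes "bounded_operator s1 s2 T"
  obtains C where "0 \<le> C" "\<And>x. norm (T x) \<le> C * norm x"
proof -
  obtain C where C: "\<And>x. norm (T x) \<le> C * norm x" using assms unfolding bounded_operator_def by blast
  have "norm (T x) \<le> max 0 C * norm x" for x
    by (rule order_trans[OF C]) (intro mult_right_mono, auto)
  then show ?thesis using that[of "max 0 C"] by simp
qed

text \<open>
  Otherwise there are finitely supported vectors in the unit ball with consecutive disjoint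
  supports on which \<open>T\<close> has norm at least \<open>\<epsilon> / 2\<close>, and by compactness the images of a subsequence
  converge to some \<open>y \<noteq> 0\<close>. A sum of \<open>m\<close> of them has norm at most \<open>\<surd>m\<close>, but its image is close to
  \<open>m y\<close>, which contradicts the boundedness of \<open>T\<close> for large \<open>m\<close>.
\<close>

lemma compact_operator_tail:
  fixes T :: "'k::real_or_complex ell2 \<Rightarrow> 'k ell2"
  assumes T: "compact_operator ell2_scale ell2_scale T" and \<epsilon>: "0 < \<epsilon>"
  shows "\<exists>n. \<forall>x. (\<forall>i<n. coord x i = 0) \<longrightarrow> norm (T x) \<le> \<epsilon> * norm x"
proof (rule ccontr)
  assume contra: "\<not> ?thesis"
  have bT: "bounded_operator ell2_scale ell2_scale T" and cT: "compact (closure (T ` cball 0 1))"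
    using T by (auto simp: compact_operator_def)
  obtain C where C: "0 \<le> C" "\<And>x. norm (T x) \<le> C * norm x"
    using bounded_operator_bound[OF bT] by blast
  interpret E: normed_space_over "ell2_scale :: 'k \<Rightarrow> 'k ell2 \<Rightarrow> 'k ell2" by (rule normed_space_over_ell2)
  have lin: "Vector_Spaces.linear ell2_scale ell2_scale T" using bT by (simp add: bounded_operator_def)
  interpret T: Vector_Spaces.linear ell2_scale ell2_scale T by (rule lin)
  have "\<exists>u N. (\<forall>i<n. coord u i = 0) \<and> (\<forall>i\<ge>N. coord u i = 0) \<and> n \<le> N \<and> norm u \<le> 1 \<and> \<epsilon> / 2 \<le> norm (T u)" for n
  proof -
    obtain x where x: "\<forall>i<n. coord x i = 0" "\<epsilon> * norm x < norm (T x)"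
      using contra by (metis not_le)
    have nx: "0 < norm x" using x(2) T.zero by (cases "x = 0") auto
    define x' where "x' = ell2_scale (of_real (1 / norm x)) x"
    have x': "norm x' = 1" "\<epsilon> < norm (T x')" "\<forall>i<n. coord x' i = 0"
      using nx x by (auto simp: x'_def E.norm_scale T.scale norm_divide coord_scale field_simps)
    have "(\<lambda>N. norm (finite_part {..<N} (coord x') - x')) \<longlonglongrightarrow> 0"
      using finite_part_tendsto[of x'] by (simp add: LIM_zero_iff tendsto_norm_zero_iff)
    moreover have "0 < \<epsilon> / (2 * (C + 1))" using \<epsilon> C by simp
    ultimately have "\<forall>\<^sub>F N in sequentially. norm (finite_part {..<N} (coord x') - x') < \<epsilon> / (2 * (C + 1))"
      by (rule order_tendstoD)
    then obtain N where N: "n \<le> N" "norm (finite_part {..<N} (coord x') - x') < \<epsilon> / (2 * (C + 1))"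
      unfolding eventually_sequentially by (metis nat_le_linear)
    define u where "u = finite_part {..<N} (coord x')"
    have "(norm u)\<^sup>2 \<le> 1\<^sup>2"
      unfolding u_def norm_finite_part[OF finite_lessThan] using sum_coord_le[of "{..<N}" x'] x' by simp
    then have u1: "norm u \<le> 1" by (rule power2_le_imp_le) simp
    have "norm (T x') \<le> norm (T u) + norm (T (u - x'))"
      unfolding T.diff using norm_triangle_ineq4[of "T u" "T u - T x'"] by simp
    also have "norm (T (u - x')) \<le> C * norm (u - x')" by (rule C)
    also have "\<dots> \<le> (C + 1) * (\<epsilon> / (2 * (C + 1)))"
      using N(2) C(1) by (intro mult_mono) (auto simp: u_def)
    also have "\<dots> = \<epsilon> / 2" using C(1) by (simp add: field_simps)
    finally have "\<epsilon> / 2 \<le> norm (T u)" using x'(2) by simp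
    then show ?thesis
      using u1 N(1) x'(3) by (intro exI[of _ u] exI[of _ N]) (auto simp: u_def coord_finite_part)
  qed
  then obtain U N where U: "\<And>n i. i < n \<Longrightarrow> coord (U n) i = 0" "\<And>n i. N n \<le> i \<Longrightarrow> coord (U n) i = 0"
    "\<And>n. n \<le> N n" "\<And>n. norm (U n) \<le> 1" "\<And>n. \<epsilon> / 2 \<le> norm (T (U n))"
    by metis
  \<comment> \<open>The vector \<open>U n\<close> is supported in \<open>n..<N n\<close>, so the supports along the iterates of \<open>N\<close> are
    disjoint.\<close>
  define s where "s = rec_nat 0 (\<lambda>_. N)"
  have s: "s (Suc j) = N (s j)" for j by (simp add: s_def)
  have smono: "mono s" by (rule mono_iff_le_Suc[THEN iffD2]) (simp add: s U(3))
  have "\<forall>j. T (U (s j)) \<in> closure (T ` cball 0 1)"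
    using U(4) closure_subset[of "T ` cball 0 1"] by (auto simp: image_subset_iff)
  then obtain y \<rho> where \<rho>: "strict_mono \<rho>" and "((\<lambda>j. T (U (s j))) \<circ> \<rho>) \<longlonglongrightarrow> y"
    using cT[unfolded compact_def, rule_format, of "\<lambda>j. T (U (s j))"] by blast
  then have lim: "(\<lambda>j. T (U (s (\<rho> j)))) \<longlonglongrightarrow> y" by (simp add: o_def)
  have "\<epsilon> / 2 \<le> norm y"
    using tendsto_norm[OF lim] by (rule tendsto_lowerbound) (intro always_eventually allI U(5), simp)
  obtain J where J: "\<And>j. J \<le> j \<Longrightarrow> norm (T (U (s (\<rho> j))) - y) \<le> \<epsilon> / 4"
    using LIMSEQ_D[OF lim, of "\<epsilon> / 4"] \<epsilon> by (auto intro: less_imp_le)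
  define a where "a = (\<lambda>j. U (s (\<rho> (J + j))))"
  have sep: "s (Suc (\<rho> j)) \<le> s (\<rho> (Suc j))" for j
    using \<rho> by (intro monoD[OF smono]) (simp add: strict_mono_Suc_iff Suc_leI)
  have w: "(norm (\<Sum>j<m. a j))\<^sup>2 \<le> real m \<and> (\<forall>i\<ge>s (\<rho> (J + m)). coord (\<Sum>j<m. a j) i = 0)" for m
  proof (induction m)
    case (Suc m)
    have supp: "coord (a m) i = 0" if "s (\<rho> (J + Suc m)) \<le> i" for i
      unfolding a_def using that sep[of "J + m"] by (intro U(2)) (simp add: s)
    have "coord (\<Sum>j<m. a j) i = 0 \<or> coord (a m) i = 0" for i
      using Suc U(1)[of i "s (\<rho> (J + m))"] by (cases "i < s (\<rho> (J + m))") (auto simp: a_def)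
    then have "(norm (\<Sum>j<Suc m. a j))\<^sup>2 = (norm (\<Sum>j<m. a j))\<^sup>2 + (norm (a m))\<^sup>2"
      by (simp add: norm_add_disjoint)
    moreover have "(norm (a m))\<^sup>2 \<le> 1" using U(4) by (simp add: a_def power_le_one)
    moreover have "s (\<rho> (J + m)) \<le> s (\<rho> (J + Suc m))"
      using \<rho> by (intro monoD[OF smono]) (simp add: strict_mono_less_eq)
    ultimately show ?case using Suc supp by (auto simp: coord_add)
  qed simp
  have "real m * (\<epsilon> / 4) \<le> C * sqrt m" for m
  proof -
    have "norm (T (\<Sum>j<m. a j)) \<le> C * norm (\<Sum>j<m. a j)" by (rule C)
    also have "\<dots> \<le> C * sqrt m" using w[of m] C(1) by (intro mult_left_mono real_le_rsqrt) auto
    finally have up: "norm (\<Sum>j<m. T (a j)) \<le> C * sqrt m" by (simp add: T.sum)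
    have "norm ((\<Sum>j<m. T (a j)) - real m *\<^sub>R y) = norm (\<Sum>j<m. T (a j) - y)"
      by (simp add: sum_subtractf scaleR_conv_of_real[symmetric] sum_constant_scaleR)
    also have "\<dots> \<le> (\<Sum>j<m. \<epsilon> / 4)"
      unfolding a_def by (intro sum_norm_le J) simp
    finally have dev: "norm ((\<Sum>j<m. T (a j)) - real m *\<^sub>R y) \<le> real m * (\<epsilon> / 4)" by simp
    have "real m * (\<epsilon> / 2) \<le> real m * norm y"
      using \<open>\<epsilon> / 2 \<le> norm y\<close> by (intro mult_left_mono) auto
    also have "\<dots> = norm (real m *\<^sub>R y)" by simp
    also have "\<dots> \<le> norm (\<Sum>j<m. T (a j)) + norm ((\<Sum>j<m. T (a j)) - real m *\<^sub>R y)"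
      using norm_triangle_ineq4[of "\<Sum>j<m. T (a j)" "(\<Sum>j<m. T (a j)) - real m *\<^sub>R y"] by simp
    finally show ?thesis using up dev by (simp add: field_simps)
  qed
  note bound = this
  obtain m :: nat where m: "(4 * C / \<epsilon>)\<^sup>2 < real m" using reals_Archimedean2 by blast
  then have m0: "0 < real m" by (meson le_less_trans zero_le_power2)
  have "sqrt m * (sqrt m * (\<epsilon> / 4)) = real m * (\<epsilon> / 4)"
    by (simp only: mult.assoc[symmetric] real_sqrt_mult_self abs_of_nat)
  then have "sqrt m * (sqrt m * (\<epsilon> / 4)) \<le> sqrt m * C"
    using bound[of m] by (simp only: mult.commute[of C])
  then have "sqrt m * (\<epsilon> / 4) \<le> C" using m0 by (simp only: mult_le_cancel_left_pos real_sqrt_gt_zero)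
  then have "sqrt m \<le> 4 * C / \<epsilon>" using \<epsilon> by (simp add: field_simps)
  then have "(sqrt m)\<^sup>2 \<le> (4 * C / \<epsilon>)\<^sup>2" by (intro power_mono) auto
  then show False using m by simp
qed

definition maps_ball_into_compact :: "('a::real_normed_vector \<Rightarrow> 'b::real_normed_vector) \<Rightarrow> bool" where
  "maps_ball_into_compact f \<longleftrightarrow> (\<exists>K. compact K \<and> f ` cball 0 1 \<subseteq> K)"

lemma maps_ball_into_compact_sum:
  assumes "\<And>i. i \<in> I \<Longrightarrow> maps_ball_into_compact (f i)"
  shows "maps_ball_into_compact (\<lambda>x. \<Sum>i\<in>I. f i x)"
  using assms
proof (induction I rule: infinite_finite_induct)
  case (insert i I)
  obtain K where K: "compact K" "f i ` cball 0 1 \<subseteq> K"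
    using insert.prems[of i] by (auto simp: maps_ball_into_compact_def)
  obtain L where L: "compact L" "(\<lambda>x. \<Sum>i\<in>I. f i x) ` cball 0 1 \<subseteq> L"
    using insert by (auto simp: maps_ball_into_compact_def)
  have "(\<lambda>x. \<Sum>i\<in>insert i I. f i x) ` cball 0 1 \<subseteq> {x + y |x y. x \<in> K \<and> y \<in> L}"
    using K(2) L(2) insert.hyps by (auto simp: image_subset_iff)
  then show ?case unfolding maps_ball_into_compact_def using compact_sums[OF K(1) L(1)] by blast
qed (auto simp: maps_ball_into_compact_def intro: exI[of _ "{0}"])

lemma maps_ball_into_compact_rank_one:
  fixes scale :: "'k::real_or_complex \<Rightarrow> 'b::real_normed_vector \<Rightarrow> 'b"
    and c :: "'a::real_normed_vector \<Rightarrow> 'k"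
  assumes "normed_space_over scale" and c: "\<And>x. norm (c x) \<le> B * norm x"
  shows "maps_ball_into_compact (\<lambda>x. scale (c x) u)"
proof -
  interpret normed_space_over scale by (rule assms(1))
  have "continuous_on S (\<lambda>a. scale a u)" for S
  proof (rule continuous_on_subset[OF _ subset_UNIV])
    have "bounded_linear (\<lambda>a. scale a u)"
    proof (rule bounded_linear_intro[where K = "norm u"])
      show "scale (r *\<^sub>R x) u = r *\<^sub>R scale x u" for r x
        by (simp add: scaleR_conv_of_real scale_of_real[symmetric])
    qed (auto simp: scale_left_distrib norm_scale)
    then show "continuous_on UNIV (\<lambda>a. scale a u)" by (rule linear_continuous_on)
  qed
  then have "compact ((\<lambda>a. scale a u) ` cball 0 (max 0 B))"
    by (intro compact_continuous_image compact_cball_scalar)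
  moreover have "(\<lambda>x. scale (c x) u) ` cball 0 1 \<subseteq> (\<lambda>a. scale a u) ` cball 0 (max 0 B)"
  proof (rule image_subsetI)
    fix x :: 'a assume "x \<in> cball 0 1"
    then have "norm (c x) \<le> max 0 B * 1"
      using c[of x] by (intro order_trans[OF c] mult_mono) auto
    then show "scale (c x) u \<in> (\<lambda>a. scale a u) ` cball 0 (max 0 B)" by (intro imageI) simp
  qed
  ultimately show ?thesis unfolding maps_ball_into_compact_def by blast
qed

text \<open>
  A sum of finite rank operators that converges geometrically in norm is a norm limit of compact
  operators; compactness of the closure of the image of the ball is checked by total boundedness.
\<close>

lemma compact_operator_series:
  fixes sA :: "'k::real_or_complex \<Rightarrow> 'a::real_normed_vector \<Rightarrow> 'a"
    and sB :: "'k \<Rightarrow> 'b::banach \<Rightarrow> 'b"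
  assumes A: "normed_space_over sA" and B: "normed_space_over sB"
    and cadd: "\<And>k i x y. c k i (x + y) = c k i x + c k i y"
    and cscale: "\<And>k i a x. c k i (sA a x) = a * c k i x"
    and cbound: "\<And>k i. \<exists>C. \<forall>x. norm (c k i x) \<le> C * norm x"
    and S: "\<And>k x. S k x = (\<Sum>i\<in>I k. sB (c k i x) (u k i))"
    and bound: "\<And>k x. norm (S k x) \<le> M * (1 / 2) ^ k * norm x" and M: "0 \<le> M"
  shows "\<And>x. summable (\<lambda>k. S k x)"
    and "compact_operator sA sB (\<lambda>x. \<Sum>k. S k x)"
proof -
  interpret A: normed_space_over sA by (rule A)
  interpret B: normed_space_over sB by (rule B)
  have geo: "summable (\<lambda>k. M * (1 / 2) ^ k * norm x)" for x :: 'a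
    by (intro summable_mult2 summable_mult summable_geometric) simp
  show sm: "summable (\<lambda>k. S k x)" for x
    by (rule summable_comparison_test'[OF geo[of x], of 0]) (use bound in auto)
  have geosum: "(\<Sum>k. M * (1 / 2) ^ (k + n) * norm x) = 2 * M * (1 / 2) ^ n * norm x" for n and x :: 'a
  proof -
    have "(\<Sum>k. M * (1 / 2) ^ (k + n) * norm x) = (\<Sum>k. (M * (1 / 2) ^ n * norm x) * (1 / 2) ^ k)"
      by (simp add: power_add mult_ac)
    also have "\<dots> = (M * (1 / 2) ^ n * norm x) * (\<Sum>k. (1 / 2) ^ k)"
      by (intro suminf_mult summable_geometric) simp
    also have "(\<Sum>k. (1 / 2 :: real) ^ k) = 2" by (simp add: suminf_geometric)
    finally show ?thesis by simp
  qed
  have tail: "norm ((\<Sum>k. S k x) - (\<Sum>k<n. S k x)) \<le> 2 * M * (1 / 2) ^ n * norm x" for x n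
  proof -
    have "(\<Sum>k. S k x) - (\<Sum>k<n. S k x) = (\<Sum>k. S (k + n) x)"
      by (simp add: suminf_minus_initial_segment[OF sm])
    also have "norm \<dots> \<le> (\<Sum>k. M * (1 / 2) ^ (k + n) * norm x)"
    proof (rule norm_suminf_le)
      show "summable (\<lambda>k. M * (1 / 2) ^ (k + n) * norm x)"
        using summable_ignore_initial_segment[OF geo[of x], of n] by simp
    qed (rule bound)
    finally show ?thesis unfolding geosum .
  qed
  have lin: "Vector_Spaces.linear sA sB (\<lambda>x. \<Sum>k. S k x)"
  proof (intro Vector_Spaces.linear.intro module_hom.intro module_hom_axioms.intro)
    show "vector_space sA" "vector_space sB" "module sA" "module sB"
      using A.vector_space_axioms B.vector_space_axioms A.module_axioms B.module_axioms by auto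
    have "S k (x + y) = S k x + S k y" for k x y
      by (simp add: S cadd B.scale_left_distrib sum.distrib)
    then show "(\<Sum>k. S k (x + y)) = (\<Sum>k. S k x) + (\<Sum>k. S k y)" for x y
      by (simp add: suminf_add[OF sm sm])
    have Sa: "S k (sA a x) = sB a (S k x)" for k a x
      by (simp add: S cscale B.scale_sum_right)
    have bl: "bounded_linear (sB a)" for a
    proof (rule bounded_linear_intro[where K = "norm a"])
      show "sB a (r *\<^sub>R x) = r *\<^sub>R sB a x" for r x
        by (simp add: B.scale_of_real[symmetric] mult.commute)
    qed (auto simp: B.scale_right_distrib B.norm_scale mult.commute)
    show "(\<Sum>k. S k (sA a x)) = sB a (\<Sum>k. S k x)" for a x
      unfolding Sa by (rule bounded_linear.suminf[OF bl sm, symmetric])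
  qed
  have bnd: "norm (\<Sum>k. S k x) \<le> 2 * M * norm x" for x
    using tail[of x 0] by simp
  have pc: "maps_ball_into_compact (\<lambda>x. \<Sum>k<n. S k x)" for n
  proof (rule maps_ball_into_compact_sum)
    fix k
    have "maps_ball_into_compact (\<lambda>x. \<Sum>i\<in>I k. sB (c k i x) (u k i))"
    proof (rule maps_ball_into_compact_sum)
      fix i
      obtain C where "\<And>x. norm (c k i x) \<le> C * norm x" using cbound by blast
      then show "maps_ball_into_compact (\<lambda>x. sB (c k i x) (u k i))"
        by (rule maps_ball_into_compact_rank_one[OF B])
    qed
    then show "maps_ball_into_compact (S k)" unfolding S[abs_def] .
  qed
  have "compact (closure ((\<lambda>x. \<Sum>k. S k x) ` cball 0 1))"
    unfolding compact_eq_totally_bounded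
  proof (intro conjI allI impI)
    show "complete (closure ((\<lambda>x. \<Sum>k. S k x) ` cball 0 1))" by (simp add: complete_eq_closed)
    fix e :: real assume e: "0 < e"
    have "(\<lambda>n. 2 * M * (1 / 2) ^ n) \<longlonglongrightarrow> 2 * M * 0"
      by (intro tendsto_intros LIMSEQ_power_zero) simp
    then have "\<forall>\<^sub>F n in sequentially. 2 * M * (1 / 2) ^ n < e / 4"
      using e by (intro order_tendstoD(2)[where a = "e / 4"]) auto
    then obtain n where n: "2 * M * (1 / 2) ^ n < e / 4"
      unfolding eventually_sequentially by blast
    obtain K where K: "compact K" "(\<lambda>x. \<Sum>k<n. S k x) ` cball 0 1 \<subseteq> K"
      using pc[of n] by (auto simp: maps_ball_into_compact_def)
    obtain F where F: "finite F" "K \<subseteq> (\<Union>x\<in>F. ball x (e / 4))"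
      using K(1) e unfolding compact_eq_totally_bounded by (meson divide_pos_pos zero_less_numeral)
    have "closure ((\<lambda>x. \<Sum>k. S k x) ` cball 0 1) \<subseteq> (\<Union>x\<in>F. cball x (e / 2))"
    proof (rule closure_minimal)
      show "closed (\<Union>x\<in>F. cball x (e / 2))" using F(1) by (intro closed_UN) auto
      show "(\<lambda>x. \<Sum>k. S k x) ` cball 0 1 \<subseteq> (\<Union>x\<in>F. cball x (e / 2))"
      proof (rule image_subsetI)
        fix x :: 'a assume x: "x \<in> cball 0 1"
        then have "(\<Sum>k<n. S k x) \<in> K" using K(2) by blast
        then obtain f where f: "f \<in> F" "dist f (\<Sum>k<n. S k x) < e / 4" using F(2) by auto
        have "norm ((\<Sum>k. S k x) - (\<Sum>k<n. S k x)) \<le> 2 * M * (1 / 2) ^ n * 1"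
          using x M by (intro order_trans[OF tail] mult_left_mono) auto
        then have "dist (\<Sum>k<n. S k x) (\<Sum>k. S k x) \<le> e / 4"
          using n by (simp add: dist_norm norm_minus_commute)
        then have "dist f (\<Sum>k. S k x) \<le> e / 2"
          using f(2) dist_triangle[of f "\<Sum>k. S k x" "\<Sum>k<n. S k x"] by linarith
        then show "(\<Sum>k. S k x) \<in> (\<Union>x\<in>F. cball x (e / 2))" using f(1) by auto
      qed
    qed
    also have "\<dots> \<subseteq> (\<Union>x\<in>F. ball x e)" using e by (intro UN_mono order_refl) auto
    finally show "\<exists>k. finite k \<and> closure ((\<lambda>x. \<Sum>k. S k x) ` cball 0 1) \<subseteq> (\<Union>x\<in>k. ball x e)"
      using F(1) by blast
  qed
  then show "compact_operator sA sB (\<lambda>x. \<Sum>k. S k x)"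
    unfolding compact_operator_def bounded_operator_def using lin bnd by blast
qed

section \<open>A fundamental biorthogonal system\<close>

context normed_space_over
begin

definition continuous_form :: "('x \<Rightarrow> 'k) \<Rightarrow> bool" where
  "continuous_form f \<longleftrightarrow> linear_form f \<and> (\<exists>C. \<forall>x. norm (f x) \<le> C * norm x)"

definition biorthogonal :: "nat \<Rightarrow> (nat \<Rightarrow> 'x) \<Rightarrow> (nat \<Rightarrow> 'x \<Rightarrow> 'k) \<Rightarrow> bool" where
  "biorthogonal n v w \<longleftrightarrow> (\<forall>i<n. continuous_form (w i)) \<and>
     (\<forall>i<n. \<forall>j<n. w i (v j) = (if i = j then 1 else 0))"

lemma linear_form_diff: "linear_form f \<Longrightarrow> f (x - y) = f x - f y"
  unfolding linear_form_def
  by (metis (no_types, opaque_lifting) add_diff_cancel_right' diff_add_cancel)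

lemma linear_form_scale: "linear_form f \<Longrightarrow> f (scale c x) = c * f x"
  by (simp add: linear_form_def)

lemma norming_form:
  assumes "z \<noteq> 0"
  shows "\<exists>f. linear_form f \<and> f z = 1 \<and> (\<forall>x. norm (f x) \<le> norm x / norm z)"
proof -
  define M where "M = range (\<lambda>c. scale c z)"
  define f where "f = (\<lambda>x. THE c. x = scale c z)"
  have f: "f (scale c z) = c" for c
    unfolding f_def using assms by (intro the_equality) (auto simp: scale_cancel_right)
  have "\<exists>g. (\<forall>x y. g (x + y) = g x + g y) \<and> (\<forall>c x. g (scale c x) = c * g x) \<and>
           (\<forall>x. norm (g x) \<le> norm x / norm z) \<and> (\<forall>x\<in>M. g x = f x)"
  proof (rule hahn_banach)
    show "vector_space scale" by (rule vector_space_axioms)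
    show "norm (x + y) / norm z \<le> norm x / norm z + norm y / norm z" for x y :: 'x
      unfolding add_divide_distrib[symmetric] by (intro divide_right_mono norm_triangle_ineq) simp
    show "0 \<in> M" unfolding M_def by (rule range_eqI[of _ _ 0]) simp
    show "x + y \<in> M" if "x \<in> M" "y \<in> M" for x y
      using that by (auto simp: M_def scale_left_distrib[symmetric])
    show "scale c x \<in> M" if "x \<in> M" for c x using that by (auto simp: M_def)
    show "f (x + y) = f x + f y" if "x \<in> M" "y \<in> M" for x y
      using that by (auto simp: M_def scale_left_distrib[symmetric] f)
    show "f (scale c x) = c * f x" if "x \<in> M" for c x using that by (auto simp: M_def f)
    show "norm (f x) \<le> norm x / norm z" if "x \<in> M" for x
      using that assms by (auto simp: M_def f norm_scale)
  qed (simp add: norm_scale)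
  then obtain g where g: "linear_form g" "\<And>x. norm (g x) \<le> norm x / norm z" "\<And>x. x \<in> M \<Longrightarrow> g x = f x"
    unfolding linear_form_def by blast
  have "z \<in> M" unfolding M_def by (rule range_eqI[of _ _ 1]) simp
  then have "g z = f (scale 1 z)" using g(3) by simp
  then show ?thesis using g(1,2) unfolding f by blast
qed

text \<open>
  \<open>P\<close> is the projection onto the span of the \<open>v\<^sub>i\<close> along the kernels of the \<open>w\<^sub>i\<close>. The vector \<open>z\<close> is
  \<open>x - P x\<close>, normalized, or any other unit vector in the kernel of \<open>P\<close> if \<open>x\<close> is in the span
  already. The functional is a norming functional of \<open>z\<close> composed with \<open>1 - P\<close>, which makes it
  vanish on the \<open>v\<^sub>i\<close>.
\<close>

lemma biorthogonal_complement_vector: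
  assumes bi: "biorthogonal n v w" and inf: "\<not> finite_dimensional UNIV"
  shows "\<exists>z f. continuous_form f \<and> norm z = 1 \<and> f z = 1 \<and> (\<forall>i<n. w i z = 0) \<and> (\<forall>i<n. f (v i) = 0) \<and>
    (\<exists>a c. x = (\<Sum>i<n. scale (a i) (v i)) + scale c z)"
proof -
  have lin: "linear_form (w i)" if "i < n" for i
    using bi that by (simp add: biorthogonal_def continuous_form_def)
  have wv: "w i (v j) = (if i = j then 1 else 0)" if "i < n" "j < n" for i j
    using bi that by (simp add: biorthogonal_def)
  define P where "P = (\<lambda>y. combo {..<n} (\<lambda>i. w i y) v)"
  have wP: "w i (P y) = w i y" if "i < n" for i y
  proof -
    have "w i (P y) = (\<Sum>j<n. if j = i then w i y else 0)"
      unfolding P_def linear_form_combo[OF lin[OF that]] using that by (intro sum.cong) (auto simp: wv)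
    then show ?thesis using that by simp
  qed
  have Pv: "P (v j) = v j" if "j < n" for j
  proof -
    have "P (v j) = (\<Sum>i<n. if i = j then v j else 0)"
      unfolding P_def combo_def using that by (intro sum.cong) (auto simp: wv)
    then show ?thesis using that by simp
  qed
  have Padd: "P (x + y) = P x + P y" for x y
    unfolding P_def combo_add[symmetric] unfolding combo_def using lin
    by (intro sum.cong refl) (simp add: linear_form_def)
  have Pscale: "P (scale c y) = scale c (P y)" for c y
    unfolding P_def combo_mult[symmetric] unfolding combo_def using lin
    by (intro sum.cong refl) (simp add: linear_form_def)
  have "\<exists>y. y - P y \<noteq> 0 \<and> (x - P x \<noteq> 0 \<longrightarrow> y = x)"
  proof (cases "x - P x = 0")
    case True
    have "\<exists>y. y \<noteq> P y"
    proof (rule ccontr)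
      assume "\<not> ?thesis"
      then have *: "y = P y" for y by blast
      have "P y \<in> span (v ` {..<n})" for y
        unfolding P_def combo_def by (intro span_sum span_scale span_base) auto
      then have "span (v ` {..<n}) = UNIV" using * by (metis UNIV_eq_I)
      then show False using inf unfolding finite_dimensional_def by (metis finite_imageI finite_lessThan subspace_UNIV)
    qed
    then show ?thesis using True by auto
  qed auto
  then obtain y where y: "y - P y \<noteq> 0" "x - P x \<noteq> 0 \<longrightarrow> y = x" by blast
  define z where "z = scale (of_real (1 / norm (y - P y))) (y - P y)"
  have z1: "norm z = 1" using y(1) by (simp add: z_def norm_scale norm_divide)
  have wz: "w i z = 0" if "i < n" for i
    using lin[OF that] by (simp add: z_def linear_form_scale linear_form_diff wP[OF that])
  have Pz: "P z = 0" unfolding P_def combo_def by (intro sum.neutral) (simp add: wz)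
  obtain \<zeta> where \<zeta>: "linear_form \<zeta>" "\<zeta> z = 1" "\<And>x. norm (\<zeta> x) \<le> norm x / norm z"
    using norming_form[of z] z1 by force
  define f where "f = (\<lambda>x. \<zeta> (x - P x))"
  have flin: "linear_form f"
    unfolding linear_form_def f_def using \<zeta>(1)
    by (simp add: Padd Pscale linear_form_diff) (simp add: linear_form_def algebra_simps)
  have "\<forall>i<n. \<exists>C. \<forall>x. norm (w i x) \<le> C * norm x"
    using bi by (simp add: biorthogonal_def continuous_form_def)
  then obtain C where C: "\<And>i x. i < n \<Longrightarrow> norm (w i x) \<le> C i * norm x" by metis
  have fb: "norm (f x) \<le> (1 + (\<Sum>i<n. C i * norm (v i))) * norm x" for x
  proof -
    have "norm (P x) \<le> (\<Sum>i<n. C i * norm x * norm (v i))"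
      unfolding P_def combo_def using C by (intro sum_norm_le) (auto simp: norm_scale intro: mult_right_mono)
    also have "\<dots> = (\<Sum>i<n. C i * norm (v i)) * norm x"
      unfolding sum_distrib_right by (simp add: mult_ac)
    finally have "norm (x - P x) \<le> norm x + (\<Sum>i<n. C i * norm (v i)) * norm x"
      using norm_triangle_ineq4[of x "P x"] by linarith
    moreover have "norm (f x) \<le> norm (x - P x)" using \<zeta>(3)[of "x - P x"] z1 by (simp add: f_def)
    ultimately show ?thesis by (simp add: algebra_simps)
  qed
  have "\<exists>a c. x = (\<Sum>i<n. scale (a i) (v i)) + scale c z"
  proof (cases "x - P x = 0")
    case True
    then show ?thesis
      by (intro exI[of _ "\<lambda>i. w i x"] exI[of _ 0]) (simp add: P_def combo_def)
  next
    case False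
    then have "y = x" using y(2) by simp
    then have "x = P x + scale (of_real (norm (x - P x))) z"
      using False by (simp add: z_def)
    then show ?thesis
      by (intro exI[of _ "\<lambda>i. w i x"] exI[of _ "of_real (norm (x - P x))"]) (simp only: P_def combo_def)
  qed
  moreover have "continuous_form f" using flin fb by (auto simp: continuous_form_def)
  moreover have "f z = 1" using \<zeta>(2) by (simp add: f_def Pz)
  moreover have "f (v i) = 0" if "i < n" for i
    using linear_form_zero[OF \<zeta>(1)] by (simp add: f_def Pv[OF that])
  ultimately show ?thesis using z1 wz by blast
qed

text \<open>
  A block consists of the indices \<open>n, \<dots>, N\<close>. Those below \<open>N\<close> belong to a complemented Hilbert
  space; the index \<open>N\<close> brings \<open>x\<close> into the span. The operator \<open>T\<close> is small on everything after the
  Hilbert space, and its value at the unit vector \<open>N\<close> is small relative to the functional \<open>w\<^sub>N\<close>.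
\<close>

definition adapted_block ::
  "('k ell2 \<Rightarrow> 'k ell2) \<Rightarrow> real \<Rightarrow> real \<Rightarrow> 'x \<Rightarrow> nat \<Rightarrow> nat \<Rightarrow> (nat \<Rightarrow> 'x) \<Rightarrow> (nat \<Rightarrow> 'x \<Rightarrow> 'k) \<Rightarrow> bool" where
  "adapted_block T A \<epsilon> x n N v w \<longleftrightarrow> n \<le> N \<and>
    (\<exists>a. x = (\<Sum>i<Suc N. scale (a i) (v i))) \<and> norm (v N) = 1 \<and>
    (\<forall>c. norm (\<Sum>i=n..<N. scale (c i) (v i)) \<le> A * sqrt (\<Sum>i=n..<N. (norm (c i))\<^sup>2)) \<and>
    (\<forall>y. sqrt (\<Sum>i=n..<N. (norm (w i y))\<^sup>2) \<le> A * norm y) \<and>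
    (\<forall>x. (\<forall>i<N. coord x i = 0) \<longrightarrow> norm (T x) \<le> \<epsilon> * norm x) \<and>
    (\<forall>y. norm (w N y) * norm (T (unit_ell2 N)) \<le> \<epsilon> * norm y)"

lemma adapted_block_cong:
  assumes "adapted_block T A \<epsilon> x n N v w" and eq: "\<And>i. i < Suc N \<Longrightarrow> v' i = v i \<and> w' i = w i"
  shows "adapted_block T A \<epsilon> x n N v' w'"
proof -
  have "(\<Sum>i<Suc N. scale (a i) (v' i)) = (\<Sum>i<Suc N. scale (a i) (v i))"
    "(\<Sum>i=n..<N. scale (a i) (v' i)) = (\<Sum>i=n..<N. scale (a i) (v i))"
    "(\<Sum>i=n..<N. (norm (w' i y))\<^sup>2) = (\<Sum>i=n..<N. (norm (w i y))\<^sup>2)" for a y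
    using eq by (auto intro!: sum.cong)
  then show ?thesis using assms(1) eq[of N] unfolding adapted_block_def by simp
qed

text \<open>
  The order of the choices matters: first the vector \<open>z\<close> for the index \<open>N\<close> and its functional,
  then \<open>N\<close>, so large that \<open>T\<close> is small enough relative to the norm of this functional, and last
  the Hilbert space that fills the indices \<open>n, \<dots>, N - 1\<close>, biorthogonal to all the rest.
\<close>

lemma biorthogonal_extension:
  fixes T :: "'k ell2 \<Rightarrow> 'k ell2"
  assumes copies: "complemented_hilbert_copies A"
    and inf: "\<not> finite_dimensional UNIV"
    and tail: "\<forall>\<epsilon>>0. \<exists>n. \<forall>x. (\<forall>i<n. coord x i = 0) \<longrightarrow> norm (T x) \<le> \<epsilon> * norm x"
    and bi: "biorthogonal n v w" and \<epsilon>: "0 < \<epsilon>"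
  shows "\<exists>N v' w'. biorthogonal (Suc N) v' w' \<and> (\<forall>i<n. v' i = v i \<and> w' i = w i) \<and>
    adapted_block T A \<epsilon> x n N v' w'"
proof -
  obtain z f where f: "continuous_form f" "f z = 1" "\<And>i. i < n \<Longrightarrow> f (v i) = 0"
    and z: "norm z = 1" "\<And>i. i < n \<Longrightarrow> w i z = 0"
    and x: "\<exists>a c. x = (\<Sum>i<n. scale (a i) (v i)) + scale c z"
    using biorthogonal_complement_vector[OF bi inf, of x] by blast
  obtain C where "\<And>y. norm (f y) \<le> C * norm y" using f(1) by (auto simp: continuous_form_def)
  then have C: "norm (f y) \<le> max 0 C * norm y" for y
    by (rule order_trans) (intro mult_right_mono, auto)
  \<comment> \<open>The constant of a bounded functional need not be positive in general, hence the maximum.\<close>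
  define \<epsilon>' where "\<epsilon>' = \<epsilon> / (max 0 C + 1)"
  have \<epsilon>': "0 < \<epsilon>'" "\<epsilon>' \<le> \<epsilon>" "max 0 C * \<epsilon>' \<le> \<epsilon>"
    using \<epsilon> by (auto simp: \<epsilon>'_def field_simps)
  obtain N0 where N0: "\<And>x. (\<forall>i<N0. coord x i = 0) \<Longrightarrow> norm (T x) \<le> \<epsilon>' * norm x"
    using tail \<epsilon>'(1) by blast
  define N where "N = max n N0"
  have N: "n \<le> N" "N0 \<le> N" by (auto simp: N_def)
  define \<psi> where "\<psi> = (\<lambda>t. if t < n then w t else f)"
  define y where "y = (\<lambda>t. if t < n then v t else z)"
  have \<psi>: "\<forall>t<Suc n. linear_form (\<psi> t)"
    using bi f(1) by (auto simp: \<psi>_def biorthogonal_def continuous_form_def)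
  from copies[unfolded complemented_hilbert_copies_def, THEN conjunct2,
      THEN spec[of _ "N - n"], THEN spec[of _ "Suc n"], THEN spec[of _ \<psi>], THEN spec[of _ y], THEN mp, OF \<psi>]
  obtain X Q where
    Q: "\<forall>j. linear_form (Q j)" and QX: "\<forall>i<N - n. \<forall>j<N - n. Q i (X j) = (if i = j then 1 else 0)"
    and X: "\<forall>c. norm (\<Sum>j<N - n. scale (c j) (X j)) \<le> A * sqrt (sqn (N - n) c)"
    and Qn: "\<forall>z. sqrt (sqn (N - n) (\<lambda>j. Q j z)) \<le> A * norm z"
    and \<psi>X: "\<forall>j<N - n. \<forall>t<Suc n. \<psi> t (X j) = 0" and Qy: "\<forall>j<N - n. \<forall>t<Suc n. Q j (y t) = 0"
    by (elim exE conjE)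
  have wX: "w i (X j) = 0" if "i < n" "j < N - n" for i j
    using \<psi>X[rule_format, of j i] that by (simp add: \<psi>_def)
  have fX: "f (X j) = 0" if "j < N - n" for j
    using \<psi>X[rule_format, of j n] that by (simp add: \<psi>_def)
  have Qv: "Q j (v i) = 0" if "i < n" "j < N - n" for i j
    using Qy[rule_format, of j i] that by (simp add: y_def)
  have Qz: "Q j z = 0" if "j < N - n" for j
    using Qy[rule_format, of j n] that by (simp add: y_def)
  have Qc: "continuous_form (Q j)" if "j < N - n" for j
  proof -
    have "norm (Q j y) \<le> A * norm y" for y
    proof -
      have "norm (Q j y) \<le> sqrt (sqn (N - n) (\<lambda>j. Q j y))"
        using norm_le_sqn[OF that, of "\<lambda>j. Q j y"] by (rule real_le_rsqrt)
      then show ?thesis using Qn by (meson order_trans)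
    qed
    then show ?thesis using Q by (auto simp: continuous_form_def)
  qed
  define v' where "v' = (\<lambda>i. if i < n then v i else if i < N then X (i - n) else z)"
  define w' where "w' = (\<lambda>i. if i < n then w i else if i < N then Q (i - n) else f)"
  have shift: "(\<Sum>i=n..<N. g i) = (\<Sum>j<N - n. g (n + j))" for g :: "nat \<Rightarrow> 'c::comm_monoid_add"
    using sum.shift_bounds_nat_ivl[of g 0 n "N - n"] N by (simp add: atLeast0LessThan add.commute)
  have e1: "biorthogonal (Suc N) v' w'"
    unfolding biorthogonal_def
  proof (intro conjI allI impI)
    show "continuous_form (w' i)" if "i < Suc N" for i
      using that bi Qc[of "i - n"] f(1) by (auto simp: w'_def biorthogonal_def)
    show "w' i (v' j) = (if i = j then 1 else 0)" if ij: "i < Suc N" "j < Suc N" for i j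
    proof -
      have bwv: "w i (v j) = (if i = j then 1 else 0)" if "i < n" "j < n" for i j
        using bi that by (simp add: biorthogonal_def)
      consider "i < n" | "n \<le> i" "i < N" | "i = N" using ij by linarith
      then show ?thesis
      proof cases
        case 1
        then show ?thesis using ij N by (auto simp: w'_def v'_def bwv wX z(2))
      next
        case 2
        then show ?thesis using ij N QX[rule_format, of "i - n" "j - n"]
          by (auto simp: w'_def v'_def Qv Qz)
      next
        case 3
        then show ?thesis using ij N by (auto simp: w'_def v'_def fX f(2,3))
      qed
    qed
  qed
  have e2: "\<exists>a. x = (\<Sum>i<Suc N. scale (a i) (v' i))"
  proof -
    obtain a c where ac: "x = (\<Sum>i<n. scale (a i) (v i)) + scale c z" using x by blast
    define a' where "a' = (\<lambda>i. if i < n then a i else if i < N then 0 else c)"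
    have "(\<Sum>i<N. scale (a' i) (v' i)) = (\<Sum>i<n. scale (a' i) (v' i))"
      using N by (intro sum.mono_neutral_right) (auto simp: a'_def)
    also have "\<dots> = (\<Sum>i<n. scale (a i) (v i))"
      by (intro sum.cong) (auto simp: a'_def v'_def)
    finally have "(\<Sum>i<Suc N. scale (a' i) (v' i)) = (\<Sum>i<n. scale (a i) (v i)) + scale (a' N) (v' N)" by simp
    then have "x = (\<Sum>i<Suc N. scale (a' i) (v' i))"
      unfolding ac using N by (simp add: a'_def v'_def)
    then show ?thesis by blast
  qed
  have e3: "norm (\<Sum>i=n..<N. scale (c i) (v' i)) \<le> A * sqrt (\<Sum>i=n..<N. (norm (c i))\<^sup>2)" for c
    using X[rule_format, of "\<lambda>j. c (n + j)"] by (simp add: shift v'_def sqn_def)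
  have e4: "sqrt (\<Sum>i=n..<N. (norm (w' i y))\<^sup>2) \<le> A * norm y" for y
    using Qn[rule_format, of y] by (simp add: shift w'_def sqn_def)
  have e5: "norm (T x) \<le> \<epsilon> * norm x" if "\<forall>i<N. coord x i = 0" for x
  proof -
    have "norm (T x) \<le> \<epsilon>' * norm x" using that N by (intro N0) auto
    also have "\<dots> \<le> \<epsilon> * norm x" using \<epsilon>' by (intro mult_right_mono) auto
    finally show ?thesis .
  qed
  have e6: "norm (w' N y) * norm (T (unit_ell2 N)) \<le> \<epsilon> * norm y" for y
  proof -
    have "(norm (unit_ell2 N :: 'k ell2))\<^sup>2 = 1"
      using norm_finite_part[of "{N}" "\<lambda>_. 1 :: 'k"]
      by (simp add: finite_part_def normed_space_over.norm_scale[OF normed_space_over_ell2])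
    then have "norm (unit_ell2 N :: 'k ell2) = 1" using power2_eq_imp_eq[of "norm (unit_ell2 N :: 'k ell2)" 1] by simp
    moreover have "norm (T (unit_ell2 N)) \<le> \<epsilon>' * norm (unit_ell2 N :: 'k ell2)"
      using N by (intro N0) (auto simp: coord_unit)
    ultimately have "norm (w' N y) * norm (T (unit_ell2 N)) \<le> (max 0 C * norm y) * \<epsilon>'"
      using C[of y] N \<epsilon>' by (intro mult_mono) (auto simp: w'_def)
    also have "\<dots> \<le> \<epsilon> * norm y" using mult_right_mono[OF \<epsilon>'(3), of "norm y"] by (simp add: mult_ac)
    finally show ?thesis .
  qed
  have e7: "norm (v' N) = 1" using N z by (simp add: v'_def)
  have e8: "\<forall>i<n. v' i = v i \<and> w' i = w i" by (simp add: v'_def w'_def)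
  have "adapted_block T A \<epsilon> x n N v' w'"
    unfolding adapted_block_def using N(1) e2 e3 e4 e5 e6 e7 by blast
  then show ?thesis using e1 e8 by blast
qed

lemma fundamental_biorthogonal_system:
  fixes T :: "'k ell2 \<Rightarrow> 'k ell2" and X :: "nat \<Rightarrow> 'x"
  assumes copies: "complemented_hilbert_copies A"
    and inf: "\<not> finite_dimensional UNIV"
    and tail: "\<forall>\<epsilon>>0. \<exists>n. \<forall>x. (\<forall>i<n. coord x i = 0) \<longrightarrow> norm (T x) \<le> \<epsilon> * norm x"
  shows "\<exists>n N v w. n 0 = (0::nat) \<and> (\<forall>k. n (Suc k) = Suc (N k)) \<and>
    (\<forall>i. continuous_form (w i)) \<and> (\<forall>i j. w i (v j) = (if i = j then 1 else 0)) \<and>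
    (\<forall>k. adapted_block T A ((1 / 4) ^ Suc k) (X k) (n k) (N k) v w)"
proof -
  define P where "P = (\<lambda>(k::nat) (n, v, w). biorthogonal n v w \<and> (k = 0 \<longrightarrow> n = 0))"
  define step where "step = (\<lambda>k (n :: nat, v :: nat \<Rightarrow> 'x, w :: nat \<Rightarrow> 'x \<Rightarrow> 'k) (n', v', w'). \<exists>N. n' = Suc N \<and>
    (\<forall>i<n. v' i = v i \<and> w' i = w i) \<and> adapted_block T A ((1 / 4) ^ Suc k) (X k) n N v' w')"
  have "\<exists>S. \<forall>k. P k (S k) \<and> step k (S k) (S (Suc k))"
  proof (rule dependent_nat_choice)
    show "\<exists>s. P 0 s" by (rule exI[of _ "(0, \<lambda>_. 0, \<lambda>_ _. 0)"]) (simp add: P_def biorthogonal_def)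
    fix s k assume s: "P k s"
    obtain n v w where nvw: "s = (n, v, w)" by (cases s)
    have bi: "biorthogonal n v w" using s by (simp add: P_def nvw)
    have pos: "0 < (1 / 4 :: real) ^ Suc k" by simp
    from biorthogonal_extension[OF copies inf tail bi pos, of "X k"]
    obtain N v' w' where "biorthogonal (Suc N) v' w'" "\<forall>i<n. v' i = v i \<and> w' i = w i"
      "adapted_block T A ((1 / 4) ^ Suc k) (X k) n N v' w'" by blast
    then show "\<exists>s'. P (Suc k) s' \<and> step k s s'"
      by (intro exI[of _ "(Suc N, v', w')"]) (auto simp: P_def step_def nvw)
  qed
  then obtain S where S: "\<And>k. P k (S k)" "\<And>k. step k (S k) (S (Suc k))" by blast
  define n where "n = (\<lambda>k. fst (S k))"
  define vv where "vv = (\<lambda>k. fst (snd (S k)))"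
  define ww where "ww = (\<lambda>k. snd (snd (S k)))"
  have Sk: "S k = (n k, vv k, ww k)" for k by (simp add: n_def vv_def ww_def)
  have bi: "biorthogonal (n k) (vv k) (ww k)" for k using S(1)[of k] by (simp add: Sk P_def)
  have n0: "n 0 = 0" using S(1)[of 0] by (simp add: Sk P_def)
  define N where "N = (\<lambda>k. n (Suc k) - 1)"
  have nN: "n (Suc k) = Suc (N k)"
    and step_agree: "i < n k \<Longrightarrow> vv (Suc k) i = vv k i \<and> ww (Suc k) i = ww k i"
    and block: "adapted_block T A ((1 / 4) ^ Suc k) (X k) (n k) (N k) (vv (Suc k)) (ww (Suc k))" for k i
    using S(2)[of k] by (auto simp: Sk step_def N_def)
  have nle: "n k \<le> N k" for k using block[of k] by (simp add: adapted_block_def)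
  have nmono: "n k \<le> n (k + l)" for k l
  proof (induction l)
    case (Suc l)
    then show ?case using nN[of "k + l"] nle[of "k + l"] by simp
  qed simp
  have nge: "k \<le> n k" for k
  proof (induction k)
    case (Suc k)
    then show ?case using nN[of k] nle[of k] by simp
  qed simp
  have agree: "vv (k + l) i = vv k i \<and> ww (k + l) i = ww k i" if i: "i < n k" for i k l
  proof (induction l)
    case (Suc l)
    have "i < n (k + l)" using i nmono[of k l] by linarith
    then show ?case using Suc step_agree[of i "k + l"] by simp
  qed simp
  define v where "v = (\<lambda>i. vv (Suc i) i)"
  define w where "w = (\<lambda>i. ww (Suc i) i)"
  have vw: "v i = vv k i \<and> w i = ww k i" if i: "i < n k" for i k
  proof (cases "k \<le> Suc i")
    case True
    then show ?thesis using agree[OF i, of "Suc i - k"] by (simp add: v_def w_def)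
  next
    case False
    have "i < n (Suc i)" using nge[of "Suc i"] by simp
    from agree[OF this, of "k - Suc i"] show ?thesis using False by (simp add: v_def w_def)
  qed
  show ?thesis
  proof (rule exI[of _ n], rule exI[of _ N], rule exI[of _ v], rule exI[of _ w], intro conjI allI)
    show "n 0 = 0" by (rule n0)
    show "n (Suc k) = Suc (N k)" for k by (rule nN)
    show "adapted_block T A ((1 / 4) ^ Suc k) (X k) (n k) (N k) v w" for k
      by (rule adapted_block_cong[OF block]) (simp add: vw nN)
    show "continuous_form (w i)" for i
    proof -
      have "i < n (Suc i)" using nge[of "Suc i"] by simp
      then show ?thesis using bi[of "Suc i"] by (simp add: biorthogonal_def w_def)
    qed
    show "w i (v j) = (if i = j then 1 else 0)" for i j
    proof -
      have "i < n (Suc (i + j))" "j < n (Suc (i + j))" using nge[of "Suc (i + j)"] by auto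
      then show ?thesis using bi[of "Suc (i + j)"] vw[of i "Suc (i + j)"] vw[of j "Suc (i + j)"]
        by (simp add: biorthogonal_def)
    qed
  qed
qed

end

section \<open>The factorization\<close>

theorem theorem3p4:
  fixes scale :: "'k::real_or_complex \<Rightarrow> 'x::banach \<Rightarrow> 'x"
    and T :: "'k ell2 \<Rightarrow> 'k ell2"
    and p :: real
  assumes "compact_operator ell2_scale ell2_scale T"
    and "1 < p"
    and "normed_space_over scale"
    and "separable_space (euclidean :: 'x topology)"
    and "\<not> normed_space_over.finite_dimensional scale UNIV"
    and "normed_space_over.script_Lp_space scale p"
  shows "\<exists>T1 T2. T = T2 \<circ> T1 \<and>
           compact_operator ell2_scale scale T1 \<and>
           compact_operator scale ell2_scale T2 \<and>
           closure (range T1) = UNIV"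
proof -
  interpret normed_space_over scale by (rule assms(3))
  interpret E: normed_space_over "ell2_scale :: 'k \<Rightarrow> 'k ell2 \<Rightarrow> 'k ell2" by (rule normed_space_over_ell2)
  have bT: "bounded_operator ell2_scale ell2_scale T" using assms(1) by (simp add: compact_operator_def)
  obtain C where C: "0 \<le> C" "\<And>x. norm (T x) \<le> C * norm x"
    using bounded_operator_bound[OF bT] by blast
  interpret T: Vector_Spaces.linear ell2_scale ell2_scale T
    using bT by (simp add: bounded_operator_def)
  obtain Ds :: "'x set" where Ds: "countable Ds" "closure Ds = UNIV"
    using assms(4) by (auto simp: separable_space_def)
  have "Ds \<noteq> {}" using Ds(2) by auto
  define X where "X = from_nat_into Ds"
  have rX: "range X = Ds" unfolding X_def using \<open>Ds \<noteq> {}\<close> Ds(1) by (rule range_from_nat_into)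
  obtain A where copies: "complemented_hilbert_copies A"
    using uniformly_complemented_hilbert_spaces[OF assms(6,2,5)] by blast
  then have A: "0 \<le> A" by (simp add: complemented_hilbert_copies_def)
  have T_tail: "\<forall>\<epsilon>>0. \<exists>n. \<forall>x. (\<forall>i<n. coord x i = 0) \<longrightarrow> norm (T x) \<le> \<epsilon> * norm x"
    using compact_operator_tail[OF assms(1)] by blast
  obtain n N v w where n0: "n 0 = (0::nat)" and nSuc: "\<And>k. n (Suc k) = Suc (N k)"
    and w: "\<And>i. continuous_form (w i)" and wv: "\<And>i j. w i (v j) = (if i = j then 1 else 0)"
    and block: "\<And>k. adapted_block T A ((1 / 4) ^ Suc k) (X k) (n k) (N k) v w"
    using fundamental_biorthogonal_system[OF copies assms(5) T_tail, of X] by metis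
  have nN: "\<forall>k. n (Suc k) = Suc (N k)" "\<forall>k. n k \<le> N k"
    and Xv: "\<forall>k. \<exists>a. X k = (\<Sum>i<n (Suc k). scale (a i) (v i))" and vN: "\<forall>k. norm (v (N k)) = 1"
    and V: "\<forall>k c. norm (\<Sum>i=n k..<N k. scale (c i) (v i)) \<le> A * sqrt (\<Sum>i=n k..<N k. (norm (c i))\<^sup>2)"
    and W: "\<forall>k y. sqrt (\<Sum>i=n k..<N k. (norm (w i y))\<^sup>2) \<le> A * norm y"
    and tail: "\<forall>k x. (\<forall>i<N k. coord x i = 0) \<longrightarrow> norm (T x) \<le> (1 / 4) ^ Suc k * norm x"
    and last: "\<forall>k y. norm (w (N k) y) * norm (T (unit_ell2 (N k))) \<le> (1 / 4) ^ Suc k * norm y"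
    using block unfolding adapted_block_def nSuc by blast+
  define blk where "blk = (\<lambda>k. {n k..<n (Suc k)})"
  have finblk: "finite (blk k)" for k by (simp add: blk_def)
  have blk_split: "sum g (blk k) = sum g {n k..<N k} + g (N k)" for g :: "nat \<Rightarrow> 'z::comm_monoid_add" and k
    unfolding blk_def using nN(1)[rule_format, of k] nN(2)[rule_format, of k] by simp
  have part: "(\<Sum>k<m. sum g (blk k)) = sum g {..<n m}" for g :: "nat \<Rightarrow> 'z::comm_monoid_add" and m
  proof (induction m)
    case (Suc m)
    have "sum g {..<n (Suc m)} = sum g {..<n m} + sum g (blk m)"
      unfolding blk_def atLeast0LessThan[symmetric] using nN[rule_format, of m]
      by (subst sum.atLeastLessThan_concat) auto
    then show ?case using Suc by simp
  qed (simp add: n0)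
  have nge: "k \<le> n k" for k
  proof (induction k)
    case (Suc k)
    then show ?case using nN[rule_format, of k] by simp
  qed simp
  have blk_disj: "i \<notin> blk m" if "i \<in> blk k" "m \<noteq> k" for i k m
  proof -
    have mono: "n a \<le> n b" if "a \<le> b" for a b
      using that by (rule lift_Suc_mono_le[rotated]) (use nN in \<open>simp add: le_SucI\<close>)
    show ?thesis
      using that mono[of "Suc m" k] mono[of "Suc k" m] by (cases "m < k") (auto simp: blk_def)
  qed
  have blk_ex: "\<exists>k. i \<in> blk k" for i
  proof -
    define k where "k = (LEAST k. i < n (Suc k))"
    have "i < n (Suc i)" using nge[of "Suc i"] by simp
    then have k1: "i < n (Suc k)" unfolding k_def by (rule LeastI)
    have "n k \<le> i"
    proof (cases k)
      case (Suc l)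
      then have "\<not> i < n (Suc l)" unfolding k_def by (intro not_less_Least) simp
      then show ?thesis using Suc by simp
    qed (simp add: n0)
    then show ?thesis using k1 by (auto simp: blk_def)
  qed
  have Vblk: "norm (\<Sum>i\<in>blk k. scale (c i) (v i)) \<le> (A + 1) * sqrt (\<Sum>i\<in>blk k. (norm (c i))\<^sup>2)" for k c
  proof -
    let ?s = "\<Sum>i=n k..<N k. (norm (c i))\<^sup>2"
    have s0: "0 \<le> ?s" by (intro sum_nonneg) auto
    have "norm (\<Sum>i\<in>blk k. scale (c i) (v i)) \<le> norm (\<Sum>i=n k..<N k. scale (c i) (v i)) + norm (scale (c (N k)) (v (N k)))"
      unfolding blk_split by (rule norm_triangle_ineq)
    also have "\<dots> \<le> A * sqrt ?s + norm (c (N k))"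
      using V vN by (intro add_mono) (auto simp: norm_scale)
    also have "\<dots> \<le> A * sqrt (?s + (norm (c (N k)))\<^sup>2) + sqrt (?s + (norm (c (N k)))\<^sup>2)"
      using A s0 by (intro add_mono mult_left_mono real_le_rsqrt) auto
    finally show ?thesis unfolding blk_split by (simp add: distrib_right)
  qed
  have tail_n: "norm (T x) \<le> (C + 1) * (1 / 4) ^ k * norm x" if x: "\<forall>i<n k. coord x i = 0" for k x
  proof (cases k)
    case 0
    have "norm (T x) \<le> C * norm x" by (rule C)
    also have "\<dots> \<le> (C + 1) * norm x" by (intro mult_right_mono) auto
    finally show ?thesis using 0 by simp
  next
    case (Suc l)
    have "norm (T x) \<le> (1 / 4) ^ Suc l * norm x" using tail x nN Suc by simp
    also have "\<dots> \<le> (C + 1) * (1 / 4) ^ Suc l * norm x"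
      using C(1) by (intro mult_right_mono) auto
    finally show ?thesis using Suc by simp
  qed
  define D where "D = (C + 1) * A + 1"
  have D0: "0 \<le> D" using C(1) A by (simp add: D_def)
  have Wblk: "norm (\<Sum>i\<in>blk k. ell2_scale (w i y) (T (unit_ell2 i))) \<le> D * (1 / 4) ^ k * norm y" for k y
  proof -
    let ?f = "finite_part {n k..<N k} (\<lambda>i. w i y)"
    have Tf: "T ?f = (\<Sum>i=n k..<N k. ell2_scale (w i y) (T (unit_ell2 i)))"
      by (simp add: finite_part_def T.sum T.scale)
    have nf: "norm ?f = sqrt (\<Sum>i=n k..<N k. (norm (w i y))\<^sup>2)"
      using norm_finite_part[of "{n k..<N k}" "\<lambda>i. w i y"] by (metis finite_atLeastLessThan norm_ge_zero real_sqrt_unique)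
    have "norm (T ?f) \<le> (C + 1) * (1 / 4) ^ k * norm ?f"
      by (rule tail_n) (auto simp: coord_finite_part)
    also have "\<dots> \<le> (C + 1) * (1 / 4) ^ k * (A * norm y)"
      unfolding nf using C(1) W by (intro mult_left_mono) auto
    finally have 1: "norm (T ?f) \<le> (C + 1) * (1 / 4) ^ k * (A * norm y)" .
    have "norm (ell2_scale (w (N k) y) (T (unit_ell2 (N k)))) \<le> (1 / 4) ^ Suc k * norm y"
      unfolding E.norm_scale using last by blast
    also have "\<dots> \<le> (1 / 4) ^ k * norm y" by (intro mult_right_mono) auto
    finally have 2: "norm (ell2_scale (w (N k) y) (T (unit_ell2 (N k)))) \<le> (1 / 4) ^ k * norm y" .
    have "norm (\<Sum>i\<in>blk k. ell2_scale (w i y) (T (unit_ell2 i)))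
        \<le> norm (T ?f) + norm (ell2_scale (w (N k) y) (T (unit_ell2 (N k))))"
      unfolding blk_split Tf by (rule norm_triangle_ineq)
    also have "\<dots> \<le> D * (1 / 4) ^ k * norm y" using 1 2 by (simp add: D_def algebra_simps)
    finally show ?thesis .
  qed
  \<comment> \<open>The weights \<open>2\<^sup>-\<^sup>k\<close> and \<open>2\<^sup>k\<close> split the decay \<open>4\<^sup>-\<^sup>k\<close> of \<open>T\<close> on the blocks evenly between the two
    factors.\<close>
  define S1 where "S1 = (\<lambda>k x. \<Sum>i\<in>blk k. scale (coord x i) (scale (of_real ((1 / 2) ^ k)) (v i)))"
  define S2 where "S2 = (\<lambda>k y. \<Sum>i\<in>blk k. ell2_scale (w i y) (ell2_scale (of_real (2 ^ k)) (T (unit_ell2 i))))"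
  have S1_eq: "S1 k x = scale (of_real ((1 / 2) ^ k)) (\<Sum>i\<in>blk k. scale (coord x i) (v i))" for k x
    unfolding S1_def scale_sum_right by (simp add: mult.commute)
  have S2_eq: "S2 k y = ell2_scale (of_real (2 ^ k)) (\<Sum>i\<in>blk k. ell2_scale (w i y) (T (unit_ell2 i)))" for k y
    unfolding S2_def E.scale_sum_right by (simp add: mult.commute)
  have b1: "norm (S1 k x) \<le> (A + 1) * (1 / 2) ^ k * norm x" for k x
  proof -
    have "sqrt (\<Sum>i\<in>blk k. (norm (coord x i))\<^sup>2) \<le> norm x"
      using sum_coord_le[OF finblk] by (intro real_le_lsqrt) auto
    then have "norm (\<Sum>i\<in>blk k. scale (coord x i) (v i)) \<le> (A + 1) * norm x"
      using A by (intro order_trans[OF Vblk] mult_left_mono) auto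
    then have "(1 / 2) ^ k * norm (\<Sum>i\<in>blk k. scale (coord x i) (v i)) \<le> (1 / 2) ^ k * ((A + 1) * norm x)"
      by (intro mult_left_mono) auto
    then show ?thesis unfolding S1_eq norm_scale norm_of_real by (simp add: mult_ac)
  qed
  have b2: "norm (S2 k y) \<le> D * (1 / 2) ^ k * norm y" for k y
  proof -
    have "2 ^ k * norm (\<Sum>i\<in>blk k. ell2_scale (w i y) (T (unit_ell2 i))) \<le> 2 ^ k * (D * (1 / 4) ^ k * norm y)"
      by (intro mult_left_mono Wblk) auto
    also have "\<dots> = D * (2 * (1 / 4)) ^ k * norm y" unfolding power_mult_distrib by (simp add: mult_ac)
    finally show ?thesis unfolding S2_eq E.norm_scale norm_of_real by simp
  qed
  have wadd: "w i (x + y) = w i x + w i y" and wscale: "w i (scale a x) = a * w i x"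
    and wbound: "\<exists>C. \<forall>x. norm (w i x) \<le> C * norm x" for i a x y
    using w by (auto simp: continuous_form_def linear_form_def)
  define T1 where "T1 = (\<lambda>x. \<Sum>k. S1 k x)"
  define T2 where "T2 = (\<lambda>y. \<Sum>k. S2 k y)"
  have cbound: "\<exists>C. \<forall>x :: 'k ell2. norm (coord x i) \<le> C * norm x" for i
    by (rule exI[of _ 1]) (simp add: norm_coord_le)
  note series1 = compact_operator_series[OF normed_space_over_ell2 assms(3),
      where c = "\<lambda>k i x. coord x i" and S = S1 and I = blk
        and u = "\<lambda>k i. scale (of_real ((1 / 2) ^ k)) (v i)" and M = "A + 1",
      OF coord_add coord_scale cbound S1_def[THEN fun_cong, THEN fun_cong] b1]
  note series2 = compact_operator_series[OF assms(3) normed_space_over_ell2,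
      where c = "\<lambda>k i. w i" and S = S2 and I = blk
        and u = "\<lambda>k i. ell2_scale (of_real (2 ^ k)) (T (unit_ell2 i))" and M = D,
      OF wadd wscale wbound S2_def[THEN fun_cong, THEN fun_cong] b2 D0]
  have sum1: "summable (\<lambda>k. S1 k x)" for x by (rule series1(1)) (use A in simp)
  have c1: "compact_operator ell2_scale scale T1" unfolding T1_def by (rule series1(2)) (use A in simp)
  have sum2: "summable (\<lambda>k. S2 k y)" for y by (rule series2(1))
  have c2: "compact_operator scale ell2_scale T2" unfolding T2_def by (rule series2(2))
  have wT1: "w i (T1 x) = of_real ((1 / 2) ^ k) * coord x i" if i: "i \<in> blk k" for i k x
  proof -
    obtain K where K: "\<And>x. norm (w i x) \<le> norm x * K" using wbound[of i] by (auto simp: mult.commute)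
    have bl: "bounded_linear (w i)"
    proof (rule bounded_linear_intro[OF wadd _ K])
      show "w i (r *\<^sub>R y) = r *\<^sub>R w i y" for r y
        unfolding norm_scaleR_scale wscale by (simp add: scaleR_conv_of_real)
    qed
    have wS: "w i (S1 m x) = (if m = k then of_real ((1 / 2) ^ k) * coord x i else 0)" for m
    proof -
      have lin: "linear_form (w i)" using w by (simp add: continuous_form_def)
      have "w i (S1 m x) = of_real ((1 / 2) ^ m) * (\<Sum>j\<in>blk m. if j = i then coord x i else 0)"
        unfolding S1_eq wscale linear_form_sum[OF lin] using wv
        by (intro arg_cong2[where f = "(*)"] sum.cong refl) auto
      also have "(\<Sum>j\<in>blk m. if j = i then coord x i else 0) = (if i \<in> blk m then coord x i else 0)"
        using finblk by simp
      finally show ?thesis using i blk_disj[OF i, of m] by auto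
    qed
    have "w i (T1 x) = (\<Sum>m. w i (S1 m x))"
      unfolding T1_def by (rule bounded_linear.suminf[OF bl sum1])
    also have "\<dots> = (\<Sum>m\<in>{k}. w i (S1 m x))"
      by (rule suminf_finite) (auto simp: wS)
    finally show ?thesis by (simp add: wS)
  qed
  have fact: "T x = T2 (T1 x)" for x
  proof -
    have S2T1: "S2 k (T1 x) = (\<Sum>i\<in>blk k. T (ell2_scale (coord x i) (unit_ell2 i)))" for k
    proof -
      have "of_real (2 ^ k) * (of_real ((1 / 2) ^ k) :: 'k) = 1"
        unfolding of_real_mult[symmetric] power_mult_distrib[symmetric] by simp
      then show ?thesis
        unfolding S2_def by (intro sum.cong refl) (simp add: wT1 T.scale mult_ac)
    qed
    have "(\<Sum>k<m. S2 k (T1 x)) = T (finite_part {..<n m} (coord x))" for m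
      unfolding S2T1 part finite_part_def T.sum ..
    then have 1: "(\<lambda>m. T (finite_part {..<n m} (coord x))) \<longlonglongrightarrow> T2 (T1 x)"
      using summable_LIMSEQ[OF sum2[of "T1 x"]] by (simp add: T2_def)
    have "filterlim n at_top sequentially"
      by (rule filterlim_at_top_mono[OF filterlim_ident]) (simp add: nge)
    then have lim: "(\<lambda>m. finite_part {..<n m} (coord x)) \<longlonglongrightarrow> x"
      by (rule filterlim_compose[OF finite_part_tendsto])
    have bl: "bounded_linear T"
    proof (rule bounded_linear_intro[where K = C])
      show "T (r *\<^sub>R y) = r *\<^sub>R T y" for r y
        unfolding E.norm_scaleR_scale T.scale ..
    qed (auto simp: T.add C(2) mult.commute)
    have "(\<lambda>m. T (finite_part {..<n m} (coord x))) \<longlonglongrightarrow> T x"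
      by (rule bounded_linear.tendsto[OF bl lim])
    then show ?thesis using 1 by (rule LIMSEQ_unique)
  qed
  interpret T1: Vector_Spaces.linear ell2_scale scale T1
    using c1 by (simp add: compact_operator_def bounded_operator_def)
  have v_range: "v i = T1 (ell2_scale (of_real (2 ^ k)) (unit_ell2 i))" if i: "i \<in> blk k" for i k
  proof -
    have S1u: "S1 m (unit_ell2 i) = (if m = k then scale (of_real ((1 / 2) ^ k)) (v i) else 0)" for m
    proof -
      have "S1 m (unit_ell2 i) = scale (of_real ((1 / 2) ^ m)) (\<Sum>j\<in>blk m. if j = i then v i else 0)"
        unfolding S1_eq by (intro arg_cong2[where f = scale] sum.cong refl) (auto simp: coord_unit)
      also have "(\<Sum>j\<in>blk m. if j = i then v i else 0) = (if i \<in> blk m then v i else 0)"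
        using finblk by simp
      finally show ?thesis using i blk_disj[OF i, of m] by auto
    qed
    have "T1 (unit_ell2 i) = (\<Sum>m\<in>{k}. S1 m (unit_ell2 i))"
      unfolding T1_def by (rule suminf_finite) (auto simp: S1u)
    also have "\<dots> = scale (of_real ((1 / 2) ^ k)) (v i)" by (simp add: S1u)
    finally have "T1 (ell2_scale (of_real (2 ^ k)) (unit_ell2 i)) = scale (of_real (2 ^ k) * of_real ((1 / 2) ^ k)) (v i)"
      unfolding T1.scale by simp
    also have "of_real (2 ^ k) * (of_real ((1 / 2) ^ k) :: 'k) = 1"
      unfolding of_real_mult[symmetric] power_mult_distrib[symmetric] by simp
    finally show ?thesis by simp
  qed
  have "Ds \<subseteq> range T1"
  proof
    fix d assume "d \<in> Ds"
    then obtain k where "d = X k" using rX by blast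
    then obtain a where d: "d = (\<Sum>i<n (Suc k). scale (a i) (v i))" using Xv by blast
    have "\<forall>i. \<exists>u. v i = T1 u" using blk_ex v_range by blast
    then obtain u where u: "\<And>i. v i = T1 (u i)" by metis
    have "d = T1 (\<Sum>i<n (Suc k). ell2_scale (a i) (u i))"
      unfolding d T1.sum T1.scale u ..
    then show "d \<in> range T1" by blast
  qed
  then have "closure (range T1) = UNIV"
    using closure_mono[of Ds "range T1"] Ds(2) by auto
  moreover have "T = T2 \<circ> T1" using fact by (auto simp: fun_eq_iff)
  ultimately show ?thesis using c1 c2 by blast
qed

end
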